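(* Let $K$ be a field of characteristic $0$. Let $S$ be a smooth rational quadric in $\mathbb{P}^3_K$ such that $S\not\simeq\mathbb{P}^1_K\times\mathbb{P}^1_K$. Then $$J(\operatorname{Aut}(S))\leqslant 120.$$
   Context: For a finite group $G$, the Jordan constant $J(G)$ is the smallest index of a normal abelian subgroup of $G$. An arbitrary group $\Gamma$ is called Jordan if $J(\Gamma)=\sup\{J(G) : G\subseteq\Gamma,\ |G|<\infty\}$ is finite, and then $J(\Gamma)$ is called the Jordan constant of $\Gamma$. $\operatorname{Aut}(S)$ is the group of automorphisms of $S$ as a variety over $K$, and isomorphism of surfaces is over $K$. A quadric in $\mathbb{P}^3_K$ is a surface defined by a quadratic form over $K$; "rational" means rational over $K$ (birational to $\mathbb{P}^2_K$ over $K$); a smooth two-dimensional quadric is rational if and only if it contains a $K$-rational point. *)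

theory Defs
  imports
    "HOL-Library.Poly_Mapping"
    "HOL-Library.Numeral_Type"
    "HOL-Library.Extended_Nat"
    "HOL-Algebra.Bij"
    "HOL-Algebra.Coset"
    "HOL-Algebra.Algebraic_Closure_Type"
    "HOL-Analysis.Finite_Cartesian_Product"
begin

section \<open>Polynomials over \<open>K\<close> in variables indexed by a finite type\<close>

text \<open>
  The ground field \<open>K\<close> is the type \<open>'k\<close>. A monomial is the map sending a variable to its exponent,
  and a polynomial is the map sending a monomial to its coefficient.
\<close>

type_synonym ('k, 'i) mpoly = "('i \<Rightarrow>\<^sub>0 nat) \<Rightarrow>\<^sub>0 'k"

text \<open>Polynomials have coefficients in \<open>K\<close>, but are evaluated at vectors over the algebraic closure.\<close>

definition mpoly_eval :: "('k::field, 'i::finite) mpoly \<Rightarrow> 'k alg_closure ^ 'i \<Rightarrow> 'k alg_closure" where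
  "mpoly_eval f x = (\<Sum>m\<in>Poly_Mapping.keys f.
     to_ac (Poly_Mapping.lookup f m) * (\<Prod>i\<in>UNIV. (x $ i) ^ Poly_Mapping.lookup m i))"

definition homogeneous :: "nat \<Rightarrow> ('k::zero, 'i::finite) mpoly \<Rightarrow> bool" where
  "homogeneous d f \<longleftrightarrow> (\<forall>m\<in>Poly_Mapping.keys f. (\<Sum>i\<in>UNIV. Poly_Mapping.lookup m i) = d)"

text \<open>
  In the definition of the formal partial derivative the subtraction of exponents is truncated, but
  a monomial not involving the variable \<open>i\<close> gets coefficient \<open>0\<close>.
\<close>

definition partial_deriv :: "'i::finite \<Rightarrow> ('k::field, 'i) mpoly \<Rightarrow> ('k, 'i) mpoly" where
  "partial_deriv i f = (\<Sum>m\<in>Poly_Mapping.keys f.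
     Poly_Mapping.single (m - Poly_Mapping.single i 1)
       (of_nat (Poly_Mapping.lookup m i) * Poly_Mapping.lookup f m))"


section \<open>Projective space and its subvarieties\<close>

text \<open>
  A variety over \<open>K\<close> (of characteristic \<open>0\<close>, hence perfect) is represented by its set of points over
  the algebraic closure of \<open>K\<close>; the \<open>K\<close>-structure is recorded by admitting only polynomials with
  coefficients in \<open>K\<close> in the definitions of the Zariski topology and of morphisms. So the open sets
  below are exactly the open subschemes over \<open>K\<close>, and the morphisms are exactly the
  \<open>K\<close>-morphisms of reduced quasi-projective schemes over \<open>K\<close>.

  A point of the projective space is the set of all its vectors of homogeneous coordinates.
  The type \<open>'i\<close> indexes the homogeneous coordinates, so the dimension is \<open>CARD('i) - 1\<close>.
\<close>

type_synonym ('k, 'i) point = "('k alg_closure ^ 'i) set"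

definition point_of :: "'k::field alg_closure ^ 'i::finite \<Rightarrow> ('k, 'i) point" where
  "point_of x = {c *s x | c. c \<noteq> 0}"

definition proj_space :: "('k::field, 'i::finite) point set" where
  "proj_space = {point_of x | x. x \<noteq> 0}"

definition zero_locus :: "('k::field, 'i::finite) mpoly set \<Rightarrow> ('k, 'i) point set" where
  "zero_locus T = {P \<in> proj_space. \<forall>f\<in>T. \<forall>x\<in>P. mpoly_eval f x = 0}"

definition zariski_open :: "('k::field, 'i::finite) point set \<Rightarrow> bool" where
  "zariski_open U \<longleftrightarrow>
     (\<exists>T. (\<forall>f\<in>T. \<exists>d. homogeneous d f) \<and> U = proj_space - zero_locus T)"

text \<open>
  Locally around each point, a morphism into a projective space is given by forms of the same degree
  over \<open>K\<close>. As the elements of \<open>\<phi> Q\<close> are nonzero vectors, these forms have no common zero near the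
  point.
\<close>

definition is_morphism ::
  "('k::field, 'i::finite) point set \<Rightarrow> ('k, 'j::finite) point set \<Rightarrow>
   (('k, 'i) point \<Rightarrow> ('k, 'j) point) \<Rightarrow> bool" where
  "is_morphism V W \<phi> \<longleftrightarrow> \<phi> \<in> V \<rightarrow> W \<and>
     (\<forall>P\<in>V. \<exists>U d. \<exists>F :: 'j \<Rightarrow> ('k, 'i) mpoly.
        zariski_open U \<and> P \<in> U \<and> (\<forall>j. homogeneous d (F j)) \<and>
        (\<forall>Q\<in>V \<inter> U. \<forall>x\<in>Q. (\<chi> j. mpoly_eval (F j) x) \<in> \<phi> Q))"

definition isomorphic_var ::
  "('k::field, 'i::finite) point set \<Rightarrow> ('k, 'j::finite) point set \<Rightarrow> bool" where
  "isomorphic_var V W \<longleftrightarrow> (\<exists>\<phi> \<psi>. is_morphism V W \<phi> \<and> is_morphism W V \<psi> \<and>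
     (\<forall>P\<in>V. \<psi> (\<phi> P) = P) \<and> (\<forall>Q\<in>W. \<phi> (\<psi> Q) = Q))"

definition dense_open_in ::
  "('k::field, 'i::finite) point set \<Rightarrow> ('k, 'i) point set \<Rightarrow> bool" where
  "dense_open_in U V \<longleftrightarrow> (\<exists>N. zariski_open N \<and> U = V \<inter> N) \<and>
     (\<forall>N. zariski_open N \<and> V \<inter> N \<noteq> {} \<longrightarrow> U \<inter> N \<noteq> {})"

definition birational ::
  "('k::field, 'i::finite) point set \<Rightarrow> ('k, 'j::finite) point set \<Rightarrow> bool" where
  "birational V W \<longleftrightarrow>
     (\<exists>U U'. dense_open_in U V \<and> dense_open_in U' W \<and> isomorphic_var U U')"

definition rational_surface :: "('k::field, 'i::finite) point set \<Rightarrow> bool" where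
  "rational_surface V \<longleftrightarrow> birational V (proj_space :: ('k, 3) point set)"

text \<open>The product of projective varieties, as a projective variety via the Segre embedding.\<close>

definition product_var ::
  "('k::field, 'i::finite) point set \<Rightarrow> ('k, 'j::finite) point set \<Rightarrow> ('k, 'i \<times> 'j) point set"
  where
  "product_var V W = {point_of (\<chi> p. x $ fst p * y $ snd p) | x y.
     x \<noteq> 0 \<and> y \<noteq> 0 \<and> point_of x \<in> V \<and> point_of y \<in> W}"

text \<open>
  The Jacobian criterion, at all geometric points. It refers to the defining form, so that it
  excludes forms that define a non-reduced scheme.
\<close>

definition smooth_hypersurface :: "('k::field, 'i::finite) mpoly \<Rightarrow> bool" where
  "smooth_hypersurface f \<longleftrightarrow>
     (\<forall>x. x \<noteq> 0 \<and> mpoly_eval f x = 0 \<longrightarrow> (\<exists>i. mpoly_eval (partial_deriv i f) x \<noteq> 0))"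


section \<open>Automorphism groups\<close>

text \<open>
  Automorphisms are made extensional (as in \<^const>\<open>Bij\<close>), so that each one is represented by only
  one function.
\<close>

definition Aut ::
  "('k::field, 'i::finite) point set \<Rightarrow> (('k, 'i) point \<Rightarrow> ('k, 'i) point) monoid" where
  "Aut V = (BijGroup V)
     \<lparr>carrier := {\<phi> \<in> Bij V. is_morphism V V \<phi> \<and> is_morphism V V (inv_into V \<phi>)}\<rparr>"


section \<open>Jordan constants\<close>

definition finite_jordan_constant :: "('a, 'b) monoid_scheme \<Rightarrow> nat" where
  "finite_jordan_constant G =
     (LEAST n. \<exists>A. A \<lhd> G \<and> comm_group (G\<lparr>carrier := A\<rparr>) \<and> n = card (rcosets\<^bsub>G\<^esub> A))"

text \<open>The value \<open>\<infinity>\<close> means that the group is not Jordan.\<close>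

definition jordan_constant :: "('a, 'b) monoid_scheme \<Rightarrow> enat" where
  "jordan_constant \<Gamma> = (SUP H\<in>{H. subgroup H \<Gamma> \<and> finite H}.
     enat (finite_jordan_constant (\<Gamma>\<lparr>carrier := H\<rparr>)))"

end

theory Submission
  imports Defs "HOL-Algebra.Group_Action" "HOL-Analysis.Determinants"
begin

text \<open>
  A quadric with a rational point becomes \<open>x y = z\<^sup>2 - d w\<^sup>2\<close> in suitable coordinates over \<open>K\<close>. If
  \<open>d\<close> is a square, it is the Segre quadric; so let \<open>\<delta> = \<surd>d \<notin> K\<close>. Over the algebraic closure the surface consists
  of the rank one matrices \<open>u v\<^sup>T\<close>, and every automorphism has the form \<open>(u, v) \<mapsto> (A u, B v)\<close> or
  \<open>(u, v) \<mapsto> (A v, B u)\<close>. So a subgroup \<open>G\<^sub>0\<close> of index at most \<open>2\<close> of a finite group \<open>G\<close> of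
  automorphisms acts on the projective line of the lines of one ruling. This action is faithful because \<open>\<delta>\<close> has
  a conjugate over \<open>K\<close> and conjugation interchanges the rulings. Every nontrivial element of \<open>G\<^sub>0\<close> has
  exactly two fixed points and the stabilizers of points are abelian. Counting fixed points shows that either
  \<open>|G\<^sub>0| \<le> 60\<close>, and the trivial group has index at most \<open>120\<close> in \<open>G\<close>, or some stabilizer \<open>C\<close> has index at
  most \<open>2\<close> in \<open>G\<^sub>0\<close>. In the latter case the intersection of \<open>C\<close> with a conjugate is an abelian normal
  subgroup of index at most \<open>8\<close> in \<open>G\<close>.
\<close>

text \<open>In the split case the two factors can move independently, so the action on one ruling
  has a kernel. Over the algebraic closure nothing ties \<open>A\<close> to \<open>B\<close>; the
  tie comes from three \<open>K\<close>-points of the surface, whose images are rational again, and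
  rationality makes the two factors of a point conjugate. The obstacle before that is to know the
  automorphisms at all, since a morphism is only locally given by forms. Removing a greatest common
  divisor yields one global formula for each factor of the image, and the bidegrees of such formulas
  compose like matrices; an invertible morphism is therefore linear in each factor. Elements have
  two fixed points because finite order in characteristic 0 excludes a double eigenvalue.
  Stabilizers are abelian because a commutator in one has both eigenvalues equal to 1. The number 60
  is the order of the icosahedral group, the largest of the solutions 12, 24, 60 of the orbit
  equation. The number 8 comes from three steps of index at most 2: to the subgroup that preserves
  the rulings, to a point stabilizer in it, and to the intersection with a conjugate.\<close>

no_notation fps_nth (infixl \<open>$\<close> 75)

section \<open>Bihomogeneous polynomials\<close>

text \<open>\<open>hom1 n p\<close> and \<open>bihom n m p\<close> are homogenizations: a polynomial is only meaningful here together with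
  bounds for its degrees. In \<open>p :: 'c poly poly\<close> the inner variable is \<open>t / s\<close> and the outer one \<open>b / a\<close>.\<close>

definition hom1 :: "nat \<Rightarrow> 'c::comm_ring_1 poly \<Rightarrow> 'c \<Rightarrow> 'c \<Rightarrow> 'c" where
  "hom1 n p s t = (\<Sum>i\<le>n. coeff p i * t ^ i * s ^ (n - i))"

lemma hom1_zero [simp]: "hom1 n 0 s t = 0"
  by (simp add: hom1_def)

lemma hom1_add: "hom1 n (p + q) s t = hom1 n p s t + hom1 n q s t"
  by (simp add: hom1_def sum.distrib algebra_simps)

lemma hom1_smult: "hom1 n (smult c p) s t = c * hom1 n p s t"
  by (simp add: hom1_def sum_distrib_left algebra_simps)

lemma hom1_pCons: "hom1 (Suc n) (pCons a p) s t = a * s ^ Suc n + t * hom1 n p s t"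
  by (simp add: hom1_def sum.atMost_Suc_shift sum_distrib_left algebra_simps del: sum.atMost_Suc)

lemma hom1_const: "hom1 n [:a:] s t = a * s ^ n"
  by (cases n) (simp_all add: hom1_pCons, simp add: hom1_def)

lemma hom1_Suc:
  assumes "degree p \<le> n"
  shows "hom1 (Suc n) p s t = s * hom1 n p s t"
proof -
  have "coeff p (Suc n) = 0" using assms by (simp add: coeff_eq_0)
  then show ?thesis
    by (simp add: hom1_def sum_distrib_left Suc_diff_le algebra_simps)
qed

lemma hom1_raise:
  assumes "degree p \<le> n"
  shows "hom1 (k + n) p s t = s ^ k * hom1 n p s t"
  by (induction k) (use assms in \<open>simp_all add: hom1_Suc algebra_simps\<close>)

text \<open>Coefficients beyond the nominal degree are cut off by \<open>hom1\<close>, so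
  multiplicativity depends on the degree bounds. The induction splits off the constant coefficient
  of \<open>p\<close>, which leaves a multiple of \<open>q\<close> to be padded by a power of
  \<open>s\<close>.\<close>

lemma hom1_mult:
  assumes "degree p \<le> n" "degree q \<le> m"
  shows "hom1 (n + m) (p * q) s t = hom1 n p s t * hom1 m q s t"
  using assms(1)
proof (induction n arbitrary: p)
  case 0
  then obtain a where "p = [:a:]" using degree_eq_zeroE by auto
  then show ?case by (simp add: hom1_smult hom1_const)
next
  case (Suc n)
  obtain a p' where p: "p = pCons a p'" by (cases p)
  have "degree p' \<le> n" using Suc.prems p by (cases "p' = 0") auto
  then show ?case
    using hom1_raise[OF assms(2), of "Suc n"]
    by (simp add: p hom1_add hom1_smult hom1_pCons Suc.IH) (simp add: algebra_simps)
qed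

lemma hom1_at_1:
  assumes "degree p \<le> n"
  shows "hom1 n p 1 t = poly p t"
proof -
  have "(\<Sum>i\<le>n. coeff p i * t ^ i) = (\<Sum>i\<le>degree p. coeff p i * t ^ i)"
    by (rule sum.mono_neutral_right) (use assms in \<open>auto intro: le_degree\<close>)
  then show ?thesis by (simp add: hom1_def poly_altdef)
qed

text \<open>The value at infinity is the coefficient at the nominal degree, even where that exceeds
  the true degree. Through it, \<open>hom1_mult\<close> also yields multiplicativity of top
  coefficients.\<close>

lemma hom1_at_0: "hom1 n p 0 1 = coeff p n"
  by (simp add: hom1_def power_0_left flip: sum.delta) (simp add: if_distrib sum.delta cong: if_cong)

section \<open>Polynomials homogenized in two pairs of variables\<close>

definition bideg :: "nat \<Rightarrow> nat \<Rightarrow> 'c::comm_ring_1 poly poly \<Rightarrow> bool" where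
  "bideg n m p \<longleftrightarrow> degree p \<le> m \<and> (\<forall>j. degree (coeff p j) \<le> n)"

definition bihom :: "nat \<Rightarrow> nat \<Rightarrow> 'c::comm_ring_1 poly poly \<Rightarrow> 'c \<Rightarrow> 'c \<Rightarrow> 'c \<Rightarrow> 'c \<Rightarrow> 'c" where
  "bihom n m p s t a b = (\<Sum>j\<le>m. hom1 n (coeff p j) s t * b ^ j * a ^ (m - j))"

lemma bihom_zero [simp]: "bihom n m 0 s t a b = 0"
  by (simp add: bihom_def)

lemma bihom_add: "bihom n m (p + q) s t a b = bihom n m p s t a b + bihom n m q s t a b"
  by (simp add: bihom_def hom1_add sum.distrib algebra_simps)

lemma bihom_pCons:
  "bihom n (Suc m) (pCons c p) s t a b = hom1 n c s t * a ^ Suc m + b * bihom n m p s t a b"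
  by (simp add: bihom_def sum.atMost_Suc_shift sum_distrib_left algebra_simps del: sum.atMost_Suc)

lemma bihom_const: "bihom n m [:c:] s t a b = hom1 n c s t * a ^ m"
  by (cases m) (simp_all add: bihom_pCons, simp add: bihom_def)

lemma bihom_raise:
  assumes "degree p \<le> m"
  shows "bihom n (k + m) p s t a b = a ^ k * bihom n m p s t a b"
proof (induction k)
  case (Suc k)
  have "coeff p (Suc (k + m)) = 0" using assms by (simp add: coeff_eq_0)
  then have "bihom n (Suc (k + m)) p s t a b = a * bihom n (k + m) p s t a b"
    by (simp add: bihom_def sum_distrib_left Suc_diff_le algebra_simps)
  with Suc show ?case by simp
qed simp

lemma bihom_smult:
  assumes "degree c \<le> n" "\<And>j. degree (coeff q j) \<le> n'"
  shows "bihom (n + n') m (smult c q) s t a b = hom1 n c s t * bihom n' m q s t a b"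
  using assms by (simp add: bihom_def hom1_mult sum_distrib_left algebra_simps)

lemma bihom_mult:
  assumes "bideg n m p" "bideg n' m' q"
  shows "bihom (n + n') (m + m') (p * q) s t a b = bihom n m p s t a b * bihom n' m' q s t a b"
  using assms(1)
proof (induction m arbitrary: p)
  case 0
  then obtain c where c: "p = [:c:]" using degree_eq_zeroE by (auto simp: bideg_def)
  have "degree c \<le> n" using 0 c by (auto simp: bideg_def dest: spec[of _ 0])
  then show ?case using assms(2) by (simp add: c bihom_smult bihom_const bideg_def)
next
  case (Suc m)
  obtain c p' where p: "p = pCons c p'" by (cases p)
  have "degree p' \<le> m" using Suc.prems p by (cases "p' = 0") (auto simp: bideg_def)
  moreover have c: "degree (coeff p j) \<le> n" for j using Suc.prems by (simp add: bideg_def)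
  have "degree (coeff p' j) \<le> n" for j using c[of "Suc j"] by (simp add: p)
  ultimately have IH: "bihom (n + n') (m + m') (p' * q) s t a b = bihom n m p' s t a b * bihom n' m' q s t a b"
    by (intro Suc.IH) (simp add: bideg_def)
  have "bihom (n + n') (Suc m + m') (smult c q) s t a b = a ^ Suc m * bihom (n + n') m' (smult c q) s t a b"
    using assms(2) degree_smult_le[of c q] by (intro bihom_raise) (auto simp: bideg_def)
  also have "\<dots> = a ^ Suc m * (hom1 n c s t * bihom n' m' q s t a b)"
    using c[of 0] assms(2) by (subst bihom_smult) (auto simp: p bideg_def)
  finally show ?case
    by (simp add: p bihom_add bihom_pCons IH) (simp add: algebra_simps)
qed

lemma bideg_add: "bideg n m p \<Longrightarrow> bideg n m q \<Longrightarrow> bideg n m (p + q)"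
  by (auto simp: bideg_def intro: degree_add_le)

lemma bideg_mult:
  assumes "bideg n m p" "bideg n' m' q"
  shows "bideg (n + n') (m + m') (p * q)"
proof -
  have "degree (coeff p i * coeff q k) \<le> n + n'" for i k
    using assms by (meson add_mono bideg_def degree_mult_le order_trans)
  then have "degree (coeff (p * q) j) \<le> n + n'" for j
    unfolding coeff_mult by (intro degree_sum_le) auto
  then show ?thesis
    using assms unfolding bideg_def by (meson add_mono degree_mult_le order_trans)
qed

text \<open>The degree in the inner variable, as \<open>degree\<close> is the one in the outer
  variable. Taken as a least bound, it is 0 for the zero polynomial, in agreement with
  \<open>degree\<close>.\<close>

definition degt :: "'c::comm_ring_1 poly poly \<Rightarrow> nat" where
  "degt p = (LEAST n. \<forall>j. degree (coeff p j) \<le> n)"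

lemma degree_coeff_le_degt: "degree (coeff p j) \<le> degt p"
proof -
  have "\<exists>n. \<forall>j. degree (coeff p j) \<le> n"
  proof (intro exI allI)
    fix j
    show "degree (coeff p j) \<le> (\<Sum>i\<le>degree p. degree (coeff p i))"
    proof (cases "j \<le> degree p")
      case True
      then show ?thesis by (intro member_le_sum) auto
    qed (simp add: coeff_eq_0)
  qed
  then show ?thesis unfolding degt_def by (rule LeastI2_ex) blast
qed

lemma degt_le: "(\<And>j. degree (coeff p j) \<le> n) \<Longrightarrow> degt p \<le> n"
  unfolding degt_def by (rule Least_le) blast

lemma bideg_iff: "bideg n m p \<longleftrightarrow> degt p \<le> n \<and> degree p \<le> m"
  using degt_le degree_coeff_le_degt order_trans unfolding bideg_def by blast

lemma degt_witness:
  assumes "p \<noteq> 0"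
  obtains j where "coeff (coeff p j) (degt p) \<noteq> 0"
proof -
  have "\<exists>j. degree (coeff p j) = degt p \<and> coeff p j \<noteq> 0"
  proof (cases "degt p = 0")
    case True
    then have "degree (coeff p (degree p)) = degt p" 
      using degree_coeff_le_degt[of p "degree p"] by simp
    then show ?thesis using assms leading_coeff_0_iff by blast
  next
    case False
    have "\<exists>j. \<not> degree (coeff p j) \<le> degt p - 1"
      using degt_le[of p "degt p - 1"] False by force
    then obtain j where j: "\<not> degree (coeff p j) \<le> degt p - 1" by blast
    then have "degree (coeff p j) = degt p" 
      using degree_coeff_le_degt[of p j] by linarith
    moreover have "coeff p j \<noteq> 0" using j by auto
    ultimately show ?thesis by blast
  qed
  then show ?thesis using that by (metis leading_coeff_0_iff)
qed

text \<open>The coefficients of the highest inner power form a nonzero polynomial in the outer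
  variable, and for a product these polynomials multiply; over a domain nothing cancels.\<close>

lemma degt_mult:
  fixes p q :: "'c::idom poly poly"
  assumes "p \<noteq> 0" "q \<noteq> 0"
  shows "degt (p * q) = degt p + degt q"
proof (rule antisym)
  show "degt (p * q) \<le> degt p + degt q"
    using bideg_mult[of "degt p" "degree p" p "degt q" "degree q" q] by (simp add: bideg_iff)
  define top where "top n r = map_poly (\<lambda>c. coeff c n) r" for n and r :: "'c poly poly"
  have top: "coeff (top n r) j = coeff (coeff r j) n" for n r j
    by (simp add: top_def coeff_map_poly)
  have top_nz: "top (degt r) r \<noteq> 0" if "r \<noteq> 0" for r
    using degt_witness[OF that] top by (metis coeff_0)
  have lead: "coeff (c * d) (n + m) = coeff c n * coeff d m" if "degree c \<le> n" "degree d \<le> m"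
    for c d :: "'c poly" and n m
    using hom1_mult[OF that, of 0 1] by (simp add: hom1_at_0)
  have "top (degt p + degt q) (p * q) = top (degt p) p * top (degt q) q"
  proof (rule poly_eqI)
    fix j
    have "coeff (coeff (p * q) j) (degt p + degt q)
        = (\<Sum>i\<le>j. coeff (coeff p i * coeff q (j - i)) (degt p + degt q))"
      by (subst coeff_mult) (rule coeff_sum)
    also have "\<dots> = (\<Sum>i\<le>j. coeff (coeff p i) (degt p) * coeff (coeff q (j - i)) (degt q))"
      by (intro sum.cong refl lead degree_coeff_le_degt)
    finally show "coeff (top (degt p + degt q) (p * q)) j = coeff (top (degt p) p * top (degt q) q) j"
      by (simp only: top coeff_mult[of "top (degt p) p"])
  qed
  then have "top (degt p + degt q) (p * q) \<noteq> 0"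
    using top_nz assms by simp
  then obtain j where "coeff (coeff (p * q) j) (degt p + degt q) \<noteq> 0"
    using top by (metis leading_coeff_0_iff)
  then show "degt p + degt q \<le> degt (p * q)"
    using degree_coeff_le_degt[of "p * q" j] le_degree order_trans by blast
qed

section \<open>The affine chart and polynomials without zeros\<close>

definition ev2 :: "'c::comm_ring_1 poly poly \<Rightarrow> 'c \<Rightarrow> 'c \<Rightarrow> 'c" where
  "ev2 p t b = poly (poly p [:b:]) t"

lemma ev2_simps [simp]:
  "ev2 (p + q) t b = ev2 p t b + ev2 q t b" "ev2 (p * q) t b = ev2 p t b * ev2 q t b"
  by (simp_all add: ev2_def)

lemma ev2_diff [simp]: "ev2 (p - q) t b = ev2 p t b - ev2 q t b"
  by (simp add: ev2_def)

lemma ev2_altdef: "ev2 p t b = poly (map_poly (\<lambda>c. poly c t) p) b"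
  by (induction p) (simp_all add: ev2_def map_poly_pCons algebra_simps)

lemma bihom_chart:
  assumes "bideg n m p"
  shows "bihom n m p 1 t 1 b = ev2 p t b"
proof -
  have "bihom n m p 1 t 1 b = (\<Sum>j\<le>m. poly (coeff p j) t * b ^ j)"
    using assms by (simp add: bihom_def bideg_def hom1_at_1)
  also have "\<dots> = (\<Sum>j\<le>degree p. poly (coeff p j) t * b ^ j)"
    by (rule sum.mono_neutral_right) (use assms in \<open>auto simp: bideg_def intro: le_degree\<close>)
  also have "\<dots> = poly (poly p [:b:]) t"
    by (simp add: poly_altdef[of p] poly_sum)
  finally show ?thesis by (simp add: ev2_def)
qed

text \<open>For fixed \<open>b\<close> the polynomial \<open>poly p [:b:]\<close> vanishes at every
  \<open>t\<close>, so each of the infinitely many constants \<open>[:b:]\<close> is a root of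
  \<open>p\<close>.\<close>

lemma ev2_eq_zeroI:
  fixes p :: "'c::field_char_0 poly poly"
  assumes "\<And>t b. ev2 p t b = 0"
  shows "p = 0"
proof (rule ccontr)
  assume "p \<noteq> 0"
  then have fin: "finite {x. poly p x = 0}" by (rule poly_roots_finite)
  have "poly p [:b:] = 0" for b
    using assms[of _ b] by (intro poly_all_0_iff_0[THEN iffD1]) (simp add: ev2_def)
  then have "range (\<lambda>b. [:b:]) \<subseteq> {x. poly p x = 0}" by auto
  then have "finite (range (\<lambda>b::'c. [:b:]))" using fin finite_subset by blast
  then show False
    using finite_imageD[of "\<lambda>b::'c. [:b:]" UNIV] infinite_UNIV_char_0 by (auto simp: inj_on_def)
qed

text \<open>Specializing the inner variable to a value where the leading coefficient survives keeps
  the outer degree, and a root-free polynomial in one variable over an algebraically closed field is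
  constant. So the outer degree is 0, and the same argument applies to the remaining
  coefficient.\<close>

lemma nonvanishing_imp_const:
  fixes p :: "'c::{alg_closed_field,field_char_0} poly poly"
  assumes nz: "\<And>t b. ev2 p t b \<noteq> 0"
  obtains c where "c \<noteq> 0" "p = [:[:c:]:]"
proof -
  have const: "degree r = 0" if "\<And>x. poly r x \<noteq> 0" for r :: "'c poly"
    using that alg_closed_imp_poly_has_root[of r] by blast
  have "p \<noteq> 0" using nz by (auto simp: ev2_def)
  then have "finite {t. poly (lead_coeff p) t = 0}"
    by (intro poly_roots_finite) simp
  then obtain t where t: "poly (lead_coeff p) t \<noteq> 0"
    using infinite_UNIV_char_0[where ?'a='c] by (metis (mono_tags) UNIV_eq_I mem_Collect_eq)
  have "coeff (map_poly (\<lambda>c. poly c t) p) (degree p) \<noteq> 0"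
    using t by (simp add: coeff_map_poly)
  then have "degree p \<le> degree (map_poly (\<lambda>c. poly c t) p)" by (rule le_degree)
  moreover have "degree (map_poly (\<lambda>c. poly c t) p) = 0"
    by (rule const) (use nz in \<open>simp add: ev2_altdef\<close>)
  ultimately obtain c where c: "p = [:c:]" using degree_eq_zeroE by auto
  have "degree c = 0" by (rule const) (use nz in \<open>simp add: ev2_def c\<close>)
  then obtain c' where "c = [:c':]" using degree_eq_zeroE by auto
  then show ?thesis using that[of c'] c \<open>p \<noteq> 0\<close> by auto
qed

section \<open>Bihomogeneous forms as functions\<close>

definition biform :: "nat \<Rightarrow> nat \<Rightarrow> ('c::comm_ring_1 \<Rightarrow> 'c \<Rightarrow> 'c \<Rightarrow> 'c \<Rightarrow> 'c) \<Rightarrow> bool" where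
  "biform n m P \<longleftrightarrow> (\<exists>p. bideg n m p \<and> P = bihom n m p)"

lemma biform_bihom: "bideg n m p \<Longrightarrow> biform n m (bihom n m p)"
  by (auto simp: biform_def)

lemma biform_add:
  assumes "biform n m P" "biform n m Q"
  shows "biform n m (\<lambda>s t a b. P s t a b + Q s t a b)"
proof -
  obtain p q where "bideg n m p" "bideg n m q" "P = bihom n m p" "Q = bihom n m q"
    using assms by (auto simp: biform_def)
  then show ?thesis unfolding biform_def
    by (intro exI[of _ "p + q"]) (auto simp: bideg_add bihom_add fun_eq_iff)
qed

lemma biform_mult:
  assumes "biform n m P" "biform n' m' Q"
  shows "biform (n + n') (m + m') (\<lambda>s t a b. P s t a b * Q s t a b)"
proof -
  obtain p q where "bideg n m p" "bideg n' m' q" "P = bihom n m p" "Q = bihom n' m' q"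
    using assms by (auto simp: biform_def)
  then show ?thesis unfolding biform_def
    by (intro exI[of _ "p * q"]) (auto simp: bideg_mult bihom_mult fun_eq_iff)
qed

lemma biform_const: "biform 0 0 (\<lambda>s t a b. c)"
  unfolding biform_def
  by (rule exI[of _ "[:[:c:]:]"]) (auto simp: bideg_def bihom_const hom1_const fun_eq_iff coeff_pCons split: nat.split)

lemma biform_zero: "biform n m (\<lambda>s t a b. 0)"
  unfolding biform_def
  by (rule exI[of _ 0]) (auto simp: bideg_def fun_eq_iff)

lemma biform_vars:
  "biform 1 0 (\<lambda>s t a b. s)" "biform 1 0 (\<lambda>s t a b. t)"
  "biform 0 1 (\<lambda>s t a b. a)" "biform 0 1 (\<lambda>s t a b. b)"
proof -
  show "biform 1 0 (\<lambda>s t a b. s)" unfolding biform_def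
    by (rule exI[of _ "[:[:1:]:]"])
      (auto simp: bideg_def bihom_const hom1_const fun_eq_iff coeff_pCons split: nat.split)
  show "biform 1 0 (\<lambda>s t a b. t)" unfolding biform_def
    by (rule exI[of _ "[:[:0, 1:]:]"])
      (auto simp: bideg_def bihom_const hom1_pCons hom1_const fun_eq_iff coeff_pCons split: nat.split)
  show "biform 0 1 (\<lambda>s t a b. a)" unfolding biform_def
    by (rule exI[of _ "[:[:1:]:]"])
      (auto simp: bideg_def bihom_const hom1_const fun_eq_iff coeff_pCons split: nat.split)
  show "biform 0 1 (\<lambda>s t a b. b)" unfolding biform_def
    by (rule exI[of _ "[:0, 1:]"])
      (auto simp: bideg_def bihom_pCons bihom_const hom1_const one_pCons fun_eq_iff coeff_pCons split: nat.split)
qed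

lemma biform_scale: "biform n m P \<Longrightarrow> biform n m (\<lambda>s t a b. c * P s t a b)"
  using biform_mult[OF biform_const] by force

lemma biform_power: "biform n m P \<Longrightarrow> biform (k * n) (k * m) (\<lambda>s t a b. P s t a b ^ k)"
  by (induction k) (auto simp: biform_const intro: biform_mult)

lemma biform_sum:
  "(\<And>i. i \<in> I \<Longrightarrow> biform n m (P i)) \<Longrightarrow> biform n m (\<lambda>s t a b. \<Sum>i\<in>I. P i s t a b)"
  by (induction I rule: infinite_finite_induct) (auto simp: biform_zero intro: biform_add)

lemma biform_prod:
  "finite I \<Longrightarrow> (\<And>i. i \<in> I \<Longrightarrow> biform (n i) (m i) (P i)) \<Longrightarrow>
    biform (sum n I) (sum m I) (\<lambda>s t a b. \<Prod>i\<in>I. P i s t a b)"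
  by (induction I rule: finite_induct) (auto simp: biform_const intro: biform_mult)

text \<open>The bidegree of the composite is the row \<open>(i', j')\<close> times the matrix with
  rows \<open>(i, j)\<close> and \<open>(k, l)\<close>. This is the source of the multiplicativity
  of bidegree matrices.\<close>

lemma biform_compose:
  assumes P: "biform i' j' P" and U: "biform i j U1" "biform i j U2" and V: "biform k l V1" "biform k l V2"
  shows "biform (i' * i + j' * k) (i' * j + j' * l)
    (\<lambda>s t a b. P (U1 s t a b) (U2 s t a b) (V1 s t a b) (V2 s t a b))"
proof -
  have H: "biform (n * d) (n * e) (\<lambda>s t a b. hom1 n c (W1 s t a b) (W2 s t a b))"
    if "biform d e W1" "biform d e W2" for n c d e W1 W2
    unfolding hom1_def
  proof (rule biform_sum)
    fix r assume "r \<in> {..n}"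
    then have "n = r + (n - r)" by simp
    then have *: "n * d = r * d + (n - r) * d" "n * e = r * e + (n - r) * e"
      by (metis add_mult_distrib)+
    show "biform (n * d) (n * e) (\<lambda>s t a b. coeff c r * W2 s t a b ^ r * W1 s t a b ^ (n - r))"
      unfolding * by (intro biform_mult biform_scale biform_power that)
  qed
  obtain p where p: "P = bihom i' j' p" using P by (auto simp: biform_def)
  show ?thesis unfolding p bihom_def
  proof (rule biform_sum)
    fix r assume "r \<in> {..j'}"
    then have "j' = r + (j' - r)" by simp
    then have *: "j' * k = r * k + (j' - r) * k" "j' * l = r * l + (j' - r) * l"
      by (metis add_mult_distrib)+
    show "biform (i' * i + j' * k) (i' * j + j' * l) (\<lambda>s t a b.
        hom1 i' (coeff p r) (U1 s t a b) (U2 s t a b) * V2 s t a b ^ r * V1 s t a b ^ (j' - r))"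
      unfolding * add.assoc[symmetric] by (intro biform_mult H biform_power U V)
  qed
qed

lemma biform_1_0:
  assumes "biform 1 0 P"
  obtains c d where "\<And>s t a b. P s t a b = c * s + d * t"
proof -
  obtain p where p: "bideg 1 0 p" "P = bihom 1 0 p" using assms by (auto simp: biform_def)
  show ?thesis
    by (rule that[of "coeff (coeff p 0) 0" "coeff (coeff p 0) 1"])
      (simp add: p bihom_def hom1_def algebra_simps)
qed

lemma biform_0_1:
  assumes "biform 0 1 P"
  obtains c d where "\<And>s t a b. P s t a b = c * a + d * b"
proof -
  obtain p where p: "bideg 0 1 p" "P = bihom 0 1 p" using assms by (auto simp: biform_def)
  show ?thesis
    by (rule that[of "coeff (coeff p 0) 0" "coeff (coeff p 1) 0"])
      (simp add: p bihom_def hom1_def algebra_simps)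
qed

text \<open>A pair without common zeros that represents the first projection must be
  \<open>(s, t)\<close> up to a constant. In the chart \<open>s = a = 1\<close> the form
  \<open>P\<close> has no zeros and is constant there, which determines both forms up to powers of
  \<open>s\<close> and \<open>a\<close>.\<close>

lemma biform_identity_degrees:
  fixes P Q :: "'c::{alg_closed_field,field_char_0} \<Rightarrow> 'c \<Rightarrow> 'c \<Rightarrow> 'c \<Rightarrow> 'c"
  assumes P: "biform n m P" and Q: "biform n m Q"
    and nz: "\<And>s t a b. (s, t) \<noteq> (0, 0) \<Longrightarrow> (a, b) \<noteq> (0, 0) \<Longrightarrow> (P s t a b, Q s t a b) \<noteq> (0, 0)"
    and eq: "\<And>s t a b. (s, t) \<noteq> (0, 0) \<Longrightarrow> (a, b) \<noteq> (0, 0) \<Longrightarrow> P s t a b * t = Q s t a b * s"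
  shows "n = 1 \<and> m = 0"
proof -
  obtain p q where p: "bideg n m p" "P = bihom n m p" and q: "bideg n m q" "Q = bihom n m q"
    using P Q by (auto simp: biform_def)
  have ev_q: "ev2 p t b * t = ev2 q t b" for t b
    using eq[of 1 t 1 b] bihom_chart p q by fastforce
  \<comment> \<open>By \<open>ev_q\<close> a zero of \<open>p\<close> would be a zero of
    \<open>q\<close> too, which \<open>nz\<close> forbids.\<close>
  have "ev2 p t b \<noteq> 0" for t b
    using ev_q[of t b] nz[of 1 t 1 b] bihom_chart p q by fastforce
  then obtain c where c: "c \<noteq> 0" "p = [:[:c:]:]" using nonvanishing_imp_const by blast
  have "q - [:[:0, c:]:] = 0"
    by (rule ev2_eq_zeroI) (simp flip: ev_q, simp add: ev2_def c)
  then have q_eq: "q = [:[:0, c:]:]" by simp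
  have "degree (coeff q 0) \<le> n" using q by (simp add: bideg_def)
  then obtain n' where n: "n = Suc n'" using c by (cases n) (auto simp: q_eq)
  have P: "P s t a b = c * s ^ n * a ^ m" for s t a b
    by (simp add: p c bihom_const hom1_const)
  have Q: "Q s t a b = t * c * s ^ n' * a ^ m" for s t a b
    by (simp add: q q_eq n bihom_const hom1_pCons hom1_const)
  \<comment> \<open>Both forms are divisible by \<open>s ^ n' * a ^ m\<close>; a positive exponent
    would produce a common zero at \<open>s = 0\<close> or at \<open>a = 0\<close>.\<close>
  have "n' = 0" using nz[of 0 1 1 0] by (cases n') (auto simp: P Q n)
  moreover have "m = 0" using nz[of 1 0 0 1] by (cases m) (auto simp: P Q n)
  ultimately show ?thesis by (simp add: n)
qed

text \<open>Unique factorization in a polynomial ring in two variables turns a map to the projective line that is locally given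
  by forms into one that is globally given by a coprime pair of forms.\<close>

lemma glue_local_biforms:
  fixes R :: "'c \<Rightarrow> 'c \<Rightarrow> 'c \<Rightarrow> 'c \<Rightarrow> 'c::{field_char_0,factorial_ring_gcd,semiring_gcd_mult_normalize} \<Rightarrow> 'c \<Rightarrow> bool"
  assumes nz: "\<And>s t a b. \<not> R s t a b 0 0"
    and para: "\<And>s t a b x y x' y'. R s t a b x y \<Longrightarrow> R s t a b x' y' \<Longrightarrow> x * y' = x' * y"
    and scale: "\<And>s t a b x y c. R s t a b x y \<Longrightarrow> c \<noteq> 0 \<Longrightarrow> R s t a b (c * x) (c * y)"
    and loc: "\<And>s t a b. (s, t) \<noteq> (0, 0) \<Longrightarrow> (a, b) \<noteq> (0, 0) \<Longrightarrow>
      \<exists>n m n' m' F1 F2 A. biform n m F1 \<and> biform n m F2 \<and> biform n' m' A \<and> A s t a b \<noteq> 0 \<and>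
        (\<forall>s t a b. (s, t) \<noteq> (0, 0) \<longrightarrow> (a, b) \<noteq> (0, 0) \<longrightarrow> A s t a b \<noteq> 0 \<longrightarrow>
           R s t a b (F1 s t a b) (F2 s t a b))"
  obtains n m H1 H2 where "biform n m H1" "biform n m H2"
    "\<And>s t a b. (s, t) \<noteq> (0, 0) \<Longrightarrow> (a, b) \<noteq> (0, 0) \<Longrightarrow> R s t a b (H1 s t a b) (H2 s t a b)"
proof -
  let ?R = "\<lambda>f1 f2 A n m n' m'. \<forall>s t a b. (s, t) \<noteq> (0, 0) \<longrightarrow> (a, b) \<noteq> (0, 0) \<longrightarrow> bihom n' m' A s t a b \<noteq> 0 \<longrightarrow>
           R s t a b (bihom n m f1 s t a b) (bihom n m f2 s t a b)"
  have loc': "\<exists>n m n' m' f1 f2 A. bideg n m f1 \<and> bideg n m f2 \<and> bideg n' m' A \<and>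
      bihom n' m' A s t a b \<noteq> 0 \<and> ?R f1 f2 A n m n' m'"
    if st: "(s, t) \<noteq> (0, 0)" and ab: "(a, b) \<noteq> (0, 0)" for s t a b
  proof -
    obtain n m n' m' F1 F2 A where *: "biform n m F1" "biform n m F2" "biform n' m' A" "A s t a b \<noteq> 0"
      "\<forall>s t a b. (s, t) \<noteq> (0, 0) \<longrightarrow> (a, b) \<noteq> (0, 0) \<longrightarrow> A s t a b \<noteq> 0 \<longrightarrow>
           R s t a b (F1 s t a b) (F2 s t a b)"
      using loc[OF st ab] by (elim exE conjE) (rule that)
    obtain f1 f2 A' where "bideg n m f1" "bideg n m f2" "bideg n' m' A'"
      "F1 = bihom n m f1" "F2 = bihom n m f2" "A = bihom n' m' A'"
      using *(1-3) by (auto simp: biform_def)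
    with *(4,5) show ?thesis by (intro exI[of _ n] exI[of _ m] exI[of _ n'] exI[of _ m']
      exI[of _ f1] exI[of _ f2] exI[of _ A']) simp
  qed
  have e1: "(1 :: 'c, 0 :: 'c) \<noteq> (0, 0)" by simp
  obtain n0 m0 n0' m0' f1 f2 A where f: "bideg n0 m0 f1" "bideg n0 m0 f2" "bideg n0' m0' A"
      "bihom n0' m0' A 1 0 1 0 \<noteq> 0" "?R f1 f2 A n0 m0 n0' m0'"
    using loc'[OF e1 e1] by (elim exE conjE) (rule that)
  have "R 1 0 1 0 (bihom n0 m0 f1 1 0 1 0) (bihom n0 m0 f2 1 0 1 0)"
    using f(5)[rule_format, OF e1 e1 f(4)] .
  then have fnz: "f1 \<noteq> 0 \<or> f2 \<noteq> 0" using nz by auto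
  have Anz: "A \<noteq> 0" using f(4) by auto
  define g where "g = gcd f1 f2"
  define h1 where "h1 = f1 div g"
  define h2 where "h2 = f2 div g"
  have gnz: "g \<noteq> 0" using fnz by (simp add: g_def)
  have fg: "f1 = g * h1" "f2 = g * h2" by (simp_all add: g_def h1_def h2_def)
  have cop: "coprime h1 h2" unfolding h1_def h2_def g_def using fnz by (rule div_gcd_coprime)
  \<comment> \<open>The nominal degrees have to be the least possible ones: larger ones would
    introduce powers of \<open>s\<close> or \<open>a\<close>, hence common zeros at
    infinity.\<close>
  define n where "n = max (degt h1) (degt h2)"
  define m where "m = max (degree h1) (degree h2)"
  have h: "bideg n m h1" "bideg n m h2" by (auto simp: bideg_iff n_def m_def)
  have main: "R s t a b (bihom n m h1 s t a b) (bihom n m h2 s t a b)"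
    if st: "(s, t) \<noteq> (0, 0)" and ab: "(a, b) \<noteq> (0, 0)" for s t a b
  proof -
    obtain n1 m1 n1' m1' f1' f2' A' where f': "bideg n1 m1 f1'" "bideg n1 m1 f2'" "bideg n1' m1' A'"
      "bihom n1' m1' A' s t a b \<noteq> 0" "?R f1' f2' A' n1 m1 n1' m1'"
      using loc'[OF st ab] by (elim exE conjE) (rule that)
    have R': "R s t a b (bihom n1 m1 f1' s t a b) (bihom n1 m1 f2' s t a b)"
      using f'(5)[rule_format, OF st ab f'(4)] .
    have fnz': "f1' \<noteq> 0 \<or> f2' \<noteq> 0" using R' nz by auto
    have Anz': "A' \<noteq> 0" using f'(4) by auto
    \<comment> \<open>Proportionality is known only where \<open>A\<close> and \<open>A'\<close> are
      both nonzero; multiplying by them makes the polynomial vanish everywhere.\<close>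
    have "(f1 * f2' - f1' * f2) * A * A' = 0"
    proof (rule ev2_eq_zeroI)
      fix t b
      show "ev2 ((f1 * f2' - f1' * f2) * A * A') t b = 0"
      proof (cases "ev2 A t b = 0 \<or> ev2 A' t b = 0")
        case True
        then show ?thesis by auto
      next
        case False
        have e: "(1 :: 'c, x) \<noteq> (0, 0)" for x by simp
        have "bihom n0' m0' A 1 t 1 b \<noteq> 0" "bihom n1' m1' A' 1 t 1 b \<noteq> 0"
          using False by (simp_all add: bihom_chart[OF f(3)] bihom_chart[OF f'(3)])
        from f(5)[rule_format, OF e e this(1)] f'(5)[rule_format, OF e e this(2)]
        have "R 1 t 1 b (ev2 f1 t b) (ev2 f2 t b)" "R 1 t 1 b (ev2 f1' t b) (ev2 f2' t b)"
          unfolding bihom_chart[OF f(1)] bihom_chart[OF f(2)] bihom_chart[OF f'(1)] bihom_chart[OF f'(2)] .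
        from para[OF this] have "ev2 (f1 * f2' - f1' * f2) t b = 0" by simp
        then show ?thesis by simp
      qed
    qed
    then have "f1 * f2' = f1' * f2" using Anz Anz' by simp
    then have cross: "h1 * f2' = f1' * h2" using gnz by (simp add: fg algebra_simps)
    obtain k where k1: "f1' = k * h1" and k2: "f2' = k * h2"
    proof (cases "h1 = 0")
      case True
      then have "is_unit h2" using cop by simp
      then have "h2 \<noteq> 0" "h2 dvd f2'" by auto
      then show ?thesis using that[of "f2' div h2"] cross True by simp
    next
      case False
      have "h1 dvd f1'"
        using coprime_dvd_mult_left_iff[OF cop, of f1'] dvd_triv_left[of h1 f2'] cross by simp
      then obtain k where k: "f1' = k * h1" by (metis dvdE mult.commute)
      have "h1 * f2' = h1 * (k * h2)" using cross k by (simp add: mult_ac)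
      then show ?thesis using that[of k] k False by simp
    qed
    have knz: "k \<noteq> 0" using k1 k2 fnz' by auto
    have dt: "degt k + degt h1 \<le> n1" "degree k + degree h1 \<le> m1" if "h1 \<noteq> 0"
      using f'(1) k1 degt_mult[OF knz that] degree_mult_eq[OF knz that] by (auto simp: bideg_iff)
    have dt': "degt k + degt h2 \<le> n1" "degree k + degree h2 \<le> m1" if "h2 \<noteq> 0"
      using f'(2) k2 degt_mult[OF knz that] degree_mult_eq[OF knz that] by (auto simp: bideg_iff)
    have [simp]: "degt 0 = 0" using degt_le[of 0 0] by simp
    \<comment> \<open>If one of \<open>h1\<close> and \<open>h2\<close> is zero, the maxima
      \<open>n\<close> and \<open>m\<close> are the degrees of the other, because both degrees of
      the zero polynomial are 0.\<close>
    have "degt k + n \<le> n1 \<and> degree k + m \<le> m1"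
      using dt dt' fnz fg by (cases "h1 = 0"; cases "h2 = 0") (auto simp: n_def m_def max_def)
    then have deg: "bideg (n1 - n) (m1 - m) k" "n \<le> n1" "m \<le> m1" by (auto simp: bideg_iff)
    have "bihom n1 m1 f1' s t a b = bihom (n1 - n) (m1 - m) k s t a b * bihom n m h1 s t a b"
      "bihom n1 m1 f2' s t a b = bihom (n1 - n) (m1 - m) k s t a b * bihom n m h2 s t a b"
      using bihom_mult[OF deg(1) h(1)] bihom_mult[OF deg(1) h(2)] deg by (simp_all add: k1 k2)
    moreover define c where "c = bihom (n1 - n) (m1 - m) k s t a b"
    ultimately have R'': "R s t a b (c * bihom n m h1 s t a b) (c * bihom n m h2 s t a b)"
      using R' by simp
    \<comment> \<open>\<open>R\<close> never admits the zero pair, so the multiplier is nonzero at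
      this point and can be scaled away.\<close>
    then have "c \<noteq> 0" using nz by auto
    then show ?thesis using scale[OF R'', of "inverse c"] by (simp add: field_simps)
  qed
  show ?thesis by (rule that[of n m "bihom n m h1" "bihom n m h2"]) (use h main biform_bihom in auto)
qed

section \<open>Finite groups whose nontrivial elements have two fixed points\<close>

text \<open>With orbit sizes \<open>c\<close> and stabilizer orders \<open>r\<close>, the last
  equation is \<open>1/r1 + 1/r2 + 1/r3 = 1 + 2/N\<close> with denominators cleared. For ordered
  \<open>r\<close> it forces \<open>(2, 3, 3)\<close>, \<open>(2, 3, 4)\<close> or
  \<open>(2, 3, 5)\<close>, with \<open>N\<close> equal to 12, 24 or 60. The dihedral family
  \<open>(2, 2, r)\<close> would have an orbit of size 2, which is excluded.\<close>

lemma three_orbit_sizes: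
  fixes N :: nat
  assumes "c1 * r1 = N" "c2 * r2 = N" "c3 * r3 = N"
    and "2 \<le> r1" "2 \<le> r2" "2 \<le> r3" and "3 \<le> c1" "3 \<le> c2" "3 \<le> c3"
    and "c1 + c2 + c3 = N + 2"
  shows "N \<le> 60"
proof -
  have bound: "k * c \<le> N" if "c * r = N" "k \<le> r" for c r k
    using that by (metis mult.commute mult_le_mono1)
  have main: "N \<le> 60"
    if c: "c1 * r1 = N" "c2 * r2 = N" "c3 * r3 = N" "3 \<le> c1" "3 \<le> c2" "3 \<le> c3"
      "c1 + c2 + c3 = N + 2" and r: "2 \<le> r1" "r1 \<le> r2" "r2 \<le> r3" for c1 c2 c3 r1 r2 r3
  proof -
    have "\<not> 3 \<le> r1"
      using bound[OF c(1), of 3] bound[OF c(2), of 3] bound[OF c(3), of 3] r c(7) by linarith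
    then have "r1 = 2" using r by simp
    then have N: "N = 2 * c1" using c by simp
    have "\<not> 4 \<le> r2"
      using bound[OF c(2), of 4] bound[OF c(3), of 4] r c(7) N by linarith
    moreover have "r2 \<noteq> 2" using c N by auto
    ultimately have "r2 = 3" using r \<open>r1 = 2\<close> by linarith
    then have N': "N = 3 * c2" using c by simp
    then have c3: "6 * c3 = N + 12" using N c by linarith
    have "\<not> 6 \<le> r3" using bound[OF c(3), of 6] c3 by linarith
    then have "r3 = 3 \<or> r3 = 4 \<or> r3 = 5" using r \<open>r2 = 3\<close> by linarith
    then show ?thesis using c(3) c3 by auto
  qed
  consider "r1 \<le> r2 \<and> r2 \<le> r3" | "r1 \<le> r3 \<and> r3 \<le> r2" | "r2 \<le> r1 \<and> r1 \<le> r3"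
    | "r2 \<le> r3 \<and> r3 \<le> r1" | "r3 \<le> r1 \<and> r1 \<le> r2" | "r3 \<le> r2 \<and> r2 \<le> r1"
    using nat_le_linear[of r1 r2] nat_le_linear[of r2 r3] nat_le_linear[of r1 r3] by blast
  then show ?thesis
  proof cases
    case 1
    show ?thesis by (rule main[of c1 r1 c2 r2 c3 r3]) (use assms 1 in linarith)+
  next
    case 2
    show ?thesis by (rule main[of c1 r1 c3 r3 c2 r2]) (use assms 2 in linarith)+
  next
    case 3
    show ?thesis by (rule main[of c2 r2 c1 r1 c3 r3]) (use assms 3 in linarith)+
  next
    case 4
    show ?thesis by (rule main[of c2 r2 c3 r3 c1 r1]) (use assms 4 in linarith)+
  next
    case 5
    show ?thesis by (rule main[of c3 r3 c1 r1 c2 r2]) (use assms 5 in linarith)+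
  next
    case 6
    show ?thesis by (rule main[of c3 r3 c2 r2 c1 r1]) (use assms 6 in linarith)+
  qed
qed

text \<open>Each orbit contributes at least \<open>N / 2\<close> to a total below
  \<open>2 * N\<close>, so there are at most three. Two orbits contribute at most
  \<open>2 * N - 6\<close>, which is too little, and fewer contribute even less.\<close>

lemma orbit_sizes:
  fixes N :: nat and c r :: "'o \<Rightarrow> nat"
  assumes "finite \<Omega>" "\<And>u. u \<in> \<Omega> \<Longrightarrow> c u * r u = N" "\<And>u. u \<in> \<Omega> \<Longrightarrow> 2 \<le> r u"
    and c3: "\<And>u. u \<in> \<Omega> \<Longrightarrow> 3 \<le> c u" and "(\<Sum>u\<in>\<Omega>. N - c u) = 2 * (N - 1)"
  shows "N \<le> 60"
proof (rule ccontr)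
  assume N: "\<not> N \<le> 60"
  have half: "2 * c u \<le> N" if "u \<in> \<Omega>" for u
    using assms(2,3)[OF that] by (metis mult.commute mult_le_mono2)
  have "card \<Omega> * N \<le> 2 * (\<Sum>u\<in>\<Omega>. N - c u)"
  proof -
    have "N \<le> 2 * (N - c u)" if "u \<in> \<Omega>" for u using half[OF that] by linarith
    then show ?thesis
      using sum_bounded_below[of \<Omega> N "\<lambda>u. 2 * (N - c u)"] by (simp add: sum_distrib_left)
  qed
  also have "\<dots> < 4 * N" using N assms(5) by simp
  finally have "card \<Omega> < 4" by simp
  then consider "card \<Omega> = 0" | "card \<Omega> = 1" | "card \<Omega> = 2" | "card \<Omega> = 3" by linarith
  then show False
  proof cases
    case 1
    then show False using assms N by simp
  next
    case 2
    then obtain u where "\<Omega> = {u}" using card_1_singletonE by blast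
    then show False using assms(5) c3[of u] N by simp
  next
    case 3
    then obtain u v where "\<Omega> = {u, v}" "u \<noteq> v" using card_2_iff by metis
    then show False using assms(5) c3[of u] c3[of v] N by simp
  next
    case 4
    then obtain u v w where *: "\<Omega> = {u, v, w}" "u \<noteq> v" "u \<noteq> w" "v \<noteq> w" using card_3_iff by metis
    then have "c u + c v + c w = N + 2"
      using assms(5) half[of u] half[of v] half[of w] N by simp
    then have "N \<le> 60"
      using three_orbit_sizes[of "c u" "r u" N "c v" "r v" "c w" "r w"] assms(2-4) * by simp
    then show False using N by simp
  qed
qed

section \<open>Double counting of fixed points over orbits\<close>

context group_action
begin

lemma orbit_eq:
  assumes "x \<in> E" "y \<in> orbit G \<phi> x"
  shows "orbit G \<phi> y = orbit G \<phi> x"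
proof -
  obtain g where "g \<in> carrier G" "y = \<phi> g x" using assms(2) by (auto simp: orbit_def)
  then have y: "y \<in> E" using assms(1) element_image by blast
  have z: "z \<in> E" if "z \<in> orbit G \<phi> w" "w \<in> E" for z w
    using that element_image by (auto simp: orbit_def)
  show ?thesis
    using orbit_trans[of x y] orbit_trans[of y x] orbit_sym[of x y] assms y z by blast
qed

text \<open>The counting argument behind the classification of the finite subgroups of \<open>PGL\<^sub>2\<close>.\<close>

lemma two_fixed_points_imp_small_orbit:
  assumes fin: "finite (carrier G)"
    and two: "\<And>g. g \<in> carrier G \<Longrightarrow> g \<noteq> \<one> \<Longrightarrow> card (invariants E \<phi> g) = 2"
  shows "Coset.order G \<le> 60 \<or> (\<exists>x\<in>E. card (orbit G \<phi> x) \<le> 2)"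
proof (rule ccontr)
  assume contra: "\<not> ?thesis"
  interpret group G using group_hom group_hom.axioms(1) by blast
  define N where "N = Coset.order G"
  have Npos: "N > 60" using contra by (simp add: N_def)
  define G' where "G' = carrier G - {\<one>}"
  define st where "st x = stabilizer G \<phi> x" for x
  \<comment> \<open>The points with nontrivial stabilizer: a finite union of orbits, even if
    \<open>E\<close> is infinite.\<close>
  define Y where "Y = {x \<in> E. \<exists>g\<in>G'. \<phi> g x = x}"
  have finG': "finite G'" using fin by (simp add: G'_def)
  have finInv: "finite (invariants E \<phi> g)" if "g \<in> G'" for g
    using two[of g] that by (auto simp: G'_def intro: card_ge_0_finite)
  have Y_eq: "Y = (\<Union>g\<in>G'. invariants E \<phi> g)" by (auto simp: Y_def invariants_def)
  have finY: "finite Y" unfolding Y_eq using finG' finInv by blast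
  have os: "card (orbit G \<phi> x) * card (st x) = N" if "x \<in> E" for x
    using orbit_stabilizer_theorem[OF that] by (simp add: st_def N_def)
  have finst: "finite (st x)" for x
    using fin by (auto simp: st_def stabilizer_def)
  have one_st: "\<one> \<in> st x" if "x \<in> E" for x
    using stabilizer_one_closed[OF that] by (simp add: st_def)
  have st': "card {g \<in> G'. \<phi> g x = x} = card (st x) - 1" if "x \<in> E" for x
  proof -
    have "{g \<in> G'. \<phi> g x = x} = st x - {\<one>}"
      by (auto simp: st_def stabilizer_def G'_def)
    then show ?thesis using one_st[OF that] finst by simp
  qed
  have inY: "x \<in> Y \<longleftrightarrow> 2 \<le> card (st x)" if "x \<in> E" for x
  proof -
    have "x \<in> Y \<longleftrightarrow> {g \<in> G'. \<phi> g x = x} \<noteq> {}" using that by (auto simp: Y_def)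
    also have "\<dots> \<longleftrightarrow> card {g \<in> G'. \<phi> g x = x} \<noteq> 0" using finG' by simp
    finally show ?thesis unfolding st'[OF that] by linarith
  qed
  have sub: "orbit G \<phi> x \<subseteq> E" if "x \<in> E" for x
    using that element_image by (auto simp: orbit_def)
  have st_orbit: "card (st y) = card (st x)" if "x \<in> E" "y \<in> orbit G \<phi> x" for x y
  proof -
    have "card (orbit G \<phi> x) * card (st y) = card (orbit G \<phi> x) * card (st x)"
      using os[of y] os[of x] orbit_eq[OF that] sub[OF that(1)] that by auto
    moreover have "card (orbit G \<phi> x) \<noteq> 0" using os[OF that(1)] Npos by (intro notI) simp
    ultimately show ?thesis by simp
  qed
  define \<Omega> where "\<Omega> = orbit G \<phi> ` Y"
  have YE: "Y \<subseteq> E" by (auto simp: Y_def)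
  have union: "\<Union>\<Omega> = Y"
  proof
    show "\<Union>\<Omega> \<subseteq> Y"
      using st_orbit inY sub YE unfolding \<Omega>_def by (smt (verit) UN_iff subset_eq)
    show "Y \<subseteq> \<Union>\<Omega>"
      using YE orbit_refl unfolding \<Omega>_def by blast
  qed
  have finO: "finite u" if "u \<in> \<Omega>" for u
    using that union finY by (metis Sup_upper finite_subset)
  have disj: "u \<inter> v = {}" if "u \<in> \<Omega>" "v \<in> \<Omega>" "u \<noteq> v" for u v
    using that YE orbit_eq unfolding \<Omega>_def by (smt (verit) disjoint_iff imageE subset_eq)
  \<comment> \<open>Pairs of a nontrivial element and a point fixed by it are counted by elements
    and then by points. In an orbit of size \<open>c\<close> every point is fixed by
    \<open>N / c - 1\<close> nontrivial elements, so the orbit contributes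
    \<open>N - c\<close>.\<close>
  have "2 * (N - 1) = (\<Sum>g\<in>G'. card (invariants E \<phi> g))"
    using two fin by (simp add: G'_def N_def Coset.order_def)
  also have "\<dots> = (\<Sum>g\<in>G'. \<Sum>x\<in>Y. if \<phi> g x = x then 1 else 0)"
  proof (rule sum.cong)
    fix g assume g: "g \<in> G'"
    then have "invariants E \<phi> g = {x \<in> Y. \<phi> g x = x}" by (auto simp: Y_def invariants_def)
    then show "card (invariants E \<phi> g) = (\<Sum>x\<in>Y. if \<phi> g x = x then 1 else 0)"
      using finY by (simp add: sum.If_cases Int_def)
  qed simp
  also have "\<dots> = (\<Sum>x\<in>Y. \<Sum>g\<in>G'. if \<phi> g x = x then 1 else 0)"
    by (rule sum.swap)
  also have "\<dots> = (\<Sum>x\<in>Y. card (st x) - 1)"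
    using finG' YE st' by (intro sum.cong) (auto simp: sum.If_cases Int_def)
  also have "\<dots> = (\<Sum>u\<in>\<Omega>. \<Sum>x\<in>u. card (st x) - 1)"
    using sum.Union_disjoint[of \<Omega> "\<lambda>x. card (st x) - 1"] finO disj union by auto
  also have "\<dots> = (\<Sum>u\<in>\<Omega>. N - card u)"
  proof (rule sum.cong)
    fix u assume "u \<in> \<Omega>"
    then obtain x where x: "x \<in> Y" "u = orbit G \<phi> x" by (auto simp: \<Omega>_def)
    then have xE: "x \<in> E" using YE by auto
    have "(\<Sum>x\<in>u. card (st x) - 1) = (\<Sum>y\<in>u. card (st x) - 1)"
      using st_orbit[OF xE] x by (intro sum.cong) auto
    also have "\<dots> = N - card u" using os[OF xE] x by (simp add: diff_mult_distrib2)
    finally show "(\<Sum>x\<in>u. card (st x) - 1) = N - card u" .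
  qed simp
  finally have total: "(\<Sum>u\<in>\<Omega>. N - card u) = 2 * (N - 1)" ..
  have "N \<le> 60"
  proof (rule orbit_sizes[OF _ _ _ _ total])
    show "finite \<Omega>" using finY by (simp add: \<Omega>_def)
    fix u assume u: "u \<in> \<Omega>"
    then obtain x where x: "x \<in> Y" "u = orbit G \<phi> x" by (auto simp: \<Omega>_def)
    then have xE: "x \<in> E" using YE by auto
    have uN: "card u * card (st x) = N" using os[OF xE] x by simp
    moreover have "card u \<noteq> 0" using uN Npos by (intro notI) simp
    ultimately have r: "N div card u = card (st x)" by (metis nonzero_mult_div_cancel_left)
    show "card u * (N div card u) = N" using uN r by simp
    show "2 \<le> N div card u" using r inY[OF xE] x by simp
    have "2 < card u" using contra xE x(2) by (simp add: not_le)
    then show "3 \<le> card u" by linarith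
  qed
  then show False using Npos by simp
qed

end

section \<open>Jordan bounds from an action with two fixed points\<close>

lemma (in Group.group) card_le_twice_Int:
  assumes "subgroup D G" "finite D"
    and "\<And>x y. x \<in> D - C \<Longrightarrow> y \<in> D - C \<Longrightarrow> inv x \<otimes> y \<in> C"
  shows "card D \<le> 2 * card (D \<inter> C)"
proof (cases "D \<subseteq> C")
  case True
  then have "D \<inter> C = D" by blast
  then show ?thesis by simp
next
  case False
  then obtain x where x: "x \<in> D" "x \<notin> C" by blast
  have D: "D \<subseteq> carrier G" using assms(1) subgroup.subset by blast
  \<comment> \<open>All elements outside \<open>C\<close> differ by elements of \<open>C\<close>, so
    translation by the inverse of one of them moves \<open>D - C\<close> into
    \<open>D \<inter> C\<close>.\<close>
  have "inj_on (\<lambda>y. inv x \<otimes> y) (D - C)"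
    using D x by (intro inj_onI) (metis DiffD1 inv_closed l_cancel subset_iff)
  moreover have "(\<lambda>y. inv x \<otimes> y) ` (D - C) \<subseteq> D \<inter> C"
    using assms(3) x subgroup.m_closed[OF assms(1)] subgroup.m_inv_closed[OF assms(1)] by auto
  ultimately have "card (D - C) \<le> card (D \<inter> C)"
    using assms(2) card_inj_on_le by blast
  moreover have "card D = card (D - C) + card (D \<inter> C)"
    using assms(2) by (metis card_Diff_subset_Int card_Int_Diff add.commute finite_Int)
  ultimately show ?thesis by simp
qed

lemma (in Group.group) finite_jordan_constant_le:
  assumes "A \<lhd> G" "\<And>x y. x \<in> A \<Longrightarrow> y \<in> A \<Longrightarrow> x \<otimes> y = y \<otimes> x" "card (rcosets A) \<le> n"
  shows "finite_jordan_constant G \<le> n"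
proof -
  have "subgroup A G" using assms(1) by (rule normal_imp_subgroup)
  then have "group (G\<lparr>carrier := A\<rparr>)" by (rule subgroup.subgroup_is_group) (rule group_axioms)
  then have "comm_group (G\<lparr>carrier := A\<rparr>)"
    using assms(2) by (intro group.group_comm_groupI) auto
  then have "finite_jordan_constant G \<le> card (rcosets A)"
    unfolding finite_jordan_constant_def using assms(1) by (intro Least_le) blast
  then show ?thesis using assms(3) by simp
qed

text \<open>\<open>idx\<close> expresses index at most 2 without cosets, in the form in which it
  arises: two exchanges of the rulings compose to a map that preserves them. The laws of an action
  are asked only on \<open>H\<close>, since an element that exchanges the rulings does not act on
  the lines of one of them.\<close>

proposition (in Group.group) finite_jordan_constant_two_fixed_points:
  fixes act :: "'a \<Rightarrow> 'e \<Rightarrow> 'e"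
  assumes fin: "finite (carrier G)" and sub: "subgroup H G"
    and idx: "\<And>x y. x \<in> carrier G - H \<Longrightarrow> y \<in> carrier G - H \<Longrightarrow> x \<otimes> y \<in> H"
    and act_closed: "\<And>g x. g \<in> H \<Longrightarrow> x \<in> E \<Longrightarrow> act g x \<in> E"
    and act_one: "\<And>x. x \<in> E \<Longrightarrow> act \<one> x = x"
    and act_mult: "\<And>g h x. g \<in> H \<Longrightarrow> h \<in> H \<Longrightarrow> x \<in> E \<Longrightarrow> act (g \<otimes> h) x = act g (act h x)"
    and two: "\<And>g. g \<in> H \<Longrightarrow> g \<noteq> \<one> \<Longrightarrow> card {x \<in> E. act g x = x} = 2"
    and stab: "\<And>x g h. x \<in> E \<Longrightarrow> g \<in> H \<Longrightarrow> h \<in> H \<Longrightarrow> act g x = x \<Longrightarrow> act h x = x \<Longrightarrow>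
      g \<otimes> h = h \<otimes> g"
  shows "finite_jordan_constant G \<le> 120"
proof -
  have HG: "H \<subseteq> carrier G" using sub by (rule subgroup.subset)
  have finH: "finite H" using fin HG finite_subset by blast
  have Hm: "x \<otimes> y \<in> H" "inv x \<in> H" if "x \<in> H" "y \<in> H" for x y
    using sub that by (simp_all add: subgroup.m_closed subgroup.m_inv_closed)
  have one: "\<one> \<in> H" using sub by (rule subgroup.one_closed)
  have notH: "inv x \<notin> H" if "x \<in> carrier G" "x \<notin> H" for x
    using that Hm(2)[of "inv x"] one by auto
  have cardG: "card (carrier G) \<le> 2 * card H"
    using card_le_twice_Int[of "carrier G" H] fin idx notH HG subgroup_self
    by (simp add: Int_absorb1)
  interpret H: group "G\<lparr>carrier := H\<rparr>" using sub by (rule subgroup.subgroup_is_group) (rule group_axioms)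
  \<comment> \<open>Restriction to \<open>E\<close> makes the maps extensional, as membership in
    \<open>Bij E\<close> demands.\<close>
  define \<phi> where "\<phi> = (\<lambda>g. \<lambda>x\<in>E. act g x)"
  have inv_act: "act (inv g) (act g x) = x" "act g (act (inv g) x) = x" if "g \<in> H" "x \<in> E" for g x
    using act_mult[of "inv g" g x] act_mult[of g "inv g" x] that Hm act_one HG by auto
  have bij: "\<phi> g \<in> Bij E" if "g \<in> H" for g
  proof -
    have "bij_betw (\<phi> g) E E"
      by (rule bij_betwI[of _ _ _ "act (inv g)"])
        (use inv_act[OF that] act_closed that Hm in \<open>auto simp: \<phi>_def\<close>)
    then show ?thesis by (auto simp: Bij_def \<phi>_def)
  qed
  interpret A: group_action "G\<lparr>carrier := H\<rparr>" E \<phi>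
  proof (intro group_action.intro group_hom.intro group_hom_axioms.intro H.group_axioms)
    show "group (BijGroup E)" by (rule group_BijGroup)
    show "\<phi> \<in> hom (G\<lparr>carrier := H\<rparr>) (BijGroup E)"
      by (intro homI) (auto simp: BijGroup_def bij, auto simp: \<phi>_def compose_def act_mult act_closed fun_eq_iff)
  qed
  have small: "Coset.order (G\<lparr>carrier := H\<rparr>) \<le> 60 \<or> (\<exists>x\<in>E. card (orbit (G\<lparr>carrier := H\<rparr>) \<phi> x) \<le> 2)"
  proof (rule A.two_fixed_points_imp_small_orbit)
    fix g assume "g \<in> carrier (G\<lparr>carrier := H\<rparr>)" "g \<noteq> \<one>\<^bsub>G\<lparr>carrier := H\<rparr>\<^esub>"
    moreover have "invariants E \<phi> g = {x \<in> E. act g x = x}" by (auto simp: invariants_def \<phi>_def)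
    ultimately show "card (invariants E \<phi> g) = 2" using two by simp
  qed (use finH in simp)
  show ?thesis
  proof (cases "card H \<le> 60")
    case True
    have "card (rcosets {\<one>}) * 1 \<le> 120"
      using lagrange[OF triv_subgroup] cardG True by (simp add: Coset.order_def)
    then show ?thesis
      by (intro finite_jordan_constant_le[OF one_is_normal]) auto
  next
    case False
    then obtain x where x: "x \<in> E" "card (orbit (G\<lparr>carrier := H\<rparr>) \<phi> x) \<le> 2"
      using small by (auto simp: Coset.order_def)
    define C where "C = {g \<in> H. act g x = x}"
    have C: "subgroup C G"
    proof (rule subgroupI)
      show "C \<subseteq> carrier G" using HG by (auto simp: C_def)
      show "C \<noteq> {}" using one act_one x by (auto simp: C_def)
      show "inv g \<in> C" if "g \<in> C" for g using that inv_act[of g x] Hm x by (auto simp: C_def)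
      show "g \<otimes> h \<in> C" if "g \<in> C" "h \<in> C" for g h
        using that Hm x act_mult by (auto simp: C_def)
    qed
    have CH: "C \<subseteq> H" by (auto simp: C_def)
    have Cm: "g \<otimes> h \<in> C" "inv g \<in> C" if "g \<in> C" "h \<in> C" for g h
      using C that by (simp_all add: subgroup.m_closed subgroup.m_inv_closed)
    \<comment> \<open>The orbit of \<open>x\<close> has at most two points, so all elements that
      move \<open>x\<close> send it to the same point.\<close>
    have Cidx: "inv g \<otimes> h \<in> C" if "g \<in> H - C" "h \<in> H - C" for g h
    proof -
      let ?O = "orbit (G\<lparr>carrier := H\<rparr>) \<phi> x"
      have O: "act g' x \<in> ?O" if "g' \<in> H" for g' using that x by (auto simp: orbit_def \<phi>_def)
      have xO: "x \<in> ?O" using O[OF one] act_one x by simp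
      have finO: "finite ?O"
      proof -
        have "?O = (\<lambda>g. \<phi> g x) ` H" by (auto simp: orbit_def)
        then show ?thesis using finH by simp
      qed
      have "act g x = act h x"
      proof (rule ccontr)
        assume "act g x \<noteq> act h x"
        then have "card {x, act g x, act h x} = 3" using that x by (auto simp: C_def)
        moreover have "card {x, act g x, act h x} \<le> card ?O"
          using O xO that finO by (intro card_mono) auto
        ultimately show False using x by simp
      qed
      then show ?thesis
        using that inv_act[of g x] act_mult[of "inv g" h x] x Hm by (auto simp: C_def)
    qed
    have notC: "inv y \<notin> C" if "y \<in> H" "y \<notin> C" for y
      using that Cm(2)[of "inv y"] HG by (metis inv_inv subset_iff)
    \<comment> \<open>This is normality of a subgroup of index at most 2: if \<open>y\<close> is
      outside \<open>C\<close>, then so is \<open>y \<otimes> c\<close>, and \<open>Cidx\<close>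
      applies to the inverses of both.\<close>
    have Cnormal: "y \<otimes> c \<otimes> inv y \<in> C" if "y \<in> H" "c \<in> C" for y c
    proof (cases "y \<in> C")
      case False
      have cy: "c \<in> carrier G" "y \<in> carrier G" "c \<in> H" using that CH HG by auto
      have "y \<otimes> c \<notin> C"
      proof
        assume "y \<otimes> c \<in> C"
        then have "y \<otimes> c \<otimes> inv c \<in> C" using Cm that by blast
        then show False using False cy by (simp add: m_assoc)
      qed
      then have "inv (y \<otimes> c) \<in> H - C" using notC[of "y \<otimes> c"] that cy Hm by auto
      then have "inv (inv (y \<otimes> c)) \<otimes> inv y \<in> C" using Cidx[of "inv (y \<otimes> c)" "inv y"] that notC False Hm by auto
      then show ?thesis using cy by simp
    qed (use that Cm in auto)
    have Hnormal: "y \<otimes> c \<otimes> inv y \<in> H" if "y \<in> carrier G" "c \<in> H" for y c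
    proof (cases "y \<in> H")
      case False
      have "y \<otimes> c \<notin> H"
      proof
        assume "y \<otimes> c \<in> H"
        then have "y \<otimes> c \<otimes> inv c \<in> H" using Hm that by blast
        then show False using False that HG by (auto simp: m_assoc)
      qed
      then show ?thesis using idx[of "y \<otimes> c" "inv y"] notH that False HG by auto
    qed (use that Hm in auto)
    \<comment> \<open>The normal core of \<open>C\<close>. Since \<open>C\<close> is normal in
      \<open>H\<close>, it is the intersection of at most two conjugates of
      \<open>C\<close>.\<close>
    define K where "K = {c \<in> C. \<forall>h\<in>carrier G. h \<otimes> c \<otimes> inv h \<in> C}"
    have CG: "C \<subseteq> carrier G" using CH HG by blast
    have K: "subgroup K G"
    proof (rule subgroupI)
      show "K \<subseteq> carrier G" using CG by (auto simp: K_def)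
      show "K \<noteq> {}" using subgroup.one_closed[OF C] by (auto simp: K_def)
      show "inv c \<in> K" if "c \<in> K" for c
      proof -
        have "h \<otimes> inv c \<otimes> inv h = inv (h \<otimes> c \<otimes> inv h)" if "h \<in> carrier G" for h
          using that \<open>c \<in> K\<close> CG by (auto simp: K_def inv_mult_group m_assoc)
        then show ?thesis using that Cm by (auto simp: K_def)
      qed
      show "c \<otimes> d \<in> K" if "c \<in> K" "d \<in> K" for c d
      proof -
        have "h \<otimes> (c \<otimes> d) \<otimes> inv h = (h \<otimes> c \<otimes> inv h) \<otimes> (h \<otimes> d \<otimes> inv h)" if "h \<in> carrier G" for h
        proof -
          have "c \<in> carrier G" "d \<in> carrier G" using \<open>c \<in> K\<close> \<open>d \<in> K\<close> CG by (auto simp: K_def)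
          moreover from this have "inv h \<otimes> (h \<otimes> (d \<otimes> inv h)) = d \<otimes> inv h"
            using that by (simp add: m_assoc[symmetric])
          ultimately show ?thesis using that by (simp add: m_assoc)
        qed
        then show ?thesis using that Cm by (auto simp: K_def)
      qed
    qed
    have Knormal: "K \<lhd> G"
    proof (rule normal_invI[OF K])
      fix y c assume y: "y \<in> carrier G" and c: "c \<in> K"
      have "h \<otimes> (y \<otimes> c \<otimes> inv y) \<otimes> inv h = (h \<otimes> y) \<otimes> c \<otimes> inv (h \<otimes> y)" if "h \<in> carrier G" for h
        using that y c CG by (auto simp: K_def inv_mult_group m_assoc)
      then show "y \<otimes> c \<otimes> inv y \<in> K" using y c by (auto simp: K_def)
    qed
    have cardH: "card H \<le> 2 * card C"
      using card_le_twice_Int[OF sub finH, of C] Cidx CH by (simp add: Int_absorb1)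
    have cardC: "card C \<le> 2 * card K"
    proof (cases "carrier G \<subseteq> H")
      case True
      then have "K = C" using Cnormal by (auto simp: K_def)
      then show ?thesis by simp
    next
      case False
      then obtain g where g: "g \<in> carrier G" "g \<notin> H" by blast
      define C' where "C' = {c. g \<otimes> c \<otimes> inv g \<in> C}"
      have "C \<inter> C' \<subseteq> K"
      proof
        fix c assume c: "c \<in> C \<inter> C'"
        have "h \<otimes> c \<otimes> inv h \<in> C" if h: "h \<in> carrier G" for h
        proof (cases "h \<in> H")
          case False
          \<comment> \<open>Outside \<open>H\<close> there is only one coset, so conjugation by
            \<open>h\<close> is conjugation by \<open>g\<close> followed by conjugation by an
            element of \<open>H\<close>, which preserves \<open>C\<close>.\<close>
          have "h \<otimes> inv g \<in> H" using idx h g False notH by auto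
          then have "(h \<otimes> inv g) \<otimes> (g \<otimes> c \<otimes> inv g) \<otimes> inv (h \<otimes> inv g) \<in> C"
            using Cnormal c by (auto simp: C'_def)
          moreover have "(h \<otimes> inv g) \<otimes> (g \<otimes> c \<otimes> inv g) \<otimes> inv (h \<otimes> inv g) = h \<otimes> c \<otimes> inv h"
          proof -
            have "c \<in> carrier G" using c CG by auto
            then have "inv g \<otimes> (g \<otimes> (c \<otimes> (inv g \<otimes> (g \<otimes> inv h)))) = c \<otimes> inv h"
              using g h by (simp add: m_assoc[symmetric])
            then show ?thesis using g h \<open>c \<in> carrier G\<close> by (simp add: m_assoc inv_mult_group)
          qed
          ultimately show ?thesis by simp
        qed (use c Cnormal in auto)
        then show "c \<in> K" using c by (auto simp: K_def)
      qed
      moreover have "card C \<le> 2 * card (C \<inter> C')"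
      proof (rule card_le_twice_Int[OF C])
        show "finite C" using finH CH finite_subset by blast
        fix u v assume uv: "u \<in> C - C'" "v \<in> C - C'"
        then have uvG: "u \<in> carrier G" "v \<in> carrier G" using CG by auto
        \<comment> \<open>The conjugates stay in \<open>H\<close> because \<open>H\<close> is normal
          and miss \<open>C\<close> by the choice of \<open>u\<close> and \<open>v\<close>; the
          coset rule for \<open>C\<close> thus carries over to \<open>C'\<close>.\<close>
        have "g \<otimes> u \<otimes> inv g \<in> H - C" "g \<otimes> v \<otimes> inv g \<in> H - C"
          using uv Hnormal g CH by (auto simp: C'_def)
        from Cidx[OF this] have "inv (g \<otimes> u \<otimes> inv g) \<otimes> (g \<otimes> v \<otimes> inv g) \<in> C" .
        moreover have "inv (g \<otimes> u \<otimes> inv g) \<otimes> (g \<otimes> v \<otimes> inv g) = g \<otimes> (inv u \<otimes> v) \<otimes> inv g"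
        proof -
          have "inv g \<otimes> (g \<otimes> (v \<otimes> inv g)) = v \<otimes> inv g"
            using g uvG by (simp add: m_assoc[symmetric])
          then show ?thesis using g uvG by (simp add: m_assoc inv_mult_group)
        qed
        ultimately show "inv u \<otimes> v \<in> C'" by (simp add: C'_def)
      qed
      moreover have "finite K" using finH CH by (auto simp: K_def intro: finite_subset[of _ H])
      ultimately show ?thesis using card_mono[of K "C \<inter> C'"] by linarith
    qed
    have "card (rcosets K) * card K \<le> 8 * card K"
      using lagrange[OF K] cardG cardH cardC by (simp add: Coset.order_def)
    moreover have "card K \<noteq> 0" using cardC cardH False by linarith
    ultimately have "card (rcosets K) \<le> 120" by simp
    moreover have "u \<otimes> v = v \<otimes> u" if "u \<in> K" "v \<in> K" for u v
      using stab[OF x(1), of u v] that by (auto simp: K_def C_def)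
    ultimately show ?thesis by (intro finite_jordan_constant_le[OF Knormal])
  qed
qed

section \<open>Morphisms of quadrics\<close>

lemma mem_point_of: "y \<in> point_of x \<longleftrightarrow> (\<exists>c. c \<noteq> 0 \<and> y = c *s x)"
  by (auto simp: point_of_def)

lemma self_mem_point_of: "x \<in> point_of x"
  by (auto simp: mem_point_of intro!: exI[of _ 1])

lemma point_of_smult:
  assumes "c \<noteq> 0"
  shows "point_of (c *s x) = point_of x"
proof -
  have "\<exists>e. e \<noteq> 0 \<and> d *s (c *s x) = e *s x" if "d \<noteq> 0" for d
    using that assms by (intro exI[of _ "d * c"]) (simp add: vector_smult_assoc)
  moreover have "\<exists>e. e \<noteq> 0 \<and> d *s x = e *s (c *s x)" if "d \<noteq> 0" for d
    using that assms by (intro exI[of _ "d / c"]) (simp add: vector_smult_assoc)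
  ultimately show ?thesis by (auto simp: mem_point_of)
qed

lemma point_of_eq: "y \<in> point_of x \<Longrightarrow> point_of y = point_of x"
  by (auto simp: mem_point_of point_of_smult)

lemma point_of_closed: "y \<in> point_of x \<Longrightarrow> c \<noteq> 0 \<Longrightarrow> c *s y \<in> point_of x"
  using point_of_eq point_of_smult self_mem_point_of by metis

lemma proj_space_mem: "P \<in> proj_space \<Longrightarrow> x \<in> P \<Longrightarrow> P = point_of x \<and> x \<noteq> 0"
  by (auto simp: proj_space_def point_of_eq mem_point_of)

lemma point_of_in_proj_space: "x \<noteq> 0 \<Longrightarrow> point_of x \<in> proj_space"
  by (auto simp: proj_space_def)

lemma mpoly_eval_scale:
  assumes "homogeneous d f"
  shows "mpoly_eval f (c *s x) = c ^ d * mpoly_eval f x"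
proof -
  have "(\<Prod>i\<in>UNIV. ((c *s x) $ i) ^ Poly_Mapping.lookup m i) = c ^ d * (\<Prod>i\<in>UNIV. (x $ i) ^ Poly_Mapping.lookup m i)"
    if "m \<in> Poly_Mapping.keys f" for m
  proof -
    have "d = (\<Sum>i\<in>UNIV. Poly_Mapping.lookup m i)" using assms that by (simp add: homogeneous_def)
    then show ?thesis by (simp add: power_mult_distrib prod.distrib power_sum)
  qed
  then show ?thesis by (simp add: mpoly_eval_def sum_distrib_left mult_ac)
qed

text \<open>The sets where a single form does not vanish are a basis of the topology, so a
  neighbourhood can be shrunk to one of them.\<close>

lemma zariski_openE:
  assumes "zariski_open U" "point_of x \<in> U"
  obtains f d where "homogeneous d f" "mpoly_eval f x \<noteq> 0"
    "\<And>y. y \<noteq> 0 \<Longrightarrow> mpoly_eval f y \<noteq> 0 \<Longrightarrow> point_of y \<in> U"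
proof -
  obtain T where T: "\<forall>f\<in>T. \<exists>d. homogeneous d f" "U = proj_space - zero_locus T"
    using assms(1) by (auto simp: zariski_open_def)
  then obtain f y where f: "f \<in> T" "y \<in> point_of x" "mpoly_eval f y \<noteq> 0"
    using assms(2) by (auto simp: zero_locus_def)
  then obtain d where d: "homogeneous d f" using T by blast
  have "mpoly_eval f x \<noteq> 0"
    using f(2,3) d by (auto simp: mem_point_of mpoly_eval_scale)
  then show ?thesis
    using that[OF d] f(1) T(2) point_of_in_proj_space self_mem_point_of by (auto simp: zero_locus_def)
qed

lemma mpoly_eval_biform:
  fixes Z :: "'k::field alg_closure \<Rightarrow> 'k alg_closure \<Rightarrow> 'k alg_closure \<Rightarrow> 'k alg_closure \<Rightarrow> 'k alg_closure^'i::finite"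
  assumes "homogeneous d f" "\<And>i. biform n m (\<lambda>s t a b. Z s t a b $ i)"
  shows "biform (d * n) (d * m) (\<lambda>s t a b. mpoly_eval f (Z s t a b))"
  unfolding mpoly_eval_def
proof (intro biform_sum biform_scale)
  fix k assume "k \<in> Poly_Mapping.keys f"
  then have d: "d = (\<Sum>i\<in>UNIV. Poly_Mapping.lookup k i)" using assms(1) by (simp add: homogeneous_def)
  show "biform (d * n) (d * m) (\<lambda>s t a b. \<Prod>i\<in>UNIV. Z s t a b $ i ^ Poly_Mapping.lookup k i)"
    unfolding d sum_distrib_right by (intro biform_prod biform_power assms(2)) simp
qed

text \<open>\<open>quad_vec s t a b\<close> lists the entries of the rank one matrix \<open>(s, t)\<^sup>T (a, b)\<close>, the two diagonal entries first.\<close>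

definition quad_vec :: "'c \<Rightarrow> 'c \<Rightarrow> 'c \<Rightarrow> 'c \<Rightarrow> 'c::comm_ring_1^4" where
  "quad_vec s t a b = (\<chi> i. if i = 1 then s * a else if i = 2 then t * b else if i = 3 then s * b else t * a)"

lemma quad_vec_nth [simp]:
  "quad_vec s t a b $ 1 = s * a" "quad_vec s t a b $ 2 = t * b"
  "quad_vec s t a b $ 3 = s * b" "quad_vec s t a b $ 4 = t * a"
  by (simp_all add: quad_vec_def)

lemma vec4_eq_iff: "x = y \<longleftrightarrow> x $ 1 = y $ 1 \<and> x $ 2 = y $ 2 \<and> x $ 3 = y $ 3 \<and> x $ 4 = (y $ 4 :: 'c)"
  for x y :: "'c^4"
  by (simp add: vec_eq_iff forall_4)

lemma quad_vec_eq_0_iff: "quad_vec s t a b = 0 \<longleftrightarrow> (s, t) = (0, 0) \<or> (a, b) = (0, 0 :: 'c::idom)"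
  by (auto simp: vec4_eq_iff)

lemma quad_vec_surj:
  fixes y :: "'c::field^4"
  assumes "y $ 1 * y $ 2 = y $ 3 * y $ 4"
  obtains s t a b where "y = quad_vec s t a b"
proof -
  consider "y $ 1 \<noteq> 0" | "y $ 1 = 0" "y $ 3 = 0" | "y $ 1 = 0" "y $ 4 = 0"
    using assms by fastforce
  then show ?thesis
  proof cases
    case 1
    then show ?thesis
      using assms by (intro that[of "y $ 1" "y $ 4" 1 "y $ 3 / y $ 1"]) (auto simp: vec4_eq_iff field_simps)
  next
    case 2
    then show ?thesis by (intro that[of 0 1 "y $ 4" "y $ 2"]) (auto simp: vec4_eq_iff)
  next
    case 3
    then show ?thesis by (intro that[of "y $ 3" "y $ 2" 0 1]) (auto simp: vec4_eq_iff)
  qed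
qed

lemma pair_proportional:
  fixes s t s' t' :: "'c::field"
  assumes "(s, t) \<noteq> (0, 0)" "(s', t') \<noteq> (0, 0)" "s * t' = s' * t"
  obtains c where "c \<noteq> 0" "s' = c * s" "t' = c * t"
proof (cases "s = 0")
  case True
  then show ?thesis using assms by (intro that[of "t' / t"]) auto
next
  case False
  then have "s' \<noteq> 0" using assms by auto
  then show ?thesis using assms False by (intro that[of "s' / s"]) (auto simp: field_simps)
qed

text \<open>\<open>N\<close> leads from the coordinates in which the quadric consists of rank one
  matrices back to the given ones. Its entries lie in the algebraic closure, because the rulings
  need not be defined over \<open>K\<close>.\<close>

locale geometric_quadric =
  fixes N N' :: "'k::field_char_0 alg_closure^4^4" and S :: "('k, 4) point set"
  assumes N_inv: "N ** N' = mat 1" "N' ** N = mat 1"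
    and S_eq: "S = {point_of x |x. x \<noteq> 0 \<and> (N' *v x) $ 1 * (N' *v x) $ 2 = (N' *v x) $ 3 * (N' *v x) $ 4}"
begin

definition par :: "'k alg_closure \<Rightarrow> 'k alg_closure \<Rightarrow> 'k alg_closure \<Rightarrow> 'k alg_closure \<Rightarrow> 'k alg_closure^4" where
  "par s t a b = N *v quad_vec s t a b"

lemma N'_par [simp]: "N' *v par s t a b = quad_vec s t a b"
  by (simp add: par_def matrix_vector_mul_assoc N_inv)

lemma par_eq_iff: "par s t a b = x \<longleftrightarrow> quad_vec s t a b = N' *v x"
  by (metis N'_par N_inv(1) matrix_vector_mul_assoc matrix_vector_mul_lid par_def)

lemma par_nonzero: "(s, t) \<noteq> (0, 0) \<Longrightarrow> (a, b) \<noteq> (0, 0) \<Longrightarrow> par s t a b \<noteq> 0"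
  using par_eq_iff[of s t a b 0] quad_vec_eq_0_iff[of s t a b] by auto

lemma par_scale: "par (c * s) (c * t) (d * a) (d * b) = (c * d) *s par s t a b"
  unfolding par_eq_iff by (simp add: vector_scalar_commute) (simp add: vec4_eq_iff)

lemma par_in_S: "(s, t) \<noteq> (0, 0) \<Longrightarrow> (a, b) \<noteq> (0, 0) \<Longrightarrow> point_of (par s t a b) \<in> S"
  using par_nonzero by (auto simp: S_eq intro!: exI[of _ "par s t a b"])

lemma S_subset: "S \<subseteq> proj_space"
  by (auto simp: S_eq point_of_in_proj_space)

lemma S_cases:
  assumes "Q \<in> S" "x \<in> Q"
  obtains s t a b where "x = par s t a b" "(s, t) \<noteq> (0, 0)" "(a, b) \<noteq> (0, 0)" "Q = point_of (par s t a b)"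
proof -
  obtain z c where z: "Q = point_of z" "z \<noteq> 0" "x = c *s z" "c \<noteq> 0"
      "(N' *v z) $ 1 * (N' *v z) $ 2 = (N' *v z) $ 3 * (N' *v z) $ 4"
    using assms by (auto simp: S_eq mem_point_of)
  then have "(N' *v x) $ 1 * (N' *v x) $ 2 = (N' *v x) $ 3 * (N' *v x) $ 4"
    by (simp add: vector_scalar_commute)
  then obtain s t a b where "N' *v x = quad_vec s t a b" using quad_vec_surj by blast
  then have x: "x = par s t a b" using par_eq_iff by metis
  have "x \<noteq> 0" using z by simp
  then have "quad_vec s t a b \<noteq> 0" using x by (auto simp: par_def)
  then show ?thesis using that[OF x] z x quad_vec_eq_0_iff[of s t a b] point_of_smult by auto
qed

lemma S_eq_point_of: "Q \<in> S \<Longrightarrow> x \<in> Q \<Longrightarrow> Q = point_of x"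
  using S_subset proj_space_mem by blast

text \<open>Proportional rank one matrices have the same column and row directions: a minor formed
  from the two first factors, multiplied by either coordinate of the second factor
  \<open>(a', b')\<close>, becomes an expression that cancels, and one of these coordinates is
  nonzero. The other minor is treated in the same way.\<close>

lemma par_same_point:
  assumes "point_of (par s t a b) = point_of (par s' t' a' b')"
    and "(s, t) \<noteq> (0, 0)" "(a, b) \<noteq> (0, 0)"
  shows "s * t' = s' * t" "a * b' = a' * b"
proof -
  obtain c where c: "c \<noteq> 0" "par s' t' a' b' = c *s par s t a b"
    using assms(1) self_mem_point_of mem_point_of by metis
  then have "N' *v par s' t' a' b' = N' *v (c *s par s t a b)" by simp
  then have *: "quad_vec s' t' a' b' = c *s quad_vec s t a b"
    by (simp add: vector_scalar_commute)
  have e: "s' * a' = c * (s * a)" "t' * b' = c * (t * b)" "s' * b' = c * (s * b)" "t' * a' = c * (t * a)"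
    using * by (simp_all add: vec4_eq_iff)
  have "(s * t' - s' * t) * a' = s * (t' * a') - t * (s' * a')"
    "(s * t' - s' * t) * b' = s * (t' * b') - t * (s' * b')"
    "(a * b' - a' * b) * s' = a * (s' * b') - b * (s' * a')"
    "(a * b' - a' * b) * t' = a * (t' * b') - b * (t' * a')"
    by (simp_all add: algebra_simps)
  then have "(s * t' - s' * t) * a' = 0" "(s * t' - s' * t) * b' = 0"
    "(a * b' - a' * b) * s' = 0" "(a * b' - a' * b) * t' = 0"
    unfolding e by (simp_all add: algebra_simps)
  moreover have "par s t a b \<noteq> 0" using assms par_nonzero by blast
  then have "quad_vec s' t' a' b' \<noteq> 0" using c * assms quad_vec_eq_0_iff[of s t a b] by auto
  then have "(s', t') \<noteq> (0, 0)" "(a', b') \<noteq> (0, 0)" using quad_vec_eq_0_iff by blast+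
  ultimately show "s * t' = s' * t" "a * b' = a' * b" by auto
qed

lemma par_biform: "biform 1 1 (\<lambda>s t a b. par s t a b $ i)"
proof -
  have "biform 1 1 (\<lambda>s t a b. quad_vec s t a b $ j)" for j
  proof -
    have "biform (1 + 0) (0 + 1) (\<lambda>s t a b. quad_vec s t a b $ j)"
      using exhaust_4[of j] biform_mult[OF biform_vars(1) biform_vars(3)]
        biform_mult[OF biform_vars(2) biform_vars(4)] biform_mult[OF biform_vars(1) biform_vars(4)]
        biform_mult[OF biform_vars(2) biform_vars(3)]
      by auto
    then show ?thesis by simp
  qed
  then show ?thesis
    unfolding par_def matrix_vector_mult_def vec_lambda_beta by (intro biform_sum biform_scale) auto
qed

lemma eval_par_biform:
  "homogeneous d f \<Longrightarrow> biform d d (\<lambda>s t a b. mpoly_eval f (par s t a b))"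
  using mpoly_eval_biform[OF _ par_biform] by force

text \<open>Along \<open>par\<close> a form of degree \<open>d\<close> pulls back to bidegree
  \<open>(d, d)\<close>. Applying \<open>N'\<close> to the local formula makes its values rank one
  matrices, so that both factors of the image can be read off from the entries of
  \<open>W\<close>.\<close>

lemma morphism_local_form:
  assumes "is_morphism S S \<phi>" "(s, t) \<noteq> (0, 0)" "(a, b) \<noteq> (0, 0)"
  obtains d e A and W :: "'k alg_closure \<Rightarrow> 'k alg_closure \<Rightarrow> 'k alg_closure \<Rightarrow> 'k alg_closure \<Rightarrow> 'k alg_closure^4" where "\<forall>i. biform d d (\<lambda>s t a b. W s t a b $ i)" "biform e e A" "A s t a b \<noteq> 0"
    "\<forall>s t a b. (s, t) \<noteq> (0, 0) \<longrightarrow> (a, b) \<noteq> (0, 0) \<longrightarrow> A s t a b \<noteq> 0 \<longrightarrow>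
      (\<exists>s' t' a' b'. (s', t') \<noteq> (0, 0) \<and> (a', b') \<noteq> (0, 0) \<and>
        par s' t' a' b' \<in> \<phi> (point_of (par s t a b)) \<and> W s t a b = quad_vec s' t' a' b')"
proof -
  let ?P = "point_of (par s t a b)"
  have P: "?P \<in> S" using assms par_in_S by blast
  have maps: "\<phi> Q \<in> S" if "Q \<in> S" for Q using assms(1) that by (auto simp: is_morphism_def)
  obtain U d F where F: "zariski_open U" "?P \<in> U" "\<forall>j. homogeneous d (F j)"
      "\<forall>Q\<in>S \<inter> U. \<forall>x\<in>Q. (\<chi> j. mpoly_eval (F j) x) \<in> \<phi> Q"
    using assms(1) P unfolding is_morphism_def by blast
  obtain f e where f: "homogeneous e f" "mpoly_eval f (par s t a b) \<noteq> 0"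
      "\<And>y. y \<noteq> 0 \<Longrightarrow> mpoly_eval f y \<noteq> 0 \<Longrightarrow> point_of y \<in> U"
    using zariski_openE[OF F(1,2)] by blast
  define W where "W s t a b = N' *v (\<chi> j. mpoly_eval (F j) (par s t a b))" for s t a b
  show ?thesis
  proof (rule that[of d W e "\<lambda>s t a b. mpoly_eval f (par s t a b)"])
    show "\<forall>i. biform d d (\<lambda>s t a b. W s t a b $ i)"
      unfolding W_def matrix_vector_mult_def vec_lambda_beta
      using F(3) by (intro allI biform_sum biform_scale eval_par_biform) auto
    show "biform e e (\<lambda>s t a b. mpoly_eval f (par s t a b))" using f(1) by (rule eval_par_biform)
    show "mpoly_eval f (par s t a b) \<noteq> 0" by (rule f(2))
    have "\<exists>s' t' a' b'. (s', t') \<noteq> (0, 0) \<and> (a', b') \<noteq> (0, 0) \<and>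
        par s' t' a' b' \<in> \<phi> (point_of (par s t a b)) \<and> W s t a b = quad_vec s' t' a' b'"
      if st: "(s, t) \<noteq> (0, 0)" and ab: "(a, b) \<noteq> (0, 0)" and nz: "mpoly_eval f (par s t a b) \<noteq> 0" for s t a b
    proof -
    let ?Q = "point_of (par s t a b)"
    have Q: "?Q \<in> S \<inter> U" using par_in_S[OF st ab] f(3)[OF par_nonzero[OF st ab] nz] by blast
    then have mem: "(\<chi> j. mpoly_eval (F j) (par s t a b)) \<in> \<phi> ?Q"
      by (intro F(4)[rule_format] self_mem_point_of)
    have "\<phi> ?Q \<in> S" using maps Q by simp
    then obtain s' t' a' b' where *: "(\<chi> j. mpoly_eval (F j) (par s t a b)) = par s' t' a' b'"
        "(s', t') \<noteq> (0, 0)" "(a', b') \<noteq> (0, 0)"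
      by (rule S_cases[OF _ mem])
    show ?thesis
      using * mem by (intro exI[of _ s'] exI[of _ t'] exI[of _ a'] exI[of _ b']) (auto simp: W_def)
    qed
    then show "\<forall>s t a b. (s, t) \<noteq> (0, 0) \<longrightarrow> (a, b) \<noteq> (0, 0) \<longrightarrow> mpoly_eval f (par s t a b) \<noteq> 0 \<longrightarrow>
      (\<exists>s' t' a' b'. (s', t') \<noteq> (0, 0) \<and> (a', b') \<noteq> (0, 0) \<and>
        par s' t' a' b' \<in> \<phi> (point_of (par s t a b)) \<and> W s t a b = quad_vec s' t' a' b')"
      by blast
  qed
qed

lemma point_mem_scale:
  assumes "Q \<in> S" "x \<in> Q" "c \<noteq> 0" shows "c *s x \<in> Q"
  using assms S_eq_point_of point_of_closed by metis

end

section \<open>Global formulas for morphisms, one factor at a time\<close>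

context geometric_quadric begin

text \<open>Every nonzero column of a rank one matrix represents its first factor: entries 1 and 4
  form one column, entries 3 and 2 the other. These are local pairs of forms for a map to the
  projective line, and \<open>R\<close> relates a point to all homogeneous coordinates of its image
  there, as the gluing requires.\<close>

lemma morphism_ruling1:
  assumes mor: "is_morphism S S \<phi>"
  obtains n m H1 H2 where "biform n m H1" "biform n m H2"
    "\<And>s t a b. (s, t) \<noteq> (0, 0) \<Longrightarrow> (a, b) \<noteq> (0, 0) \<Longrightarrow> (H1 s t a b, H2 s t a b) \<noteq> (0, 0) \<and>
      (\<exists>a' b'. (a', b') \<noteq> (0, 0) \<and> par (H1 s t a b) (H2 s t a b) a' b' \<in> \<phi> (point_of (par s t a b)))"
proof -
  have maps: "\<phi> (point_of (par s t a b)) \<in> S" if "(s, t) \<noteq> (0, 0)" "(a, b) \<noteq> (0, 0)" for s t a b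
    using mor par_in_S[OF that] by (auto simp: is_morphism_def)
  define R where "R s t a b x y \<longleftrightarrow> (s, t) \<noteq> (0, 0) \<and> (a, b) \<noteq> (0, 0) \<and> (x, y) \<noteq> (0, 0) \<and> 
    (\<exists>a' b'. (a', b') \<noteq> (0, 0) \<and> par x y a' b' \<in> \<phi> (point_of (par s t a b)))" for s t a b x y
  have "\<exists>n m H1 H2. biform n m H1 \<and> biform n m H2 \<and>
    (\<forall>s t a b. (s, t) \<noteq> (0, 0) \<longrightarrow> (a, b) \<noteq> (0, 0) \<longrightarrow> R s t a b (H1 s t a b) (H2 s t a b))"
  proof (rule glue_local_biforms[of R])
    show "\<not> R s t a b 0 0" for s t a b by (simp add: R_def)
  next
    fix s t a b x y x' y' assume R: "R s t a b x y" "R s t a b x' y'"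
    then obtain a1 b1 a2 b2 where ab: "(a1, b1) \<noteq> (0, 0)" "(a2, b2) \<noteq> (0, 0)"
      "par x y a1 b1 \<in> \<phi> (point_of (par s t a b))" "par x' y' a2 b2 \<in> \<phi> (point_of (par s t a b))"
      unfolding R_def by blast
    have "\<phi> (point_of (par s t a b)) \<in> S" using R maps by (auto simp: R_def)
    then have "point_of (par x y a1 b1) = point_of (par x' y' a2 b2)"
      using ab(3,4) S_eq_point_of by metis
    then show "x * y' = x' * y" using par_same_point(1) R ab unfolding R_def by blast
  next
    fix s t a b x y and c :: "'k alg_closure" assume R: "R s t a b x y" and c: "c \<noteq> 0"
    then obtain a1 b1 where ab: "(a1, b1) \<noteq> (0, 0)" "par x y a1 b1 \<in> \<phi> (point_of (par s t a b))"
      unfolding R_def by blast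
    have "\<phi> (point_of (par s t a b)) \<in> S" using R maps by (auto simp: R_def)
    then have "par (c * x) (c * y) (1 * a1) (1 * b1) \<in> \<phi> (point_of (par s t a b))"
      unfolding par_scale using point_mem_scale ab c by simp
    then have "par (c * x) (c * y) a1 b1 \<in> \<phi> (point_of (par s t a b))" by simp
    moreover have "(c * x, c * y) \<noteq> (0, 0)" using R c by (auto simp: R_def)
    ultimately show "R s t a b (c * x) (c * y)" using R ab unfolding R_def by blast
  next
    fix s t a b :: "'k alg_closure" assume st: "(s, t) \<noteq> (0, 0)" and ab: "(a, b) \<noteq> (0, 0)"
    obtain d e A and W :: "'k alg_closure \<Rightarrow> 'k alg_closure \<Rightarrow> 'k alg_closure \<Rightarrow> 'k alg_closure \<Rightarrow> 'k alg_closure^4" where W_all: "\<forall>i. biform d d (\<lambda>s t a b. W s t a b $ i)"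
      and W: "biform e e A" "A s t a b \<noteq> 0"
      and loc_all: "\<forall>s t a b. (s, t) \<noteq> (0, 0) \<longrightarrow> (a, b) \<noteq> (0, 0) \<longrightarrow> A s t a b \<noteq> 0 \<longrightarrow>
      (\<exists>s' t' a' b'. (s', t') \<noteq> (0, 0) \<and> (a', b') \<noteq> (0, 0) \<and>
        par s' t' a' b' \<in> \<phi> (point_of (par s t a b)) \<and> W s t a b = quad_vec s' t' a' b')"
      by (rule morphism_local_form[OF mor st ab])
    note Wi = W_all[rule_format] and loc = loc_all[rule_format]
    have col: "R s t a b (W s t a b $ 1) (W s t a b $ 4)"
      if c: "(s, t) \<noteq> (0, 0)" "(a, b) \<noteq> (0, 0)" "A s t a b \<noteq> 0" "(W s t a b $ 1, W s t a b $ 4) \<noteq> (0, 0)" for s t a b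
    proof -
      obtain s' t' a' b' where *: "(s', t') \<noteq> (0, 0)" "(a', b') \<noteq> (0, 0)"
        "par s' t' a' b' \<in> \<phi> (point_of (par s t a b))" "W s t a b = quad_vec s' t' a' b'"
        using loc[OF c(1-3)] by blast
      then have "a' \<noteq> 0" using c(4) by auto
      then have "a' *s par s' t' a' b' \<in> \<phi> (point_of (par s t a b))"
        using point_mem_scale[OF maps[OF c(1,2)] *(3)] by simp
      then have "par (s' * a') (t' * a') a' b' \<in> \<phi> (point_of (par s t a b))"
        using par_scale[of a' s' t' 1 a' b'] by (simp add: mult.commute)
      then show ?thesis using c * unfolding R_def by auto
    qed
    have col': "R s t a b (W s t a b $ 3) (W s t a b $ 2)"
      if c: "(s, t) \<noteq> (0, 0)" "(a, b) \<noteq> (0, 0)" "A s t a b \<noteq> 0" "(W s t a b $ 3, W s t a b $ 2) \<noteq> (0, 0)" for s t a b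
    proof -
      obtain s' t' a' b' where *: "(s', t') \<noteq> (0, 0)" "(a', b') \<noteq> (0, 0)"
        "par s' t' a' b' \<in> \<phi> (point_of (par s t a b))" "W s t a b = quad_vec s' t' a' b'"
        using loc[OF c(1-3)] by blast
      then have "b' \<noteq> 0" using c(4) by auto
      then have "b' *s par s' t' a' b' \<in> \<phi> (point_of (par s t a b))"
        using point_mem_scale[OF maps[OF c(1,2)] *(3)] by simp
      then have "par (s' * b') (t' * b') a' b' \<in> \<phi> (point_of (par s t a b))"
        using par_scale[of b' s' t' 1 a' b'] by (simp add: mult.commute)
      then show ?thesis using c * unfolding R_def by auto
    qed
    have "W s t a b \<noteq> 0" using loc[OF st ab W(2)] quad_vec_eq_0_iff by metis
    \<comment> \<open>Either column may vanish at the given point, but not both. Multiplying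
      \<open>A\<close> by a nonzero entry of the chosen column keeps that column nonzero on the
      whole neighbourhood.\<close>
    then consider i where "W s t a b $ i \<noteq> 0" "i = 1 \<or> i = 4" | i where "W s t a b $ i \<noteq> 0" "i = 3 \<or> i = 2"
      unfolding vec4_eq_iff by (metis zero_index)
    then show "\<exists>n m n' m' F1 F2 A. biform n m F1 \<and> biform n m F2 \<and> biform n' m' A \<and> A s t a b \<noteq> 0 \<and>
        (\<forall>s t a b. (s, t) \<noteq> (0, 0) \<longrightarrow> (a, b) \<noteq> (0, 0) \<longrightarrow> A s t a b \<noteq> 0 \<longrightarrow>
           R s t a b (F1 s t a b) (F2 s t a b))"
    proof cases
      case 1
      show ?thesis
        by (rule exI[of _ d], rule exI[of _ d], rule exI[of _ "e + d"], rule exI[of _ "e + d"],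
            rule exI[of _ "\<lambda>s t a b. W s t a b $ 1"], rule exI[of _ "\<lambda>s t a b. W s t a b $ 4"],
            rule exI[of _ "\<lambda>s t a b. A s t a b * W s t a b $ i"])
          (use 1 W Wi col biform_mult[OF W(1) Wi[of i]] in auto)
    next
      case 2
      show ?thesis
        by (rule exI[of _ d], rule exI[of _ d], rule exI[of _ "e + d"], rule exI[of _ "e + d"],
            rule exI[of _ "\<lambda>s t a b. W s t a b $ 3"], rule exI[of _ "\<lambda>s t a b. W s t a b $ 2"],
            rule exI[of _ "\<lambda>s t a b. A s t a b * W s t a b $ i"])
          (use 2 W Wi col' biform_mult[OF W(1) Wi[of i]] in auto)
    qed
  qed blast
  then show ?thesis using that unfolding R_def by metis
qed

end

lemma biform_swap:
  assumes "biform n m P"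
  shows "biform m n (\<lambda>s t a b. P a b s t)"
  using biform_compose[OF assms biform_vars(3,4) biform_vars(1,2)] by simp

lemma biform_identity_degrees':
  fixes P Q :: "'c::{alg_closed_field,field_char_0} \<Rightarrow> 'c \<Rightarrow> 'c \<Rightarrow> 'c \<Rightarrow> 'c"
  assumes P: "biform n m P" and Q: "biform n m Q"
    and nz: "\<And>s t a b. (s, t) \<noteq> (0, 0) \<Longrightarrow> (a, b) \<noteq> (0, 0) \<Longrightarrow> (P s t a b, Q s t a b) \<noteq> (0, 0)"
    and eq: "\<And>s t a b. (s, t) \<noteq> (0, 0) \<Longrightarrow> (a, b) \<noteq> (0, 0) \<Longrightarrow> P s t a b * b = Q s t a b * a"
  shows "n = 0 \<and> m = 1"
  using biform_identity_degrees[OF biform_swap[OF P] biform_swap[OF Q] nz eq] by simp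

text \<open>Transposition of matrices in the coordinates of \<open>quad_vec\<close>. It exchanges
  the factors, so a statement about the first factor yields one about the second.\<close>

definition swap34 :: "'c::comm_ring_1^4^4" where
  "swap34 = (\<chi> i j. if (i, j) \<in> {(1, 1), (2, 2), (3, 4), (4, 3)} then 1 else 0)"

lemma swap34_mult: "(swap34 *v y) $ 1 = y $ 1" "(swap34 *v y) $ 2 = y $ 2"
  "(swap34 *v y) $ 3 = y $ 4" "(swap34 *v y) $ 4 = y $ 3"
  by (simp_all add: swap34_def matrix_vector_mult_def sum_4)

lemma swap34_involution: "swap34 ** swap34 = mat 1"
proof -
  have "(swap34 ** swap34) *v y = y" for y :: "'a^4"
    unfolding matrix_vector_mul_assoc[symmetric] by (simp add: vec4_eq_iff swap34_mult)
  then show ?thesis by (simp add: matrix_eq)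
qed

context geometric_quadric begin

lemma morphism_ruling2:
  assumes mor: "is_morphism S S \<phi>"
  obtains n m H1 H2 where "biform n m H1" "biform n m H2"
    "\<And>s t a b. (s, t) \<noteq> (0, 0) \<Longrightarrow> (a, b) \<noteq> (0, 0) \<Longrightarrow> (H1 s t a b, H2 s t a b) \<noteq> (0, 0) \<and>
      (\<exists>s' t'. (s', t') \<noteq> (0, 0) \<and> par s' t' (H1 s t a b) (H2 s t a b) \<in> \<phi> (point_of (par s t a b)))"
proof -
  interpret T: geometric_quadric "N ** swap34" "swap34 ** N'" S
  proof
    show "(N ** swap34) ** (swap34 ** N') = mat 1"
      by (metis N_inv(1) matrix_mul_assoc matrix_mul_rid swap34_involution)
    show "(swap34 ** N') ** (N ** swap34) = mat 1"
      by (metis N_inv(2) matrix_mul_assoc matrix_mul_rid swap34_involution)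
    show "S = {point_of x |x. x \<noteq> 0 \<and> ((swap34 ** N') *v x) $ 1 * ((swap34 ** N') *v x) $ 2 =
      ((swap34 ** N') *v x) $ 3 * ((swap34 ** N') *v x) $ 4}"
      unfolding S_eq matrix_vector_mul_assoc[symmetric] swap34_mult by (simp add: mult.commute)
  qed
  have Tpar: "T.par a b s t = par s t a b" for s t a b
  proof -
    have "swap34 *v quad_vec a b s t = quad_vec s t a b"
      by (simp add: vec4_eq_iff swap34_mult mult.commute)
    then show ?thesis unfolding T.par_def par_def matrix_vector_mul_assoc[symmetric] by simp
  qed
  obtain n m H1 H2 where H: "biform n m H1" "biform n m H2" and
    main: "\<And>s t a b. (s, t) \<noteq> (0, 0) \<Longrightarrow> (a, b) \<noteq> (0, 0) \<Longrightarrow> (H1 s t a b, H2 s t a b) \<noteq> (0, 0) \<and>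
      (\<exists>a' b'. (a', b') \<noteq> (0, 0) \<and> T.par (H1 s t a b) (H2 s t a b) a' b' \<in> \<phi> (point_of (T.par s t a b)))"
    using T.morphism_ruling1[OF mor] by metis
  show ?thesis
    by (rule that[OF biform_swap[OF H(1)] biform_swap[OF H(2)]]) (use main Tpar in simp)
qed

text \<open>Each factor is known separately, next to some unspecified partner vector. As both
  descriptions concern the same image point, the partner of the first factor is proportional to the
  form found for the second.\<close>

lemma morphism_global_form:
  assumes mor: "is_morphism S S \<phi>"
  obtains i j k l H1 H2 K1 K2 where "biform i j H1" "biform i j H2" "biform k l K1" "biform k l K2"
    "\<And>s t a b. (s, t) \<noteq> (0, 0) \<Longrightarrow> (a, b) \<noteq> (0, 0) \<Longrightarrow>
      (H1 s t a b, H2 s t a b) \<noteq> (0, 0) \<and> (K1 s t a b, K2 s t a b) \<noteq> (0, 0) \<and>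
      par (H1 s t a b) (H2 s t a b) (K1 s t a b) (K2 s t a b) \<in> \<phi> (point_of (par s t a b))"
proof -
  obtain i j H1 H2 where H: "biform i j H1" "biform i j H2" and
    H': "\<And>s t a b. (s, t) \<noteq> (0, 0) \<Longrightarrow> (a, b) \<noteq> (0, 0) \<Longrightarrow> (H1 s t a b, H2 s t a b) \<noteq> (0, 0) \<and>
      (\<exists>a' b'. (a', b') \<noteq> (0, 0) \<and> par (H1 s t a b) (H2 s t a b) a' b' \<in> \<phi> (point_of (par s t a b)))"
    using morphism_ruling1[OF mor] by metis
  obtain k l K1 K2 where K: "biform k l K1" "biform k l K2" and
    K': "\<And>s t a b. (s, t) \<noteq> (0, 0) \<Longrightarrow> (a, b) \<noteq> (0, 0) \<Longrightarrow> (K1 s t a b, K2 s t a b) \<noteq> (0, 0) \<and>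
      (\<exists>s' t'. (s', t') \<noteq> (0, 0) \<and> par s' t' (K1 s t a b) (K2 s t a b) \<in> \<phi> (point_of (par s t a b)))"
    using morphism_ruling2[OF mor] by metis
  have mem: "par (H1 s t a b) (H2 s t a b) (K1 s t a b) (K2 s t a b) \<in> \<phi> (point_of (par s t a b))"
    if c: "(s, t) \<noteq> (0, 0)" "(a, b) \<noteq> (0, 0)" for s t a b
  proof -
    let ?Q = "\<phi> (point_of (par s t a b))"
    have Q: "?Q \<in> S" using mor par_in_S[OF c] by (auto simp: is_morphism_def)
    obtain a' b' where ab: "(a', b') \<noteq> (0, 0)" "par (H1 s t a b) (H2 s t a b) a' b' \<in> ?Q"
      using H'[OF c] by blast
    obtain s' t' where st: "(s', t') \<noteq> (0, 0)" "par s' t' (K1 s t a b) (K2 s t a b) \<in> ?Q"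
      using K'[OF c] by blast
    have "point_of (par (H1 s t a b) (H2 s t a b) a' b') = point_of (par s' t' (K1 s t a b) (K2 s t a b))"
      using S_eq_point_of[OF Q ab(2)] S_eq_point_of[OF Q st(2)] by simp
    from par_same_point(2)[OF this] have "a' * K2 s t a b = K1 s t a b * b'"
      using H'[OF c] ab by blast
    then obtain d where d: "d \<noteq> 0" "K1 s t a b = d * a'" "K2 s t a b = d * b'"
      using pair_proportional[of a' b' "K1 s t a b" "K2 s t a b"] K'[OF c] ab by blast
    have "par (H1 s t a b) (H2 s t a b) (K1 s t a b) (K2 s t a b) = d *s par (H1 s t a b) (H2 s t a b) a' b'"
      using par_scale[of 1 "H1 s t a b" "H2 s t a b" d a' b'] d by simp
    then show ?thesis using point_mem_scale[OF Q ab(2) d(1)] by simp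
  qed
  show ?thesis
  proof (rule that[OF H K])
    fix s t a b :: "'k alg_closure"
    assume c: "(s, t) \<noteq> (0, 0)" "(a, b) \<noteq> (0, 0)"
    show "(H1 s t a b, H2 s t a b) \<noteq> (0, 0) \<and> (K1 s t a b, K2 s t a b) \<noteq> (0, 0) \<and>
      par (H1 s t a b) (H2 s t a b) (K1 s t a b) (K2 s t a b) \<in> \<phi> (point_of (par s t a b))"
      using conjunct1[OF H'[OF c]] conjunct1[OF K'[OF c]] mem[OF c] by (intro conjI)
  qed
qed

text \<open>The bidegrees of a morphism form a matrix of natural numbers, which is multiplicative under
  composition. So an automorphism has a permutation matrix of bidegrees.\<close>

lemma automorphism_global_form:
  assumes mor: "is_morphism S S \<phi>" "is_morphism S S \<psi>" and inv: "\<And>P. P \<in> S \<Longrightarrow> \<psi> (\<phi> P) = P"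
  obtains H1 H2 K1 K2 where
    "biform 1 0 H1 \<and> biform 1 0 H2 \<and> biform 0 1 K1 \<and> biform 0 1 K2 \<or>
     biform 0 1 H1 \<and> biform 0 1 H2 \<and> biform 1 0 K1 \<and> biform 1 0 K2"
    "\<And>s t a b. (s, t) \<noteq> (0, 0) \<Longrightarrow> (a, b) \<noteq> (0, 0) \<Longrightarrow>
      (H1 s t a b, H2 s t a b) \<noteq> (0, 0) \<and> (K1 s t a b, K2 s t a b) \<noteq> (0, 0) \<and>
      par (H1 s t a b) (H2 s t a b) (K1 s t a b) (K2 s t a b) \<in> \<phi> (point_of (par s t a b))"
proof -
  obtain i j k l H1 H2 K1 K2 where H: "biform i j H1" "biform i j H2" "biform k l K1" "biform k l K2" and
    f: "\<And>s t a b. (s, t) \<noteq> (0, 0) \<Longrightarrow> (a, b) \<noteq> (0, 0) \<Longrightarrow>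
      (H1 s t a b, H2 s t a b) \<noteq> (0, 0) \<and> (K1 s t a b, K2 s t a b) \<noteq> (0, 0) \<and>
      par (H1 s t a b) (H2 s t a b) (K1 s t a b) (K2 s t a b) \<in> \<phi> (point_of (par s t a b))"
    using morphism_global_form[OF mor(1)] by metis
  obtain i' j' k' l' G1 G2 L1 L2 where G: "biform i' j' G1" "biform i' j' G2" "biform k' l' L1" "biform k' l' L2" and
    g: "\<And>s t a b. (s, t) \<noteq> (0, 0) \<Longrightarrow> (a, b) \<noteq> (0, 0) \<Longrightarrow>
      (G1 s t a b, G2 s t a b) \<noteq> (0, 0) \<and> (L1 s t a b, L2 s t a b) \<noteq> (0, 0) \<and>
      par (G1 s t a b) (G2 s t a b) (L1 s t a b) (L2 s t a b) \<in> \<psi> (point_of (par s t a b))"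
    using morphism_global_form[OF mor(2)] by metis
  \<comment> \<open>Pulling back along \<open>\<phi>\<close> is substitution of its forms. The
    substituted pairs represent the identity, so their bidegrees must be those of the two
    projections.\<close>
  define after where "after = (\<lambda>F s t a b. F (H1 s t a b) (H2 s t a b) (K1 s t a b) (K2 s t a b) :: 'k alg_closure)"
  have comp: "(after G1 s t a b, after G2 s t a b) \<noteq> (0, 0) \<and> (after L1 s t a b, after L2 s t a b) \<noteq> (0, 0)
      \<and> after G1 s t a b * t = after G2 s t a b * s \<and> after L1 s t a b * b = after L2 s t a b * a"
    if c: "(s, t) \<noteq> (0, 0)" "(a, b) \<noteq> (0, 0)" for s t a b
  proof -
    let ?P = "point_of (par s t a b)"
    let ?h1 = "H1 s t a b" and ?h2 = "H2 s t a b" and ?k1 = "K1 s t a b" and ?k2 = "K2 s t a b"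
    have P: "?P \<in> S" using par_in_S[OF c] .
    then have "\<phi> ?P \<in> S" using mor by (auto simp: is_morphism_def)
    then have "\<phi> ?P = point_of (par ?h1 ?h2 ?k1 ?k2)" using f[OF c] S_eq_point_of by blast
    then have "\<psi> (point_of (par ?h1 ?h2 ?k1 ?k2)) = ?P" using inv[OF P] by simp
    then have *: "(after G1 s t a b, after G2 s t a b) \<noteq> (0, 0)" "(after L1 s t a b, after L2 s t a b) \<noteq> (0, 0)"
       "par (after G1 s t a b) (after G2 s t a b) (after L1 s t a b) (after L2 s t a b) \<in> ?P"
      using g[of ?h1 ?h2 ?k1 ?k2] f[OF c] unfolding after_def by auto
    have "point_of (par (after G1 s t a b) (after G2 s t a b) (after L1 s t a b) (after L2 s t a b)) = ?P"
      using point_of_eq[OF *(3)] .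
    from par_same_point[OF this *(1,2)] show ?thesis using * by (simp add: mult.commute)
  qed
  have "i' * i + j' * k = 1 \<and> i' * j + j' * l = 0"
  proof (rule biform_identity_degrees)
    show "biform (i' * i + j' * k) (i' * j + j' * l) (after G1)" "biform (i' * i + j' * k) (i' * j + j' * l) (after G2)"
      unfolding after_def using biform_compose G H by blast+
  qed (use comp in blast)+
  moreover have "k' * i + l' * k = 0 \<and> k' * j + l' * l = 1"
  proof (rule biform_identity_degrees')
    show "biform (k' * i + l' * k) (k' * j + l' * l) (after L1)" "biform (k' * i + l' * k) (k' * j + l' * l) (after L2)"
      unfolding after_def using biform_compose G H by blast+
  qed (use comp in blast)+
  \<comment> \<open>A 2 by 2 matrix of natural numbers that has a left inverse of the same kind is a
    permutation matrix.\<close>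
  ultimately have "i = 1 \<and> j = 0 \<and> k = 0 \<and> l = 1 \<or> i = 0 \<and> j = 1 \<and> k = 1 \<and> l = 0"
    by (auto simp: add_is_1)
  then have "biform 1 0 H1 \<and> biform 1 0 H2 \<and> biform 0 1 K1 \<and> biform 0 1 K2 \<or>
     biform 0 1 H1 \<and> biform 0 1 H2 \<and> biform 1 0 K1 \<and> biform 1 0 K2"
    using H by auto
  then show ?thesis by (rule that) (rule f)
qed

end

section \<open>Automorphisms of quadrics\<close>

lemma vec2_eq_iff: "x = y \<longleftrightarrow> x $ 1 = y $ 1 \<and> x $ 2 = (y $ 2 :: 'c)" for x y :: "'c^2"
  by (simp add: vec_eq_iff forall_2)

lemma mult_vec2: "(M *v x) $ i = M $ i $ 1 * x $ 1 + M $ i $ 2 * x $ 2" for M :: "'c::comm_ring_1^2^2"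
  by (simp add: matrix_vector_mult_def sum_2)

text \<open>The characteristic equation makes the rows of \<open>M - l\<close> dependent, so a
  vector orthogonal to one nonzero row is in the kernel: \<open>(q, - p)\<close> for a row
  \<open>(p, q)\<close>, up to sign. If both rows vanish, any vector will do.\<close>

lemma eigenvector2:
  fixes M :: "'c::field^2^2"
  assumes l: "l * l - (M$1$1 + M$2$2) * l + det M = 0"
  obtains u where "u \<noteq> 0" "M *v u = l *s u"
proof -
  have l': "l * l - (M$1$1 + M$2$2) * l + (M$1$1 * M$2$2 - M$1$2 * M$2$1) = 0"
    using l by (simp add: det_2)
  consider "M$1$2 \<noteq> 0 \<or> l \<noteq> M$1$1" | "M$2$1 \<noteq> 0 \<or> l \<noteq> M$2$2"
    | "M$1$2 = 0" "l = M$1$1" "M$2$1 = 0" "l = M$2$2" by blast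
  then show ?thesis
  proof cases
    case 1
    define u :: "'c^2" where "u = (\<chi> i. if i = 1 then M$1$2 else l - M$1$1)"
    have "M *v u = l *s u"
      using l' by (simp add: vec2_eq_iff mult_vec2 u_def) (simp add: algebra_simps)
    moreover have "u \<noteq> 0" using 1 by (auto simp: vec2_eq_iff u_def)
    ultimately show ?thesis using that by blast
  next
    case 2
    define u :: "'c^2" where "u = (\<chi> i. if i = 1 then l - M$2$2 else M$2$1)"
    have "M *v u = l *s u"
      using l' by (simp add: vec2_eq_iff mult_vec2 u_def) (simp add: algebra_simps)
    moreover have "u \<noteq> 0" using 2 by (auto simp: vec2_eq_iff u_def)
    ultimately show ?thesis using that by blast
  next
    case 3
    define u :: "'c^2" where "u = (\<chi> i. 1)"
    have "M *v u = l *s u" "u \<noteq> 0"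
      using 3 by (simp_all add: vec2_eq_iff mult_vec2 u_def)
    then show ?thesis using that by blast
  qed
qed

text \<open>The Cayley-Hamilton theorem for the matrix with rows \<open>(a, b)\<close> and
  \<open>(c, 2 * l - a)\<close>: its trace is \<open>2 * l\<close>, the assumption says that its
  determinant is \<open>l * l\<close>, so the square of the matrix minus \<open>l\<close> is zero.
  The two conclusions are the coordinates of this identity applied to \<open>(x, y)\<close>.\<close>

lemma nilpotent:
  fixes a b c l :: "'c::comm_ring_1"
  assumes "b * c = a * (2 * l - a) - l * l"
  shows "a * (a * x + b * y - l * x) + b * (c * x + (2 * l - a) * y - l * y) = l * (a * x + b * y - l * x)"
    and "c * (a * x + b * y - l * x) + (2 * l - a) * (c * x + (2 * l - a) * y - l * y)
      = l * (c * x + (2 * l - a) * y - l * y)"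
proof -
  have x: "b * (c * x) = (a * (2 * l - a) - l * l) * x" "c * (b * y) = (a * (2 * l - a) - l * l) * y"
    using assms by (simp_all flip: mult.assoc) (simp_all add: mult.commute)
  show "a * (a * x + b * y - l * x) + b * (c * x + (2 * l - a) * y - l * y) = l * (a * x + b * y - l * x)"
    by (simp add: distrib_left right_diff_distrib x) (simp add: algebra_simps)
  show "c * (a * x + b * y - l * x) + (2 * l - a) * (c * x + (2 * l - a) * y - l * y)
      = l * (c * x + (2 * l - a) * y - l * y)"
    by (simp add: distrib_left right_diff_distrib x) (simp add: algebra_simps)
qed

lemma cramer2:
  fixes p q :: "'c::comm_ring_1"
  assumes "p * a + q * b = 0" "p * c + q * d = 0"
  shows "p * (a * d - c * b) = 0" "q * (a * d - c * b) = 0"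
proof -
  have "p * (a * d - c * b) = (p * a + q * b) * d - (p * c + q * d) * b"
    "q * (a * d - c * b) = (p * c + q * d) * a - (p * a + q * b) * c"
    by (simp_all add: algebra_simps)
  then show "p * (a * d - c * b) = 0" "q * (a * d - c * b) = 0" using assms by simp_all
qed

text \<open>A double eigenvalue would make \<open>M\<close> a scalar plus a nonzero nilpotent matrix, no power of which
  is scalar in characteristic \<open>0\<close>.\<close>

lemma two_eigenlines:
  fixes M :: "'c::{alg_closed_field,field_char_0}^2^2"
  assumes inj: "\<And>u. u \<noteq> 0 \<Longrightarrow> M *v u \<noteq> 0" and n: "n > 0"
    and per: "\<And>u. \<exists>c. (((*v) M) ^^ n) u = c *s u"
    and nonscalar: "\<And>c. M *v w \<noteq> c *s w"
  obtains u1 u2 l1 l2 where "u1 \<noteq> 0" "u2 \<noteq> 0" "M *v u1 = l1 *s u1" "M *v u2 = l2 *s u2"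
    "l1 \<noteq> l2" "l1 * l2 = det M"
    "\<And>u c. u \<noteq> 0 \<Longrightarrow> M *v u = c *s u \<Longrightarrow> (\<exists>d. u = d *s u1) \<and> c = l1 \<or> (\<exists>d. u = d *s u2) \<and> c = l2"
proof -
  let ?t = "M$1$1 + M$2$2"
  have "degree [:det M, - ?t, 1:] = 2" by simp
  then obtain l1 where "poly [:det M, - ?t, 1:] l1 = 0"
    using alg_closed_imp_poly_has_root[of "[:det M, - ?t, 1:]"] by (metis zero_less_numeral)
  then have r1: "l1 * l1 - ?t * l1 + det M = 0" by (simp add: algebra_simps)
  define l2 where "l2 = ?t - l1"
  have prod: "l1 * l2 = det M" using r1 by (simp add: l2_def algebra_simps)
  have r2: "l2 * l2 - ?t * l2 + det M = 0"
    unfolding prod[symmetric] by (simp add: l2_def algebra_simps)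
  have sum: "l1 + l2 = ?t" by (simp add: l2_def)
  obtain u1 where u1: "u1 \<noteq> 0" "M *v u1 = l1 *s u1" using eigenvector2[OF r1] .
  obtain u2 where u2: "u2 \<noteq> 0" "M *v u2 = l2 *s u2" using eigenvector2[OF r2] .
  have ne: "l1 \<noteq> l2"
  proof
    assume eq: "l1 = l2"
    \<comment> \<open>The nilpotent part of \<open>M\<close> applied to \<open>w\<close>; since its
      square is zero, \<open>z\<close> is an eigenvector.\<close>
    define z where "z = M *v w - l1 *s w"
    have Mw: "M *v w = l1 *s w + z" by (simp add: z_def)
    have t: "?t = 2 * l1" "det M = l1 * l1" using sum prod eq by simp_all
    have "M$1$1 * M$2$2 - M$1$2 * M$2$1 = l1 * l1" using t by (simp add: det_2)
    then have d: "M$1$2 * M$2$1 = M$1$1 * M$2$2 - l1 * l1" by (simp add: algebra_simps)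
    have m22: "M$2$2 = 2 * l1 - M$1$1" using t by (simp add: algebra_simps)
    have d': "M$1$2 * M$2$1 = M$1$1 * (2 * l1 - M$1$1) - l1 * l1" using d m22 by simp
    have Mz: "M *v z = l1 *s z"
    proof -
      have "M$1$1 * (M$1$1 * w$1 + M$1$2 * w$2 - l1 * w$1) + M$1$2 * (M$2$1 * w$1 + M$2$2 * w$2 - l1 * w$2) =
        l1 * (M$1$1 * w$1 + M$1$2 * w$2 - l1 * w$1)"
        using nilpotent(1)[OF d'] m22 by simp
      moreover have "M$2$1 * (M$1$1 * w$1 + M$1$2 * w$2 - l1 * w$1) + M$2$2 * (M$2$1 * w$1 + M$2$2 * w$2 - l1 * w$2) =
        l1 * (M$2$1 * w$1 + M$2$2 * w$2 - l1 * w$2)"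
        using nilpotent(2)[OF d'] m22 by simp
      ultimately show ?thesis by (simp add: vec2_eq_iff mult_vec2 z_def)
    qed
    \<comment> \<open>The binomial expansion of a scalar plus a nilpotent matrix, which stops after
      the linear term.\<close>
    have pow: "(((*v) M) ^^ Suc k) w = l1 ^ Suc k *s w + (of_nat (Suc k) * l1 ^ k) *s z" for k
    proof (induction k)
      case 0
      then show ?case by (simp add: Mw)
    next
      case (Suc k)
      have "(((*v) M) ^^ Suc (Suc k)) w = M *v (l1 ^ Suc k *s w + (of_nat (Suc k) * l1 ^ k) *s z)"
        using Suc.IH by simp
      also have "\<dots> = l1 ^ Suc k *s (l1 *s w + z) + (of_nat (Suc k) * l1 ^ k) *s (l1 *s z)"
        by (simp only: matrix_vector_right_distrib vector_scalar_commute Mw Mz)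
      also have "\<dots> = l1 ^ Suc (Suc k) *s w + (of_nat (Suc (Suc k)) * l1 ^ Suc k) *s z"
        by (simp add: vec_eq_iff algebra_simps)
      finally show ?case .
    qed
    obtain k where k: "n = Suc k" using n by (cases n) auto
    obtain c where "(((*v) M) ^^ n) w = c *s w" using per by blast
    then have e: "(of_nat (Suc k) * l1 ^ k) *s z = (c - l1 ^ Suc k) *s w"
      using pow[of k] by (simp add: k vector_sub_rdistrib algebra_simps)
    have l1: "l1 \<noteq> 0" using inj[OF u1(1)] u1(2) by auto
    \<comment> \<open>Here characteristic 0 enters. Consequently \<open>z\<close> is a multiple of
      \<open>w\<close>, and \<open>w\<close> would be an eigenvector after all.\<close>
    then have "of_nat (Suc k) * l1 ^ k \<noteq> 0" using of_nat_neq_0 by auto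
    then obtain m r where m: "m \<noteq> 0" "m *s z = r *s w" using e by blast
    have "(1 / m) *s (m *s z) = (1 / m) *s (r *s w)" using m(2) by simp
    then have "z = (r / m) *s w" using m(1) by (simp add: vector_smult_assoc)
    then have "M *v w = (l1 + r / m) *s w"
      using Mw by (simp add: vector_sadd_rdistrib)
    then show False using nonscalar by blast
  qed
  \<comment> \<open>Eigenvectors for distinct eigenvalues are independent, so this determinant is
    nonzero and serves as the denominator in Cramer's rule for the coordinates of any further
    eigenvector.\<close>
  define D where "D = u1$1 * u2$2 - u1$2 * u2$1"
  have D: "D \<noteq> 0"
  proof
    assume D0: "D = 0"
    have e: "M *v u1 = l1 *s u1" "M *v u2 = l2 *s u2" using u1 u2 by auto
    have e1: "M$1$1 * u1$1 + M$1$2 * u1$2 = l1 * u1$1" "M$2$1 * u1$1 + M$2$2 * u1$2 = l1 * u1$2"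
      "M$1$1 * u2$1 + M$1$2 * u2$2 = l2 * u2$1" "M$2$1 * u2$1 + M$2$2 * u2$2 = l2 * u2$2"
      using e by (simp_all add: vec2_eq_iff mult_vec2)
    obtain c where c: "c \<noteq> 0" "u2 = c *s u1"
    proof (cases "u1$1 = 0")
      case True
      then have "u1$2 \<noteq> 0" "u2$1 = 0" using u1 D0 by (auto simp: vec2_eq_iff D_def)
      then show ?thesis using that[of "u2$2 / u1$2"] u2(1) True by (auto simp: vec2_eq_iff)
    next
      case False
      then have "u2 = (u2$1 / u1$1) *s u1" using D0 by (auto simp: vec2_eq_iff D_def field_simps)
      moreover have "u2$1 / u1$1 \<noteq> 0" using u2(1) calculation by auto
      ultimately show ?thesis using that by blast
    qed
    have "l2 *s u2 = l1 *s u2" unfolding u2(2)[symmetric] using u1(2) c by (simp add: vector_scalar_commute vector_smult_assoc mult.commute)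
    then show False using ne u2(1) by auto
  qed
  have fin: "(\<exists>d. u = d *s u1) \<and> c = l1 \<or> (\<exists>d. u = d *s u2) \<and> c = l2" if u: "u \<noteq> 0" "M *v u = c *s u" for u c
  proof -
    define p where "p = (u$1 * u2$2 - u$2 * u2$1) / D"
    define q where "q = (u1$1 * u$2 - u1$2 * u$1) / D"
    have uu: "u = p *s u1 + q *s u2"
      using D by (simp add: vec2_eq_iff p_def q_def divide_simps) (simp add: D_def algebra_simps)
    have "c *s (p *s u1 + q *s u2) = p *s (l1 *s u1) + q *s (l2 *s u2)"
      using u(2) u1(2) u2(2) unfolding uu by (simp add: matrix_vector_right_distrib vector_scalar_commute)
    then have *: "(p * (c - l1)) * u1$i + (q * (c - l2)) * u2$i = 0" for i
      by (simp add: vec_eq_iff algebra_simps)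
    have "p * (c - l1) * D = 0" "q * (c - l2) * D = 0"
      unfolding D_def using cramer2[OF *[of 1] *[of 2]] by auto
    then have "p = 0 \<or> c = l1" "q = 0 \<or> c = l2" using D by auto
    then show ?thesis using uu u(1) ne by auto
  qed
  show ?thesis by (rule that[OF u1(1) u2(1) u1(2) u2(2) ne prod fin])
qed

definition mat2 :: "'c \<Rightarrow> 'c \<Rightarrow> 'c \<Rightarrow> 'c \<Rightarrow> 'c^2^2" where
  "mat2 a b c d = (\<chi> i j. if i = 1 then (if j = 1 then a else b) else (if j = 1 then c else d))"

lemma mat2_mult: "(mat2 a b c d *v x) $ 1 = a * x $ 1 + b * x $ 2"
  "(mat2 a b c d *v x) $ 2 = c * x $ 1 + d * x $ 2" for a :: "'c::comm_ring_1"
  by (simp_all add: mult_vec2 mat2_def)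

lemma pair_nonzero_iff: "(x $ 1, x $ 2) \<noteq> (0, 0) \<longleftrightarrow> x \<noteq> (0 :: 'c::zero^2)"
  by (simp add: vec2_eq_iff)

lemma mem_point_of_2:
  assumes "x \<noteq> 0" "y \<noteq> 0" "x $ 1 * y $ 2 = y $ 1 * x $ 2"
  shows "y \<in> point_of (x :: 'k::field alg_closure^2)"
proof -
  obtain c where "c \<noteq> 0" "y $ 1 = c * x $ 1" "y $ 2 = c * x $ 2"
    using pair_proportional[of "x $ 1" "x $ 2" "y $ 1" "y $ 2"] assms pair_nonzero_iff by metis
  then show ?thesis by (auto simp: mem_point_of vec2_eq_iff)
qed

section \<open>Automorphisms represented by pairs of matrices\<close>

context geometric_quadric begin

definition parv :: "'k alg_closure^2 \<Rightarrow> 'k alg_closure^2 \<Rightarrow> 'k alg_closure^4" where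
  "parv u v = par (u $ 1) (u $ 2) (v $ 1) (v $ 2)"

lemma parv_in_S: "u \<noteq> 0 \<Longrightarrow> v \<noteq> 0 \<Longrightarrow> point_of (parv u v) \<in> S"
  unfolding parv_def by (intro par_in_S) (simp_all only: pair_nonzero_iff not_False_eq_True)

lemma parv_scale: "parv (c *s u) (d *s v) = (c * d) *s parv u v"
  by (simp add: parv_def par_scale)

lemma S_cases_vec:
  assumes "Q \<in> S"
  obtains u v where "u \<noteq> 0" "v \<noteq> 0" "Q = point_of (parv u v)"
proof -
  obtain x where "x \<in> Q" using assms S_subset self_mem_point_of by (auto simp: proj_space_def)
  then obtain s t a b where *: "(s, t) \<noteq> (0, 0)" "(a, b) \<noteq> (0, 0)" "Q = point_of (par s t a b)"
    by (rule S_cases[OF assms])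
  show ?thesis
    by (rule that[of "\<chi> i. if i = 1 then s else t" "\<chi> i. if i = 1 then a else b"])
      (use * in \<open>simp_all add: parv_def vec2_eq_iff\<close>)
qed

lemma parv_same_point:
  assumes "point_of (parv u v) = point_of (parv u' v')" "u \<noteq> 0" "v \<noteq> 0" "u' \<noteq> 0" "v' \<noteq> 0"
  shows "u' \<in> point_of u" "v' \<in> point_of v"
proof -
  have nz: "(u $ 1, u $ 2) \<noteq> (0, 0)" "(v $ 1, v $ 2) \<noteq> (0, 0)"
    using assms by (simp_all only: pair_nonzero_iff not_False_eq_True)
  have "u $ 1 * u' $ 2 = u' $ 1 * u $ 2" "v $ 1 * v' $ 2 = v' $ 1 * v $ 2"
    using par_same_point[OF assms(1)[unfolded parv_def] nz(1,2)] by simp_all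
  then show "u' \<in> point_of u" "v' \<in> point_of v" using assms mem_point_of_2 by blast+
qed

text \<open>A relation, because the matrices are determined only up to scalars. The nonvanishing
  conditions encode that both are invertible.\<close>

definition acts_by :: "(('k, 4) point \<Rightarrow> ('k, 4) point) \<Rightarrow> 'k alg_closure^2^2 \<Rightarrow> 'k alg_closure^2^2 \<Rightarrow> bool" where
  "acts_by \<phi> A B \<longleftrightarrow> (\<forall>u v. u \<noteq> 0 \<longrightarrow> v \<noteq> 0 \<longrightarrow> A *v u \<noteq> 0 \<and> B *v v \<noteq> 0 \<and>
     \<phi> (point_of (parv u v)) = point_of (parv (A *v u) (B *v v)))"

definition acts_swapped_by :: "(('k, 4) point \<Rightarrow> ('k, 4) point) \<Rightarrow> 'k alg_closure^2^2 \<Rightarrow> 'k alg_closure^2^2 \<Rightarrow> bool" where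
  "acts_swapped_by \<phi> A B \<longleftrightarrow> (\<forall>u v. u \<noteq> 0 \<longrightarrow> v \<noteq> 0 \<longrightarrow> A *v v \<noteq> 0 \<and> B *v u \<noteq> 0 \<and>
     \<phi> (point_of (parv u v)) = point_of (parv (A *v v) (B *v u)))"

lemma acts_byD:
  assumes "acts_by \<phi> A B" "u \<noteq> 0" "v \<noteq> 0"
  shows "A *v u \<noteq> 0" "B *v v \<noteq> 0" "\<phi> (point_of (parv u v)) = point_of (parv (A *v u) (B *v v))"
  using assms by (simp_all add: acts_by_def)

lemma acts_by_nonzero:
  assumes "acts_by \<phi> A B" "u \<noteq> 0"
  shows "A *v u \<noteq> 0" "B *v u \<noteq> 0"
  using acts_byD[OF assms assms(2)] by simp_all

lemma acts_swapped_byD: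
  assumes "acts_swapped_by \<phi> A B" "u \<noteq> 0" "v \<noteq> 0"
  shows "A *v v \<noteq> 0" "B *v u \<noteq> 0" "\<phi> (point_of (parv u v)) = point_of (parv (A *v v) (B *v u))"
  using assms by (simp_all add: acts_swapped_by_def)

text \<open>A form of bidegree \<open>(1, 0)\<close> or \<open>(0, 1)\<close> is linear in one
  factor and independent of the other, so each pair of forms amounts to a matrix.\<close>

lemma automorphism_cases:
  assumes mor: "is_morphism S S \<phi>" "is_morphism S S \<psi>" and inv: "\<And>P. P \<in> S \<Longrightarrow> \<psi> (\<phi> P) = P"
  shows "(\<exists>A B. acts_by \<phi> A B) \<or> (\<exists>A B. acts_swapped_by \<phi> A B)"
proof -
  have maps: "\<phi> P \<in> S" if "P \<in> S" for P using mor(1) that by (auto simp: is_morphism_def)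
  obtain H1 H2 K1 K2 where bi:
    "biform 1 0 H1 \<and> biform 1 0 H2 \<and> biform 0 1 K1 \<and> biform 0 1 K2 \<or>
     biform 0 1 H1 \<and> biform 0 1 H2 \<and> biform 1 0 K1 \<and> biform 1 0 K2"
    and f: "\<And>s t a b. (s, t) \<noteq> (0, 0) \<Longrightarrow> (a, b) \<noteq> (0, 0) \<Longrightarrow>
      (H1 s t a b, H2 s t a b) \<noteq> (0, 0) \<and> (K1 s t a b, K2 s t a b) \<noteq> (0, 0) \<and>
      par (H1 s t a b) (H2 s t a b) (K1 s t a b) (K2 s t a b) \<in> \<phi> (point_of (par s t a b))"
    using automorphism_global_form[OF mor inv] by metis
  have f': "\<phi> (point_of (parv u v)) = point_of (par (H1 (u$1) (u$2) (v$1) (v$2)) (H2 (u$1) (u$2) (v$1) (v$2))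
      (K1 (u$1) (u$2) (v$1) (v$2)) (K2 (u$1) (u$2) (v$1) (v$2)))"
    "(H1 (u$1) (u$2) (v$1) (v$2), H2 (u$1) (u$2) (v$1) (v$2)) \<noteq> (0, 0)"
    "(K1 (u$1) (u$2) (v$1) (v$2), K2 (u$1) (u$2) (v$1) (v$2)) \<noteq> (0, 0)"
    if u: "u \<noteq> 0" "v \<noteq> 0" for u v
  proof -
    have *: "(u $ 1, u $ 2) \<noteq> (0, 0)" "(v $ 1, v $ 2) \<noteq> (0, 0)" using u by (simp_all only: pair_nonzero_iff not_False_eq_True)
    have "\<phi> (point_of (parv u v)) \<in> S" using maps parv_in_S u by blast
    then show "\<phi> (point_of (parv u v)) = point_of (par (H1 (u$1) (u$2) (v$1) (v$2)) (H2 (u$1) (u$2) (v$1) (v$2))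
      (K1 (u$1) (u$2) (v$1) (v$2)) (K2 (u$1) (u$2) (v$1) (v$2)))"
      using f[OF *] unfolding parv_def by (intro S_eq_point_of) auto
    show "(H1 (u$1) (u$2) (v$1) (v$2), H2 (u$1) (u$2) (v$1) (v$2)) \<noteq> (0, 0)"
      "(K1 (u$1) (u$2) (v$1) (v$2), K2 (u$1) (u$2) (v$1) (v$2)) \<noteq> (0, 0)"
      using f[OF *] by blast+
  qed
  show ?thesis
    using bi
  proof (elim disjE conjE)
    assume "biform 1 0 H1" "biform 1 0 H2" "biform 0 1 K1" "biform 0 1 K2"
    note b = this
    obtain a b where "\<And>s t x y. H1 s t x y = a * s + b * t" by (rule biform_1_0[OF b(1)]) metis
    moreover obtain c d where "\<And>s t x y. H2 s t x y = c * s + d * t" by (rule biform_1_0[OF b(2)]) metis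
    moreover obtain a' b' where "\<And>s t x y. K1 s t x y = a' * x + b' * y" by (rule biform_0_1[OF b(3)]) metis
    moreover obtain c' d' where "\<And>s t x y. K2 s t x y = c' * x + d' * y" by (rule biform_0_1[OF b(4)]) metis
    ultimately have *: "H1 = (\<lambda>s t x y. a * s + b * t)" "H2 = (\<lambda>s t x y. c * s + d * t)"
      "K1 = (\<lambda>s t x y. a' * x + b' * y)" "K2 = (\<lambda>s t x y. c' * x + d' * y)"
      by (simp_all add: fun_eq_iff)
    have "acts_by \<phi> (mat2 a b c d) (mat2 a' b' c' d')"
      unfolding acts_by_def
    proof (intro allI impI)
      fix u v :: "'k alg_closure^2" assume "u \<noteq> 0" "v \<noteq> 0"
      from f'[OF this]
      show "mat2 a b c d *v u \<noteq> 0 \<and> mat2 a' b' c' d' *v v \<noteq> 0 \<and> \<phi> (point_of (parv u v)) =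
        point_of (parv (mat2 a b c d *v u) (mat2 a' b' c' d' *v v))"
        unfolding * parv_def mat2_mult pair_nonzero_iff[symmetric] by blast
    qed
    then show ?thesis by blast
  next
    assume "biform 0 1 H1" "biform 0 1 H2" "biform 1 0 K1" "biform 1 0 K2"
    note b = this
    obtain a b where "\<And>s t x y. H1 s t x y = a * x + b * y" by (rule biform_0_1[OF b(1)]) metis
    moreover obtain c d where "\<And>s t x y. H2 s t x y = c * x + d * y" by (rule biform_0_1[OF b(2)]) metis
    moreover obtain a' b' where "\<And>s t x y. K1 s t x y = a' * s + b' * t" by (rule biform_1_0[OF b(3)]) metis
    moreover obtain c' d' where "\<And>s t x y. K2 s t x y = c' * s + d' * t" by (rule biform_1_0[OF b(4)]) metis
    ultimately have *: "H1 = (\<lambda>s t x y. a * x + b * y)" "H2 = (\<lambda>s t x y. c * x + d * y)"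
      "K1 = (\<lambda>s t x y. a' * s + b' * t)" "K2 = (\<lambda>s t x y. c' * s + d' * t)"
      by (simp_all add: fun_eq_iff)
    have "acts_swapped_by \<phi> (mat2 a b c d) (mat2 a' b' c' d')"
      unfolding acts_swapped_by_def
    proof (intro allI impI)
      fix u v :: "'k alg_closure^2" assume "u \<noteq> 0" "v \<noteq> 0"
      from f'[OF this]
      show "mat2 a b c d *v v \<noteq> 0 \<and> mat2 a' b' c' d' *v u \<noteq> 0 \<and> \<phi> (point_of (parv u v)) =
        point_of (parv (mat2 a b c d *v v) (mat2 a' b' c' d' *v u))"
        unfolding * parv_def mat2_mult pair_nonzero_iff[symmetric] by blast
    qed
    then show ?thesis by blast
  qed
qed

lemma acts_by_compose:
  assumes "acts_by \<phi> A B" "acts_by \<psi> A' B'"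
  shows "acts_by (compose S \<phi> \<psi>) (A ** A') (B ** B')"
  unfolding acts_by_def
proof (intro allI impI)
  fix u v :: "'k alg_closure^2" assume uv: "u \<noteq> 0" "v \<noteq> 0"
  note 1 = acts_byD[OF assms(2) uv]
  note 2 = acts_byD[OF assms(1) 1(1,2)]
  show "(A ** A') *v u \<noteq> 0 \<and> (B ** B') *v v \<noteq> 0 \<and>
      compose S \<phi> \<psi> (point_of (parv u v)) = point_of (parv ((A ** A') *v u) ((B ** B') *v v))"
    using 1 2 parv_in_S[OF uv] by (simp add: compose_eq flip: matrix_vector_mul_assoc)
qed

text \<open>Two exchanges of the rulings cancel, so the elements that preserve the rulings form a
  subgroup of index at most 2.\<close>

lemma acts_swapped_compose:
  assumes "acts_swapped_by \<phi> A B" "acts_swapped_by \<psi> A' B'"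
  shows "acts_by (compose S \<phi> \<psi>) (A ** B') (B ** A')"
  unfolding acts_by_def
proof (intro allI impI)
  fix u v :: "'k alg_closure^2" assume uv: "u \<noteq> 0" "v \<noteq> 0"
  note 1 = acts_swapped_byD[OF assms(2) uv]
  note 2 = acts_swapped_byD[OF assms(1) 1(1,2)]
  show "(A ** B') *v u \<noteq> 0 \<and> (B ** A') *v v \<noteq> 0 \<and>
      compose S \<phi> \<psi> (point_of (parv u v)) = point_of (parv ((A ** B') *v u) ((B ** A') *v v))"
    using 1 2 parv_in_S[OF uv] by (simp add: compose_eq flip: matrix_vector_mul_assoc)
qed

lemma acts_by_id: "acts_by (\<lambda>P\<in>S. P) (mat 1) (mat 1)"
  by (simp add: acts_by_def parv_in_S)

lemma acts_by_inverse:
  assumes "acts_by \<phi> A B" and inv: "\<And>P. P \<in> S \<Longrightarrow> \<psi> (\<phi> P) = P"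
  obtains A' B' where "acts_by \<psi> A' B'" "A ** A' = mat 1" "A' ** A = mat 1"
proof -
  have "\<exists>A'. A' ** A = mat 1" "\<exists>B'. B' ** B = mat 1"
    using acts_by_nonzero[OF assms(1)] unfolding matrix_left_invertible_ker by blast+
  then obtain A' B' where A: "A' ** A = mat 1" "A ** A' = mat 1" "B' ** B = mat 1" "B ** B' = mat 1"
    using matrix_left_right_inverse by metis
  have "acts_by \<psi> A' B'"
    unfolding acts_by_def
  proof (intro allI impI)
    fix u v :: "'k alg_closure^2" assume uv: "u \<noteq> 0" "v \<noteq> 0"
    have AA: "A *v (A' *v u) = u" "B *v (B' *v v) = v" by (simp_all add: matrix_vector_mul_assoc A)
    then have nz: "A' *v u \<noteq> 0" "B' *v v \<noteq> 0" using uv by auto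
    then show "A' *v u \<noteq> 0 \<and> B' *v v \<noteq> 0 \<and> \<psi> (point_of (parv u v)) = point_of (parv (A' *v u) (B' *v v))"
      using acts_byD(3)[OF assms(1) nz] inv[OF parv_in_S[OF nz]] unfolding AA by simp
  qed
  then show ?thesis using that A by blast
qed

text \<open>The induced map on first factors, expressed by points of the surface alone. No
  representing matrix has to be chosen, and \<open>act_eq\<close> shows that any such matrix
  computes it.\<close>

definition act :: "(('k, 4) point \<Rightarrow> ('k, 4) point) \<Rightarrow> ('k, 2) point \<Rightarrow> ('k, 2) point" where
  "act \<phi> P = {u'. u' \<noteq> 0 \<and> (\<exists>u\<in>P. \<exists>v v'. v \<noteq> 0 \<and> v' \<noteq> 0 \<and> parv u' v' \<in> \<phi> (point_of (parv u v)))}"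

lemma act_eq:
  assumes ab: "acts_by \<phi> A B" and u: "u \<noteq> 0"
  shows "act \<phi> (point_of u) = point_of (A *v u)"
proof (intro Set.set_eqI iffI)
  fix w assume "w \<in> act \<phi> (point_of u)"
  then obtain x v v' where *: "w \<noteq> 0" "x \<in> point_of u" "v \<noteq> 0" "v' \<noteq> 0" "parv w v' \<in> \<phi> (point_of (parv x v))"
    by (auto simp: act_def)
  then obtain c where c: "c \<noteq> 0" "x = c *s u" by (auto simp: mem_point_of)
  then have x: "x \<noteq> 0" using u by auto
  have "point_of (parv (A *v x) (B *v v)) = point_of (parv w v')"
    using *(5) acts_byD(3)[OF ab x *(3)] point_of_eq by metis
  then have "w \<in> point_of (A *v x)"
    using parv_same_point(1) acts_byD[OF ab x *(3)] * by blast
  then show "w \<in> point_of (A *v u)" using c by (simp add: vector_scalar_commute point_of_smult)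
next
  fix w assume "w \<in> point_of (A *v u)"
  then obtain c where c: "c \<noteq> 0" "w = c *s (A *v u)" by (auto simp: mem_point_of)
  \<comment> \<open>An arbitrary nonzero second factor: under \<open>acts_by\<close> the first
    factor of the image does not depend on it.\<close>
  define v :: "'k alg_closure^2" where "v = (\<chi> i. 1)"
  have v: "v \<noteq> 0" by (simp add: v_def vec2_eq_iff)
  note D = acts_byD[OF ab u v]
  have "parv w (B *v v) = c *s parv (A *v u) (B *v v)" using parv_scale[of c "A *v u" 1 "B *v v"] c by simp
  then have "parv w (B *v v) \<in> \<phi> (point_of (parv u v))" using D c point_of_closed self_mem_point_of by metis
  moreover have "w \<noteq> 0" using c D by simp
  ultimately show "w \<in> act \<phi> (point_of u)"
    using v D(2) self_mem_point_of unfolding act_def by blast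
qed

end

section \<open>Finite groups of automorphisms\<close>

definition kvec :: "'k::field alg_closure^'i \<Rightarrow> bool" where
  "kvec x \<longleftrightarrow> (\<forall>i. x $ i \<in> range to_ac)"

lemma kvec_mpoly_eval:
  assumes "kvec x"
  shows "mpoly_eval f x \<in> range to_ac"
proof -
  obtain k where k: "\<And>i. x $ i = to_ac (k i)" using assms unfolding kvec_def image_iff by metis
  have "mpoly_eval f x = to_ac (\<Sum>m\<in>Poly_Mapping.keys f.
     Poly_Mapping.lookup f m * (\<Prod>i\<in>UNIV. k i ^ Poly_Mapping.lookup m i))"
    by (simp add: mpoly_eval_def k to_ac_sum to_ac_prod)
  then show ?thesis by blast
qed

text \<open>Morphisms are locally given by forms over \<open>K\<close>, and such forms take values
  in \<open>K\<close> at vectors over \<open>K\<close>.\<close>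

lemma morphism_kvec:
  assumes "is_morphism V W \<phi>" "P \<in> V" "x \<in> P" "kvec x"
  obtains y where "y \<in> \<phi> P" "kvec y"
proof -
  obtain U F where "P \<in> U" "\<forall>Q\<in>V \<inter> U. \<forall>x\<in>Q. (\<chi> j. mpoly_eval (F j) x) \<in> \<phi> Q"
    using assms(1,2) unfolding is_morphism_def by blast
  then have "(\<chi> j. mpoly_eval (F j) x) \<in> \<phi> P" using assms by blast
  moreover have "kvec (\<chi> j. mpoly_eval (F j) x)"
    using kvec_mpoly_eval[OF assms(4)] by (simp add: kvec_def)
  ultimately show ?thesis by (rule that)
qed

text \<open>The two rulings are conjugate over \<open>K(\<delta>)\<close>, where \<open>\<delta>\<^sup>2 \<in> K\<close>: the coordinates \<open>y\<^sub>3\<close> and \<open>y\<^sub>4\<close> of a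
  \<open>K\<close>-rational point are conjugate.\<close>

locale arithmetic_quadric = geometric_quadric N N' S for N N' :: "'k::field_char_0 alg_closure^4^4" and S +
  fixes \<delta> :: "'k alg_closure"
  assumes \<delta>: "\<delta> \<notin> range to_ac"
    and kvec_iff: "\<And>y. kvec (N *v y) \<longleftrightarrow> (\<exists>k1 k2 z w. y $ 1 = to_ac k1 \<and> y $ 2 = to_ac k2 \<and>
      y $ 3 = to_ac z + \<delta> * to_ac w \<and> y $ 4 = to_ac z - \<delta> * to_ac w)"
begin

lemma \<delta>_indep:
  assumes "to_ac a + \<delta> * to_ac b = 0" shows "a = 0 \<and> b = 0"
proof -
  have "b = 0"
  proof (rule ccontr)
    assume "b \<noteq> 0"
    then have "\<delta> = to_ac (- a / b)" using assms by (simp add: field_simps add_eq_0_iff2)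
    then show False using \<delta> by blast
  qed
  then show ?thesis using assms by simp
qed

text \<open>\<open>A\<close> only rescales \<open>u\<close>, so the image point has the factors
  \<open>u\<close> and \<open>B *v v\<close>. It is rational again, hence some multiple of its
  coordinates satisfies the conjugacy condition \<open>kvec_iff\<close>.\<close>

lemma kvec_image:
  assumes mor: "is_morphism S S \<phi>" and ab: "acts_by \<phi> A B"
    and triv: "\<And>u. u \<noteq> 0 \<Longrightarrow> A *v u \<in> point_of u"
    and uv: "u \<noteq> 0" "v \<noteq> 0" and k: "kvec (parv u v)"
  obtains c k1 k2 z w where "c \<noteq> 0" "c * (u $ 1 * (B *v v) $ 1) = to_ac k1" "c * (u $ 2 * (B *v v) $ 2) = to_ac k2"
    "c * (u $ 1 * (B *v v) $ 2) = to_ac z + \<delta> * to_ac w" "c * (u $ 2 * (B *v v) $ 1) = to_ac z - \<delta> * to_ac w"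
proof -
  obtain d where d: "d \<noteq> 0" "A *v u = d *s u" using triv[OF uv(1)] by (auto simp: mem_point_of)
  obtain x where x: "x \<in> \<phi> (point_of (parv u v))" "kvec x"
    by (rule morphism_kvec[OF mor parv_in_S[OF uv] self_mem_point_of k])
  have "\<phi> (point_of (parv u v)) = point_of (parv (d *s u) (1 *s (B *v v)))"
    using acts_byD(3)[OF ab uv] d by simp
  also have "\<dots> = point_of (parv u (B *v v))" unfolding parv_scale using d by (simp add: point_of_smult)
  finally obtain c where c: "c \<noteq> 0" "x = c *s parv u (B *v v)" using x by (auto simp: mem_point_of)
  have "x = N *v (c *s quad_vec (u $ 1) (u $ 2) ((B *v v) $ 1) ((B *v v) $ 2))"
    by (simp add: c parv_def par_def vector_scalar_commute)
  then have "kvec (N *v (c *s quad_vec (u $ 1) (u $ 2) ((B *v v) $ 1) ((B *v v) $ 2)))" using x by simp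
  then show ?thesis unfolding kvec_iff using that[OF c(1)] by auto
qed

text \<open>The only step that uses the base field: conjugation interchanges the rulings.\<close>

lemma ruling_faithful:
  assumes mor: "is_morphism S S \<phi>" and ab: "acts_by \<phi> A B"
    and triv: "\<And>u. u \<noteq> 0 \<Longrightarrow> A *v u \<in> point_of u" and P: "P \<in> S"
  shows "\<phi> P = P"
proof -
  \<comment> \<open>Vectors over \<open>K\<close> with equal factors \<open>u = v\<close> give
    rational points. Three of them are taken, because a projective transformation of a line is
    determined by three points.\<close>
  define e1 :: "'k alg_closure^2" where "e1 = (\<chi> i. if i = 1 then 1 else 0)"
  define e2 :: "'k alg_closure^2" where "e2 = (\<chi> i. if i = 1 then 0 else 1)"
  define e3 :: "'k alg_closure^2" where "e3 = (\<chi> i. 1)"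
  have e: "e1 $ 1 = 1" "e1 $ 2 = 0" "e2 $ 1 = 0" "e2 $ 2 = 1" "e3 $ 1 = 1" "e3 $ 2 = 1"
    by (simp_all add: e1_def e2_def e3_def)
  have nz: "e1 \<noteq> 0" "e2 \<noteq> 0" "e3 \<noteq> 0" by (simp_all add: vec2_eq_iff e)
  have k: "kvec (parv e1 e1)" "kvec (parv e2 e2)" "kvec (parv e3 e3)"
  proof -
    show "kvec (parv e1 e1)" unfolding parv_def par_def kvec_iff
      by (rule exI[of _ 1], rule exI[of _ 0], rule exI[of _ 0], rule exI[of _ 0]) (simp add: e)
    show "kvec (parv e2 e2)" unfolding parv_def par_def kvec_iff
      by (rule exI[of _ 0], rule exI[of _ 1], rule exI[of _ 0], rule exI[of _ 0]) (simp add: e)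
    show "kvec (parv e3 e3)" unfolding parv_def par_def kvec_iff
      by (rule exI[of _ 1], rule exI[of _ 1], rule exI[of _ 1], rule exI[of _ 0]) (simp add: e)
  qed
  note im = kvec_image[OF mor ab triv]
  \<comment> \<open>The fourth coordinate of the image is 0, so its components \<open>z\<close> and
    \<open>w\<close> vanish. The third coordinate, its conjugate, is then 0 as well, and it is a
    multiple of this entry.\<close>
  have B21: "B $ 2 $ 1 = 0"
  proof -
    obtain c z w where "c \<noteq> 0" "c * (e1 $ 1 * (B *v e1) $ 2) = to_ac z + \<delta> * to_ac w"
      "c * (e1 $ 2 * (B *v e1) $ 1) = to_ac z - \<delta> * to_ac w"
      by (rule im[OF _ nz(1) nz(1) k(1)])
    then show ?thesis using \<delta>_indep[of z "- w"] by (simp add: e mult_vec2)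
  qed
  have B12: "B $ 1 $ 2 = 0"
  proof -
    obtain c z w where "c \<noteq> 0" "c * (e2 $ 1 * (B *v e2) $ 2) = to_ac z + \<delta> * to_ac w"
      "c * (e2 $ 2 * (B *v e2) $ 1) = to_ac z - \<delta> * to_ac w"
      by (rule im[OF _ nz(2) nz(2) k(2)])
    then show ?thesis using \<delta>_indep[of z w] by (simp add: e mult_vec2)
  qed
  \<comment> \<open>The second and third coordinates of the image coincide. The second lies in
    \<open>K\<close>, so \<open>w = 0\<close>, and the conjugate fourth coordinate has the same
    value; it involves the other diagonal entry.\<close>
  have diag: "B $ 1 $ 1 = B $ 2 $ 2"
  proof -
    obtain c k1 k2 z w where c: "c \<noteq> 0" "c * (e3 $ 1 * (B *v e3) $ 1) = to_ac k1"
      "c * (e3 $ 2 * (B *v e3) $ 2) = to_ac k2"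
      "c * (e3 $ 1 * (B *v e3) $ 2) = to_ac z + \<delta> * to_ac w" "c * (e3 $ 2 * (B *v e3) $ 1) = to_ac z - \<delta> * to_ac w"
      by (rule im[OF _ nz(3) nz(3) k(3)])
    then have "to_ac (z - k2) + \<delta> * to_ac w = 0" by (simp add: e mult_vec2 B12 B21)
    then have "w = 0" using \<delta>_indep by blast
    then show ?thesis using c by (simp add: e mult_vec2 B12 B21) (metis mult_left_cancel)
  qed
  obtain u v where uv: "u \<noteq> 0" "v \<noteq> 0" "P = point_of (parv u v)" using S_cases_vec[OF P] .
  obtain d where d: "d \<noteq> 0" "A *v u = d *s u" using triv[OF uv(1)] by (auto simp: mem_point_of)
  have Bv: "B *v v = (B $ 1 $ 1) *s v" by (simp add: vec2_eq_iff mult_vec2 B12 B21 diag)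
  then have b: "B $ 1 $ 1 \<noteq> 0" using acts_by_nonzero(2)[OF ab uv(2)] by auto
  have "\<phi> P = point_of (parv (d *s u) ((B $ 1 $ 1) *s v))"
    using acts_byD(3)[OF ab uv(1,2)] uv(3) d Bv by simp
  also have "\<dots> = P" unfolding parv_scale using d b uv by (simp add: point_of_smult)
  finally show ?thesis .
qed

end

section \<open>The finite group acting on one projective line\<close>

locale finite_automorphisms = arithmetic_quadric N N' S \<delta>
  for N N' :: "'k::field_char_0 alg_closure^4^4" and S \<delta> +
  fixes H :: "(('k, 4) point \<Rightarrow> ('k, 4) point) set"
  assumes H: "subgroup H (BijGroup S)" "finite H"
    and mor: "\<And>\<phi>. \<phi> \<in> H \<Longrightarrow> is_morphism S S \<phi> \<and> is_morphism S S (inv_into S \<phi>)"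
begin

definition G where "G = (BijGroup S)\<lparr>carrier := H\<rparr>"

sublocale G: Group.group G
  unfolding G_def using H(1) group_BijGroup by (rule subgroup.subgroup_is_group)

lemma carrier_G [simp]: "carrier G = H"
  by (simp add: G_def)

lemma H_closed [simp]: "\<phi> \<in> H \<Longrightarrow> \<psi> \<in> H \<Longrightarrow> \<phi> \<otimes>\<^bsub>G\<^esub> \<psi> \<in> H" "\<phi> \<in> H \<Longrightarrow> inv\<^bsub>G\<^esub> \<phi> \<in> H"
  using G.m_closed[of \<phi> \<psi>] G.inv_closed[of \<phi>] by simp_all

lemma H_Bij: "\<phi> \<in> H \<Longrightarrow> \<phi> \<in> Bij S"
  using subgroup.subset[OF H(1)] by (auto simp: BijGroup_def)

lemma mult_G: "\<phi> \<in> H \<Longrightarrow> \<psi> \<in> H \<Longrightarrow> \<phi> \<otimes>\<^bsub>G\<^esub> \<psi> = compose S \<phi> \<psi>"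
  using H_Bij by (simp add: G_def BijGroup_def)

lemma one_G: "\<one>\<^bsub>G\<^esub> = (\<lambda>P\<in>S. P)"
  by (simp add: G_def BijGroup_def)

definition G0 where "G0 = {\<phi> \<in> H. \<exists>A B. acts_by \<phi> A B}"

lemma G0_H: "G0 \<subseteq> H" by (auto simp: G0_def)

lemma inv_cancel: "\<phi> \<in> H \<Longrightarrow> P \<in> S \<Longrightarrow> (inv\<^bsub>G\<^esub> \<phi>) (\<phi> P) = P"
  using G.l_inv[of \<phi>] mult_G[of "inv\<^bsub>G\<^esub> \<phi>" \<phi>] G.inv_closed[of \<phi>] unfolding one_G
  by (metis carrier_G compose_eq restrict_apply')

lemma G0_one: "\<one>\<^bsub>G\<^esub> \<in> G0"
  using acts_by_id G.one_closed by (auto simp: G0_def one_G)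

lemma acts_by_mult: "\<phi> \<in> H \<Longrightarrow> \<psi> \<in> H \<Longrightarrow> acts_by \<phi> A B \<Longrightarrow> acts_by \<psi> A' B' \<Longrightarrow>
    acts_by (\<phi> \<otimes>\<^bsub>G\<^esub> \<psi>) (A ** A') (B ** B')"
  by (simp add: mult_G acts_by_compose)

lemma acts_by_inv:
  assumes "\<phi> \<in> H" "acts_by \<phi> A B"
  obtains A' B' where "acts_by (inv\<^bsub>G\<^esub> \<phi>) A' B'" "A ** A' = mat 1" "A' ** A = mat 1"
  using acts_by_inverse[OF assms(2), of "inv\<^bsub>G\<^esub> \<phi>"] inv_cancel[OF assms(1)] by metis

lemma G0_subgroup: "subgroup G0 G"
proof (rule G.subgroupI)
  show "G0 \<subseteq> carrier G" using G0_H by simp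
  show "G0 \<noteq> {}" using G0_one by blast
  show "inv\<^bsub>G\<^esub> \<phi> \<in> G0" if mem: "\<phi> \<in> G0" for \<phi>
  proof -
    obtain A B where *: "\<phi> \<in> H" "acts_by \<phi> A B" using mem by (auto simp: G0_def)
    obtain A' B' where "acts_by (inv\<^bsub>G\<^esub> \<phi>) A' B'" using acts_by_inv[OF *] .
    then show ?thesis using G.inv_closed[of \<phi>] * by (auto simp: G0_def)
  qed
  show "\<phi> \<otimes>\<^bsub>G\<^esub> \<psi> \<in> G0" if "\<phi> \<in> G0" "\<psi> \<in> G0" for \<phi> \<psi>
    using that acts_by_mult G.m_closed unfolding G0_def by fastforce
qed

lemma G0_index:
  assumes "\<phi> \<in> H - G0" "\<psi> \<in> H - G0"
  shows "\<phi> \<otimes>\<^bsub>G\<^esub> \<psi> \<in> G0"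
proof -
  have sw: "\<exists>A B. acts_swapped_by \<phi> A B" if "\<phi> \<in> H - G0" for \<phi>
  proof -
    have "inj_on \<phi> S" using that H_Bij[of \<phi>] by (auto simp: Bij_def bij_betw_def)
    then show ?thesis
      using automorphism_cases[of \<phi> "inv_into S \<phi>"] mor[of \<phi>] that by (auto simp: G0_def)
  qed
  obtain A B A' B' where "acts_swapped_by \<phi> A B" "acts_swapped_by \<psi> A' B'"
    using sw[OF assms(1)] sw[OF assms(2)] by blast
  from acts_swapped_compose[OF this] show ?thesis
    using assms G.m_closed[of \<phi> \<psi>] by (auto simp: G0_def mult_G)
qed

lemma acts_by_pow:
  assumes "\<phi> \<in> H" "acts_by \<phi> A B"
  shows "\<exists>M B'. acts_by (\<phi> [^]\<^bsub>G\<^esub> (n::nat)) M B' \<and> (\<forall>u. M *v u = (((*v) A) ^^ n) u)"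
proof (induction n)
  case 0
  have "acts_by (\<phi> [^]\<^bsub>G\<^esub> (0::nat)) (mat 1) (mat 1)"
    unfolding G.nat_pow_0 one_G by (rule acts_by_id)
  then show ?case by (intro exI[of _ "mat 1"]) simp
next
  case (Suc n)
  then obtain M B' where M: "acts_by (\<phi> [^]\<^bsub>G\<^esub> n) M B'" "\<And>u. M *v u = (((*v) A) ^^ n) u" by blast
  have "acts_by (\<phi> [^]\<^bsub>G\<^esub> Suc n) (M ** A) (B' ** B)"
    using acts_by_mult[OF _ assms(1) M(1) assms(2)] G.nat_pow_closed[of \<phi> n] assms by simp
  moreover have "(M ** A) *v u = (((*v) A) ^^ Suc n) u" for u
    by (simp add: M(2) funpow_swap1 flip: matrix_vector_mul_assoc)
  ultimately show ?case by blast
qed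

text \<open>If every vector were an eigenvector of \<open>A\<close>, then \<open>\<phi>\<close>
  would be trivial by \<open>ruling_faithful\<close>. The power of \<open>A\<close> given by the
  group order represents the identity, so it is scalar on every vector. These are the hypotheses of
  \<open>two_eigenlines\<close>.\<close>

lemma nontrivial_eigenlines:
  assumes \<phi>: "\<phi> \<in> H" "acts_by \<phi> A B" "\<phi> \<noteq> \<one>\<^bsub>G\<^esub>"
  obtains u1 u2 l1 l2 where "u1 \<noteq> 0" "u2 \<noteq> 0" "A *v u1 = l1 *s u1" "A *v u2 = l2 *s u2"
    "l1 \<noteq> l2" "l1 * l2 = det A"
    "\<forall>u c. u \<noteq> 0 \<longrightarrow> A *v u = c *s u \<longrightarrow> (\<exists>d. u = d *s u1) \<and> c = l1 \<or> (\<exists>d. u = d *s u2) \<and> c = l2"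
proof -
  have "\<exists>w. \<forall>c. A *v w \<noteq> c *s w"
  proof (rule ccontr)
    assume "\<not> (\<exists>w. \<forall>c. A *v w \<noteq> c *s w)"
    then have sc: "\<exists>c. A *v w = c *s w" for w by blast
    have "A *v u \<in> point_of u" if u: "u \<noteq> 0" for u
    proof -
      obtain c where c: "A *v u = c *s u" using sc by blast
      moreover have "c \<noteq> 0" using c acts_by_nonzero(1)[OF \<phi>(2) u] by auto
      ultimately show ?thesis by (auto simp: mem_point_of)
    qed
    then have "\<phi> P = P" if "P \<in> S" for P
      using ruling_faithful[OF _ \<phi>(2)] mor[OF \<phi>(1)] that by blast
    then have "\<phi> = (\<lambda>P\<in>S. P)"
      using H_Bij[OF \<phi>(1)] by (intro extensionalityI[of _ S]) (auto simp: Bij_def)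
    then show False using \<phi>(3) by (simp add: one_G)
  qed
  then obtain w where w: "\<And>c. A *v w \<noteq> c *s w" by blast
  define n where "n = Coset.order G"
  have n: "n > 0" using H(2) G.one_closed by (auto simp: n_def Coset.order_def card_gt_0_iff)
  obtain M B' where M: "acts_by (\<phi> [^]\<^bsub>G\<^esub> n) M B'" "\<And>u. M *v u = (((*v) A) ^^ n) u"
    using acts_by_pow[OF \<phi>(1,2)] by blast
  have "\<phi> [^]\<^bsub>G\<^esub> n = \<one>\<^bsub>G\<^esub>" using G.pow_order_eq_1[of \<phi>] \<phi>(1) by (simp add: n_def)
  then have M1: "acts_by (\<lambda>P\<in>S. P) M B'" using M(1) by (simp add: one_G)
  have per: "\<exists>c. (((*v) A) ^^ n) u = c *s u" for u
  proof (cases "u = 0")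
    case True
    then show ?thesis using M(2)[of 0] by auto
  next
    case False
    note D = acts_byD[OF M1 False False]
    have "M *v u \<in> point_of u"
      using parv_same_point(1)[OF _ False False D(1,2)] D(3) parv_in_S[OF False False] by simp
    then show ?thesis using M(2) by (auto simp: mem_point_of)
  qed
  show ?thesis
  proof (rule two_eigenlines[of A n w])
    show "A *v u \<noteq> 0" if "u \<noteq> 0" for u using acts_by_nonzero(1)[OF \<phi>(2) that] .
    show "n > 0" by (rule n)
    show "\<exists>c. (((*v) A) ^^ n) u = c *s u" for u by (rule per)
    show "A *v w \<noteq> c *s w" for c by (rule w)
    fix u1 u2 l1 l2
    assume u: "u1 \<noteq> 0" "u2 \<noteq> 0" "A *v u1 = l1 *s u1" "A *v u2 = l2 *s u2" "l1 \<noteq> l2" "l1 * l2 = det A"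
      and eig: "\<And>u c. u \<noteq> 0 \<Longrightarrow> A *v u = c *s u \<Longrightarrow> (\<exists>d. u = d *s u1) \<and> c = l1 \<or> (\<exists>d. u = d *s u2) \<and> c = l2"
    show ?thesis by (rule that[OF u]) (intro allI impI eig)
  qed
qed

lemma card_fixed_points:
  assumes "\<phi> \<in> G0" "\<phi> \<noteq> \<one>\<^bsub>G\<^esub>"
  shows "card {P \<in> proj_space. act \<phi> P = P} = 2"
proof -
  obtain A B where \<phi>: "\<phi> \<in> H" "acts_by \<phi> A B" using assms by (auto simp: G0_def)
  obtain u1 u2 l1 l2 where u: "u1 \<noteq> 0" "u2 \<noteq> 0" "A *v u1 = l1 *s u1" "A *v u2 = l2 *s u2" "l1 \<noteq> l2"
    and eig: "\<forall>u c. u \<noteq> 0 \<longrightarrow> A *v u = c *s u \<longrightarrow> (\<exists>d. u = d *s u1) \<and> c = l1 \<or> (\<exists>d. u = d *s u2) \<and> c = l2"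
    by (rule nontrivial_eigenlines[OF \<phi> assms(2)])
  have l: "l1 \<noteq> 0" "l2 \<noteq> 0" using acts_by_nonzero(1)[OF \<phi>(2)] u by fastforce+
  have "{P \<in> proj_space. act \<phi> P = P} = {point_of u1, point_of u2}"
  proof
    show "{point_of u1, point_of u2} \<subseteq> {P \<in> proj_space. act \<phi> P = P}"
      using u l act_eq[OF \<phi>(2)] by (auto simp: point_of_in_proj_space point_of_smult)
    show "{P \<in> proj_space. act \<phi> P = P} \<subseteq> {point_of u1, point_of u2}"
    proof
      fix P assume "P \<in> {P \<in> proj_space. act \<phi> P = P}"
      then have P: "P \<in> proj_space" "act \<phi> P = P" by auto
      then obtain u where uP: "u \<noteq> 0" "P = point_of u" by (auto simp: proj_space_def)
      then have "A *v u \<in> point_of u" using P(2) act_eq[OF \<phi>(2) uP(1)] self_mem_point_of by metis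
      then obtain c where "A *v u = c *s u" by (auto simp: mem_point_of)
      then have "(\<exists>d. u = d *s u1) \<or> (\<exists>d. u = d *s u2)" using eig uP(1) by blast
      then show "P \<in> {point_of u1, point_of u2}" using uP by (auto simp: point_of_smult)
    qed
  qed
  moreover have "point_of u1 \<noteq> point_of u2"
  proof
    assume "point_of u1 = point_of u2"
    then obtain c where "u1 = c *s u2" using self_mem_point_of mem_point_of by metis
    then have "A *v u1 = l2 *s u1" using u(4) by (simp add: vector_scalar_commute vector_smult_assoc mult.commute)
    then show False using u by auto
  qed
  ultimately show ?thesis by simp
qed

text \<open>In the commutator matrix the scalars by which \<open>u\<close> is multiplied cancel, so
  1 is an eigenvalue; the determinant is 1, so the other eigenvalue is 1 too. A nontrivial element
  has distinct eigenvalues, hence the commutator is trivial.\<close>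

lemma stabilizer_commute:
  assumes P: "P \<in> proj_space" and g: "g \<in> G0" "h \<in> G0" "act g P = P" "act h P = P"
  shows "g \<otimes>\<^bsub>G\<^esub> h = h \<otimes>\<^bsub>G\<^esub> g"
proof -
  obtain u where u: "u \<noteq> 0" "P = point_of u" using P by (auto simp: proj_space_def)
  obtain A B A' B' where gh: "g \<in> H" "h \<in> H" "acts_by g A B" "acts_by h A' B'"
    using g by (auto simp: G0_def)
  obtain C D where C: "acts_by (inv\<^bsub>G\<^esub> g) C D" "A ** C = mat 1" "C ** A = mat 1"
    using acts_by_inv[OF gh(1,3)] .
  obtain C' D' where C': "acts_by (inv\<^bsub>G\<^esub> h) C' D'" "A' ** C' = mat 1" "C' ** A' = mat 1"
    using acts_by_inv[OF gh(2,4)] .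
  have gh': "g \<in> carrier G" "h \<in> carrier G" "inv\<^bsub>G\<^esub> g \<in> H" "inv\<^bsub>G\<^esub> h \<in> H"
    using gh G.inv_closed by auto
  define k where "k = g \<otimes>\<^bsub>G\<^esub> h \<otimes>\<^bsub>G\<^esub> inv\<^bsub>G\<^esub> g \<otimes>\<^bsub>G\<^esub> inv\<^bsub>G\<^esub> h"
  define M where "M = A ** A' ** C ** C'"
  have "k \<in> carrier G" using gh' by (simp add: k_def)
  then have kH: "k \<in> H" by simp
  have "\<exists>E. acts_by k M E"
  proof -
    have "g \<otimes>\<^bsub>G\<^esub> h \<in> H" "g \<otimes>\<^bsub>G\<^esub> h \<otimes>\<^bsub>G\<^esub> inv\<^bsub>G\<^esub> g \<in> H"
      using gh by simp_all
    then show ?thesis unfolding k_def M_def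
      using acts_by_mult[OF _ gh'(4) acts_by_mult[OF _ gh'(3) acts_by_mult[OF gh(1,2) gh(3,4)] C(1)] C'(1)] by blast
  qed
  then obtain E where E: "acts_by k M E" by blast
  have "k = \<one>\<^bsub>G\<^esub>"
  proof (rule ccontr)
    assume "k \<noteq> \<one>\<^bsub>G\<^esub>"
    then obtain u1 u2 l1 l2 where l: "l1 \<noteq> l2" "l1 * l2 = det M"
      and eig: "\<forall>u c. u \<noteq> 0 \<longrightarrow> M *v u = c *s u \<longrightarrow> (\<exists>d. u = d *s u1) \<and> c = l1 \<or> (\<exists>d. u = d *s u2) \<and> c = l2"
      by (rule nontrivial_eigenlines[OF kH E])
    have "det A * det C = 1" "det A' * det C' = 1"
      using arg_cong[OF C(2), of det] arg_cong[OF C'(2), of det] by (simp_all add: det_mul)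
    moreover have "det M = (det A * det C) * (det A' * det C')" by (simp add: M_def det_mul mult_ac)
    ultimately have det: "det M = 1" by simp
    have ev: "\<exists>c. c \<noteq> 0 \<and> Z *v u = c *s u" if "acts_by f Z Y" "act f P = P" for f Z Y
    proof -
      have "Z *v u \<in> point_of u" using that u act_eq[OF that(1) u(1)] self_mem_point_of by metis
      then show ?thesis by (auto simp: mem_point_of)
    qed
    obtain c where c: "c \<noteq> 0" "A *v u = c *s u" using ev gh g by blast
    obtain c' where c': "c' \<noteq> 0" "A' *v u = c' *s u" using ev gh g by blast
    have Cu: "C *v u = (1 / c) *s u"
    proof -
      have "c *s (C *v u) = u" using c C(3) by (metis matrix_vector_mul_assoc matrix_vector_mul_lid vector_scalar_commute)
      then have "(1 / c) *s (c *s (C *v u)) = (1 / c) *s u" by simp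
      then show ?thesis using c by (simp add: vector_smult_assoc)
    qed
    have Cu': "C' *v u = (1 / c') *s u"
    proof -
      have "c' *s (C' *v u) = u" using c' C'(3) by (metis matrix_vector_mul_assoc matrix_vector_mul_lid vector_scalar_commute)
      then have "(1 / c') *s (c' *s (C' *v u)) = (1 / c') *s u" by simp
      then show ?thesis using c' by (simp add: vector_smult_assoc)
    qed
    have "M *v u = 1 *s u"
      using c c' by (simp add: M_def Cu Cu' vector_scalar_commute vector_smult_assoc flip: matrix_vector_mul_assoc)
    then have "1 = l1 \<or> 1 = l2" using eig u(1) by blast
    then show False using l det by auto
  qed
  then have "g \<otimes>\<^bsub>G\<^esub> h \<otimes>\<^bsub>G\<^esub> inv\<^bsub>G\<^esub> g \<otimes>\<^bsub>G\<^esub> inv\<^bsub>G\<^esub> h \<otimes>\<^bsub>G\<^esub> (h \<otimes>\<^bsub>G\<^esub> g) = h \<otimes>\<^bsub>G\<^esub> g"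
    using gh' by (simp add: k_def)
  moreover have "g \<otimes>\<^bsub>G\<^esub> h \<otimes>\<^bsub>G\<^esub> inv\<^bsub>G\<^esub> g \<otimes>\<^bsub>G\<^esub> inv\<^bsub>G\<^esub> h \<otimes>\<^bsub>G\<^esub> (h \<otimes>\<^bsub>G\<^esub> g) = g \<otimes>\<^bsub>G\<^esub> h"
  proof -
    have "inv\<^bsub>G\<^esub> h \<otimes>\<^bsub>G\<^esub> (h \<otimes>\<^bsub>G\<^esub> g) = g" using gh' by (simp flip: G.m_assoc)
    then show ?thesis using gh' by (simp add: G.m_assoc)
  qed
  ultimately show ?thesis by simp
qed

lemma finite_jordan_constant_le_120: "finite_jordan_constant ((BijGroup S)\<lparr>carrier := H\<rparr>) \<le> 120"
proof -
  have actG: "\<exists>A B. acts_by g A B" "g \<in> H" if "g \<in> G0" for g using that by (auto simp: G0_def)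
  have "finite_jordan_constant G \<le> 120"
  proof (rule G.finite_jordan_constant_two_fixed_points[of G0 proj_space act])
    show "finite (carrier G)" using H by simp
    show "subgroup G0 G" by (rule G0_subgroup)
    show "x \<otimes>\<^bsub>G\<^esub> y \<in> G0" if "x \<in> carrier G - G0" "y \<in> carrier G - G0" for x y
      using G0_index that by simp
    show "act g P \<in> proj_space" if g: "g \<in> G0" and P: "P \<in> proj_space" for g P
    proof -
      obtain A B where ab: "acts_by g A B" using actG(1)[OF g] by blast
      obtain u where u: "u \<noteq> 0" "P = point_of u" using P by (auto simp: proj_space_def)
      show ?thesis
        using act_eq[OF ab u(1)] acts_by_nonzero(1)[OF ab u(1)] u(2) by (simp add: point_of_in_proj_space)
    qed
    show "act \<one>\<^bsub>G\<^esub> P = P" if "P \<in> proj_space" for P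
      using that act_eq[OF acts_by_id] by (auto simp: one_G proj_space_def)
    show "act (g \<otimes>\<^bsub>G\<^esub> h) P = act g (act h P)" if gh: "g \<in> G0" "h \<in> G0" and P: "P \<in> proj_space" for g h P
    proof -
      obtain A B A' B' where *: "acts_by g A B" "acts_by h A' B'"
        using actG(1)[OF gh(1)] actG(1)[OF gh(2)] by blast
      obtain u where u: "u \<noteq> 0" "P = point_of u" using P by (auto simp: proj_space_def)
      have "act (g \<otimes>\<^bsub>G\<^esub> h) P = point_of ((A ** A') *v u)"
        using act_eq[OF acts_by_mult[OF _ _ *] u(1)] u(2) actG gh by simp
      also have "\<dots> = act g (act h P)"
        using act_eq[OF *(2) u(1)] act_eq[OF *(1) acts_by_nonzero(1)[OF *(2) u(1)]] u(2)
        by (simp add: matrix_vector_mul_assoc)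
      finally show ?thesis .
    qed
  qed (use card_fixed_points stabilizer_commute in blast)+
  then show ?thesis by (simp add: G_def)
qed

end

theorem (in arithmetic_quadric) jordan_constant_Aut_le: "jordan_constant (Aut S) \<le> 120"
  unfolding jordan_constant_def
proof (rule SUP_least)
  fix H assume "H \<in> {H. subgroup H (Aut S) \<and> finite H}"
  then have H: "subgroup H (Aut S)" "finite H" by auto
  interpret B: Group.group "BijGroup S" by (rule group_BijGroup)
  have sub: "H \<subseteq> carrier (Aut S)" using subgroup.subset[OF H(1)] .
  then have HB: "H \<subseteq> carrier (BijGroup S)" by (auto simp: Aut_def BijGroup_def)
  have closed: "x \<otimes>\<^bsub>BijGroup S\<^esub> y \<in> H" if "x \<in> H" "y \<in> H" for x y
    using subgroup.m_closed[OF H(1) that] by (simp add: Aut_def)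
  have one: "\<one>\<^bsub>BijGroup S\<^esub> \<in> H" using subgroup.one_closed[OF H(1)] by (simp add: Aut_def)
  have "inv\<^bsub>BijGroup S\<^esub> x \<in> H" if x: "x \<in> H" for x
  proof -
    \<comment> \<open>A finite set closed under multiplication contains inverses, since translation
      by \<open>x\<close> permutes it. So only products and the unit of \<open>Aut S\<close> have to
      be compared with those of \<open>BijGroup S\<close>.\<close>
    have "inj_on (\<lambda>y. x \<otimes>\<^bsub>BijGroup S\<^esub> y) H" 
    proof (rule inj_onI)
      fix y z assume yz: "y \<in> H" "z \<in> H" "x \<otimes>\<^bsub>BijGroup S\<^esub> y = x \<otimes>\<^bsub>BijGroup S\<^esub> z"
      have c: "x \<in> carrier (BijGroup S)" "y \<in> carrier (BijGroup S)" "z \<in> carrier (BijGroup S)"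
        using x yz HB by auto
      show "y = z" by (rule B.l_cancel[OF yz(3) c(2,3,1)])
    qed
    then have "(\<lambda>y. x \<otimes>\<^bsub>BijGroup S\<^esub> y) ` H = H" using closed x by (intro endo_inj_surj[OF H(2)]) auto
    then have "\<one>\<^bsub>BijGroup S\<^esub> \<in> (\<lambda>y. x \<otimes>\<^bsub>BijGroup S\<^esub> y) ` H" using one by simp
    then obtain y where y: "y \<in> H" "x \<otimes>\<^bsub>BijGroup S\<^esub> y = \<one>\<^bsub>BijGroup S\<^esub>" by force
    have c: "x \<in> carrier (BijGroup S)" "y \<in> carrier (BijGroup S)" using x y HB by auto
    have "y \<otimes>\<^bsub>BijGroup S\<^esub> x = \<one>\<^bsub>BijGroup S\<^esub>" using B.inv_comm[OF y(2) c] .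
    then have "inv\<^bsub>BijGroup S\<^esub> x = y" using B.inv_equality c by blast
    then show ?thesis using y by simp
  qed
  then have HS: "subgroup H (BijGroup S)" using HB closed one by (intro B.subgroupI) auto
  interpret finite_automorphisms N N' S \<delta> H
    by (intro finite_automorphisms.intro finite_automorphisms_axioms.intro arithmetic_quadric_axioms HS)
      (use H sub in \<open>auto simp: Aut_def\<close>)
  have "(Aut S)\<lparr>carrier := H\<rparr> = (BijGroup S)\<lparr>carrier := H\<rparr>" by (simp add: Aut_def)
  then show "enat (finite_jordan_constant ((Aut S)\<lparr>carrier := H\<rparr>)) \<le> 120"
    using finite_jordan_constant_le_120 by (simp add: numeral_eq_enat)
qed

section \<open>Quadratic forms\<close>

lemma mpoly_eval_superset:
  assumes "finite A" "Poly_Mapping.keys f \<subseteq> A"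
  shows "mpoly_eval f x = (\<Sum>m\<in>A. to_ac (Poly_Mapping.lookup f m) * (\<Prod>i\<in>UNIV. (x $ i) ^ Poly_Mapping.lookup m i))"
  unfolding mpoly_eval_def
  by (rule sum.mono_neutral_left) (use assms in \<open>auto simp: in_keys_iff\<close>)

lemma mpoly_eval_add: "mpoly_eval (f + g) x = mpoly_eval f x + mpoly_eval g x"
proof -
  let ?A = "Poly_Mapping.keys f \<union> Poly_Mapping.keys g"
  have "Poly_Mapping.keys (f + g) \<subseteq> ?A" by (rule Poly_Mapping.keys_add)
  then show ?thesis
    by (simp add: mpoly_eval_superset[of ?A] lookup_add sum.distrib algebra_simps)
qed

lemma mpoly_eval_zero [simp]: "mpoly_eval 0 x = 0"
  by (simp add: mpoly_eval_def)

lemma mpoly_eval_sum: "mpoly_eval (\<Sum>a\<in>A. f a) x = (\<Sum>a\<in>A. mpoly_eval (f a) x)"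
  by (induction A rule: infinite_finite_induct) (simp_all add: mpoly_eval_add)

lemma mpoly_eval_single:
  "mpoly_eval (Poly_Mapping.single m c) x = to_ac c * (\<Prod>i\<in>UNIV. (x $ i) ^ Poly_Mapping.lookup m i)"
  by (simp add: mpoly_eval_superset[of "{m}"])

lemma degree_two_monomial:
  fixes f :: "'i::finite \<Rightarrow> nat"
  assumes "(\<Sum>i\<in>UNIV. f i) = 2"
  obtains a b where "\<And>i. f i = (if i = a then 1 else 0) + (if i = b then 1 else 0)"
proof -
  obtain a where a: "f a > 0" using assms by (metis gr0I numeral_neq_zero sum.neutral)
  define g where "g = (\<lambda>i. f i - (if i = a then 1 else 0))"
  have fg: "f i = (if i = a then 1 else 0) + g i" for i using a by (auto simp: g_def)
  have "(\<Sum>i\<in>UNIV. f i) = 1 + (\<Sum>i\<in>UNIV. g i)" by (simp add: fg sum.distrib)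
  then have "(\<Sum>i\<in>UNIV. g i) = Suc 0" using assms by simp
  then obtain b where "g b = Suc 0" "\<forall>i. b \<noteq> i \<longrightarrow> g i = 0"
    unfolding sum_eq_Suc0_iff[OF finite_class.finite_UNIV] by auto
  then have "g i = (if i = b then 1 else 0)" for i by auto
  then show ?thesis using that[of a b] fg by simp
qed

lemma prod_power_delta:
  fixes x :: "'i::finite \<Rightarrow> 'c::comm_ring_1"
  shows "(\<Prod>i\<in>UNIV. x i ^ (if i = a then 1 else 0)) = x a"
proof -
  have "(\<Prod>i\<in>UNIV. x i ^ (if i = a then 1 else 0)) = (\<Prod>i\<in>UNIV. if i = a then x i else 1)"
    by (intro prod.cong) auto
  then show ?thesis by simp
qed

text \<open>The coefficient of a monomial \<open>x_a x_b\<close> is split into halves at the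
  positions \<open>(a, b)\<close> and \<open>(b, a)\<close>; for a square \<open>a = b\<close> both
  halves fall on the same diagonal entry.\<close>

lemma quadratic_form_matrix:
  fixes q :: "('k::field_char_0, 'i::finite) mpoly"
  assumes "homogeneous 2 q"
  obtains B :: "'k^'i^'i" where "\<And>i j. B $ i $ j = B $ j $ i"
    "\<And>x. mpoly_eval q x = (\<Sum>i\<in>UNIV. \<Sum>j\<in>UNIV. to_ac (B $ i $ j) * x $ i * x $ j)"
    "\<And>i x. mpoly_eval (partial_deriv i q) x = 2 * (\<Sum>j\<in>UNIV. to_ac (B $ i $ j) * x $ j)"
proof -
  have "\<exists>a b. \<forall>i. Poly_Mapping.lookup m i = (if i = a then 1 else 0) + (if i = b then 1 else 0)"
    if "m \<in> Poly_Mapping.keys q" for m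
    using assms that degree_two_monomial[of "Poly_Mapping.lookup m"] unfolding homogeneous_def by metis
  then obtain a b where ab: "\<And>m i. m \<in> Poly_Mapping.keys q \<Longrightarrow>
    Poly_Mapping.lookup m i = (if i = a m then 1 else 0) + (if i = b m then 1 else 0)" by metis
  define c where "c = Poly_Mapping.lookup q"
  define K where "K = Poly_Mapping.keys q"
  define B :: "'k^'i^'i" where "B = (\<chi> i j. \<Sum>m\<in>K. c m / 2 *
    ((if i = a m \<and> j = b m then 1 else 0) + (if i = b m \<and> j = a m then 1 else 0)))"
  have sym: "B $ i $ j = B $ j $ i" for i j
    unfolding B_def vec_lambda_beta by (intro sum.cong refl) (simp add: conj_commute add.commute)
  have B: "to_ac (B $ i $ j) = (\<Sum>m\<in>K. to_ac (c m) / 2 *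
    ((if i = a m \<and> j = b m then 1 else 0) + (if i = b m \<and> j = a m then 1 else 0)))" for i j
    unfolding B_def vec_lambda_beta to_ac_sum
    by (simp only: to_ac_mult to_ac_divide to_ac_add to_ac_numeral if_distrib[of to_ac] to_ac_0 to_ac_1)
  have row: "(\<Sum>j\<in>UNIV. to_ac (B $ i $ j) * x $ j) =
      (\<Sum>m\<in>K. to_ac (c m) / 2 * ((if i = a m then x $ b m else 0) + (if i = b m then x $ a m else 0)))"
    for i and x :: "'k alg_closure^'i"
  proof -
    have "(\<Sum>j\<in>UNIV. to_ac (B $ i $ j) * x $ j) = (\<Sum>m\<in>K. \<Sum>j\<in>UNIV. to_ac (c m) / 2 *
      ((if i = a m \<and> j = b m then 1 else 0) + (if i = b m \<and> j = a m then 1 else 0)) * x $ j)"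
      unfolding B sum_distrib_right by (rule sum.swap)
    also have "\<dots> = (\<Sum>m\<in>K. to_ac (c m) / 2 *
      (\<Sum>j\<in>UNIV. (if j = b m then if i = a m then x $ j else 0 else 0) + (if j = a m then if i = b m then x $ j else 0 else 0)))"
      unfolding sum_distrib_left
    proof (intro sum.cong refl)
      fix m j
      show "to_ac (c m) / 2 * ((if i = a m \<and> j = b m then 1 else 0) + (if i = b m \<and> j = a m then 1 else 0)) * x $ j =
        to_ac (c m) / 2 * ((if j = b m then if i = a m then x $ j else 0 else 0) + (if j = a m then if i = b m then x $ j else 0 else 0))"
        by (cases "i = a m"; cases "j = b m"; cases "i = b m"; cases "j = a m") (simp_all only: simp_thms if_True if_False, simp_all)
    qed
    also have "\<dots> = (\<Sum>m\<in>K. to_ac (c m) / 2 * ((if i = a m then x $ b m else 0) + (if i = b m then x $ a m else 0)))"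
      by (simp add: sum.distrib)
    finally show ?thesis .
  qed
  show ?thesis
  proof (rule that[of B])
    show "B $ i $ j = B $ j $ i" for i j by (rule sym)
    show "mpoly_eval q x = (\<Sum>i\<in>UNIV. \<Sum>j\<in>UNIV. to_ac (B $ i $ j) * x $ i * x $ j)" for x
    proof -
      have "(\<Sum>i\<in>UNIV. \<Sum>j\<in>UNIV. to_ac (B $ i $ j) * x $ i * x $ j) =
        (\<Sum>i\<in>UNIV. x $ i * (\<Sum>j\<in>UNIV. to_ac (B $ i $ j) * x $ j))"
        by (simp add: sum_distrib_left mult_ac)
      also have "\<dots> = (\<Sum>m\<in>K. \<Sum>i\<in>UNIV. x $ i * (to_ac (c m) / 2 * ((if i = a m then x $ b m else 0) + (if i = b m then x $ a m else 0))))"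
        unfolding row sum_distrib_left by (rule sum.swap)
      also have "\<dots> = (\<Sum>m\<in>K. to_ac (c m) / 2 * (\<Sum>i\<in>UNIV. (if i = a m then x $ i * x $ b m else 0) + (if i = b m then x $ i * x $ a m else 0)))"
        unfolding sum_distrib_left
      proof (intro sum.cong refl)
        fix m i
        show "x $ i * (to_ac (c m) / 2 * ((if i = a m then x $ b m else 0) + (if i = b m then x $ a m else 0))) =
          to_ac (c m) / 2 * ((if i = a m then x $ i * x $ b m else 0) + (if i = b m then x $ i * x $ a m else 0))"
          by (cases "i = a m"; cases "i = b m") (simp_all only: if_True if_False, simp_all add: algebra_simps)
      qed
      also have "\<dots> = (\<Sum>m\<in>K. to_ac (c m) * (x $ a m * x $ b m))"
        by (simp add: sum.distrib mult.commute)
      also have "\<dots> = mpoly_eval q x"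
        unfolding mpoly_eval_def
        by (intro sum.cong) (simp_all add: K_def c_def ab power_add prod.distrib prod_power_delta)
      finally show ?thesis ..
    qed
    show "mpoly_eval (partial_deriv i q) x = 2 * (\<Sum>j\<in>UNIV. to_ac (B $ i $ j) * x $ j)" for i x
    proof -
      \<comment> \<open>If \<open>i\<close> does not occur in \<open>m\<close>, truncated
        subtraction leaves the monomial unchanged, but the factor 0 removes it. If \<open>i\<close>
        occurs twice, both summands on the right are present and supply the factor 2.\<close>
      have mono: "of_nat (Poly_Mapping.lookup m i) * (\<Prod>j\<in>UNIV. (x $ j) ^ Poly_Mapping.lookup (m - Poly_Mapping.single i 1) j)
        = (if i = a m then x $ b m else 0) + (if i = b m then x $ a m else 0)" if "m \<in> K" for m
      proof -
        have lk: "Poly_Mapping.lookup (m - Poly_Mapping.single i 1) j =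
          (if j = a m then 1 else 0) + (if j = b m then 1 else 0) - (if j = i then 1 else 0)" for j
          using that ab by (simp add: lookup_minus lookup_single K_def when_def)
        have lki: "Poly_Mapping.lookup m i = (if i = a m then 1 else 0) + (if i = b m then 1 else 0)"
          using that ab by (simp add: K_def)
        consider "i = a m" "i = b m" | "i = a m" "i \<noteq> b m" | "i \<noteq> a m" "i = b m" | "i \<noteq> a m" "i \<noteq> b m" by blast
        then show ?thesis
        proof cases
          case 1
          then have "Poly_Mapping.lookup (m - Poly_Mapping.single i 1) j = (if j = i then 1 else 0)" for j
            unfolding lk by auto
          then show ?thesis using lki 1 prod_power_delta[of "\<lambda>j. x $ j" i] by simp
        next
          case 2
          then have "Poly_Mapping.lookup (m - Poly_Mapping.single i 1) j = (if j = b m then 1 else 0)" for j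
            unfolding lk by auto
          then show ?thesis using lki 2 prod_power_delta[of "\<lambda>j. x $ j" "b m"] by simp
        next
          case 3
          then have "Poly_Mapping.lookup (m - Poly_Mapping.single i 1) j = (if j = a m then 1 else 0)" for j
            unfolding lk by auto
          then show ?thesis using lki 3 prod_power_delta[of "\<lambda>j. x $ j" "a m"] by simp
        next
          case 4
          then show ?thesis using lki by simp
        qed
      qed
      have "mpoly_eval (partial_deriv i q) x = (\<Sum>m\<in>K. to_ac (c m) *
        (of_nat (Poly_Mapping.lookup m i) * (\<Prod>j\<in>UNIV. (x $ j) ^ Poly_Mapping.lookup (m - Poly_Mapping.single i 1) j)))"
        by (simp add: partial_deriv_def mpoly_eval_sum mpoly_eval_single K_def c_def mult_ac)
      also have "\<dots> = 2 * (\<Sum>j\<in>UNIV. to_ac (B $ i $ j) * x $ j)"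
        unfolding row sum_distrib_left
      proof (intro sum.cong refl)
        fix m assume "m \<in> K"
        then show "to_ac (c m) * (of_nat (Poly_Mapping.lookup m i) *
            (\<Prod>j\<in>UNIV. (x $ j) ^ Poly_Mapping.lookup (m - Poly_Mapping.single i 1) j)) =
          2 * (to_ac (c m) / 2 * ((if i = a m then x $ b m else 0) + (if i = b m then x $ a m else 0)))"
          unfolding mono[OF \<open>m \<in> K\<close>] by (simp only: mult.assoc[symmetric]) simp
      qed
      finally show ?thesis .
    qed
  qed
qed

section \<open>Orthogonal splitting of symmetric bilinear forms\<close>

definition bform :: "'a::comm_ring_1^'n::finite^'n \<Rightarrow> 'a^'n \<Rightarrow> 'a^'n \<Rightarrow> 'a" where
  "bform B x y = (\<Sum>i\<in>UNIV. \<Sum>j\<in>UNIV. B $ i $ j * x $ i * y $ j)"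

lemma bform_add: "bform B (x + x') y = bform B x y + bform B x' y" "bform B x (y + y') = bform B x y + bform B x y'"
  by (simp_all add: bform_def algebra_simps sum.distrib)

lemma bform_scale: "bform B (c *s x) y = c * bform B x y" "bform B x (c *s y) = c * bform B x y"
  by (simp_all add: bform_def sum_distrib_left mult_ac)

lemma bform_diff: "bform B (x - x') y = bform B x y - bform B x' y" "bform B x (y - y') = bform B x y - bform B x y'"
  by (simp_all add: bform_def algebra_simps sum_subtractf)

lemma bform_zero [simp]: "bform B 0 y = 0" "bform B x 0 = 0"
  by (simp_all add: bform_def)

lemma bform_sym:
  assumes "\<And>i j. B $ i $ j = B $ j $ i" shows "bform B x y = bform B y x"
proof -
  have "bform B x y = (\<Sum>j\<in>UNIV. \<Sum>i\<in>UNIV. B $ i $ j * x $ i * y $ j)" unfolding bform_def by (rule sum.swap)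
  also have "\<dots> = bform B y x" unfolding bform_def by (intro sum.cong refl) (simp add: assms[of _ i for i] mult_ac)
  finally show ?thesis .
qed

locale nondegenerate_form =
  fixes B :: "'k::field_char_0^'n::finite^'n"
  assumes sym: "\<And>i j. B $ i $ j = B $ j $ i"
    and nondeg: "\<And>x. (\<And>y. bform B x y = 0) \<Longrightarrow> x = 0"
begin

text \<open>If all vectors orthogonal to \<open>E\<close> were isotropic, polarization would make
  the form zero on the orthogonal complement. Then \<open>pr v\<close> would be orthogonal to the
  span and to the complement, hence zero, and \<open>E\<close> would span the whole space.\<close>

lemma anisotropic_complement:
  assumes E: "finite E" "card E < CARD('n)"
    and pr: "\<And>v e. e \<in> E \<Longrightarrow> bform B (pr v) e = 0" "\<And>v. v - pr v \<in> vec.span E"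
  obtains u where "\<And>e. e \<in> E \<Longrightarrow> bform B u e = 0" "bform B u u \<noteq> 0"
proof (rule ccontr)
  assume contra: "\<not> thesis"
  note ob = that
  have iso: "bform B u u = 0" if u: "\<And>e. e \<in> E \<Longrightarrow> bform B u e = 0" for u
  proof (rule ccontr)
    assume "bform B u u \<noteq> 0"
    with u have thesis by (rule ob)
    with contra show False ..
  qed
  have zero: "bform B u w = 0" if u: "\<And>e. e \<in> E \<Longrightarrow> bform B u e = 0" and w: "\<And>e. e \<in> E \<Longrightarrow> bform B w e = 0" for u w
  proof -
    have "bform B (u + w) (u + w) = 0" using u w by (intro iso) (simp add: bform_add)
    then have "2 * bform B u w = 0" using iso[of u] iso[of w] u w bform_sym[OF sym, of u w] by (simp add: bform_add)
    then show ?thesis by simp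
  qed
  have "vec.span E \<noteq> UNIV"
  proof
    assume "vec.span E = UNIV"
    then have "vec.dim (UNIV :: ('k^'n) set) \<le> card E" using vec.dim_le_card[of UNIV E] E(1) by blast
    then show False using E(2) unfolding vec_dim_card by linarith
  qed
  then obtain v where v: "v \<notin> vec.span E" by blast
  have "bform B (pr v) w = 0" for w
  proof -
    have "bform B (pr v) x = 0" if "x \<in> vec.span E" for x
      using that by (induction rule: vec.span_induct_alt) (simp_all add: bform_add bform_scale pr)
    then have "bform B (pr v) (w - pr w) = 0" using pr(2) by blast
    then show ?thesis using zero[of "pr v" "pr w"] pr(1) by (simp add: bform_diff)
  qed
  then have "pr v = 0" by (rule nondeg)
  then show False using pr(2)[of v] v by simp
qed

lemma hyperbolic_splitting:
  assumes n: "CARD('n) = 4" and e1: "e1 \<noteq> 0" "bform B e1 e1 = 0"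
  obtains e2 e3 e4 b a c where "b \<noteq> 0" "a \<noteq> 0" "c \<noteq> 0" "bform B e1 e2 = b" "bform B e2 e2 = 0"
    "bform B e3 e3 = a" "bform B e4 e4 = c" "bform B e1 e3 = 0" "bform B e1 e4 = 0"
    "bform B e2 e3 = 0" "bform B e2 e4 = 0" "bform B e3 e4 = 0"
proof -
  note s = bform_sym[OF sym]
  obtain f where f: "bform B e1 f \<noteq> 0" using nondeg[of e1] e1 by blast
  define b where "b = bform B e1 f"
  have b: "b \<noteq> 0" using f by (simp add: b_def)
  \<comment> \<open>The correction by a multiple of the isotropic \<open>e1\<close> keeps the
    pairing with \<open>e1\<close> and makes the vector isotropic.\<close>
  define e2 where "e2 = f - (bform B f f / (2 * b)) *s e1"
  have e12: "bform B e1 e2 = b" "bform B e2 e1 = b"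
    using e1 s[of f e1] by (simp_all add: e2_def bform_diff bform_scale b_def)
  have e22: "bform B e2 e2 = 0"
    using e1 b s[of f e1] by (simp add: e2_def bform_diff bform_scale flip: b_def)
  \<comment> \<open>Since \<open>e1\<close> and \<open>e2\<close> are isotropic and pair to
    \<open>b\<close>, the component along each is found by pairing with the other.\<close>
  define pr where "pr v = v - (bform B v e2 / b) *s e1 - (bform B v e1 / b) *s e2" for v
  have pr: "bform B (pr v) e1 = 0" "bform B (pr v) e2 = 0" for v
    using e1 e12 e22 b by (simp_all add: pr_def bform_diff bform_scale)
  have card2: "card {e1, e2} \<le> 2" by (simp add: card_insert_if)
  obtain e3 where e3: "\<And>e. e \<in> {e1, e2} \<Longrightarrow> bform B e3 e = 0" "bform B e3 e3 \<noteq> 0"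
  proof (rule anisotropic_complement[of "{e1, e2}" pr])
    show "card {e1, e2} < CARD('n)" using card2 n by linarith
    show "bform B (pr v) e = 0" if "e \<in> {e1, e2}" for v e using that pr by auto
    show "v - pr v \<in> vec.span {e1, e2}" for v
    proof -
      have eq: "v - pr v = (bform B v e2 / b) *s e1 + (bform B v e1 / b) *s e2" by (simp add: pr_def)
      show ?thesis unfolding eq by (intro vec.span_add vec.span_scale vec.span_base) simp_all
    qed
  qed auto
  define a where "a = bform B e3 e3"
  have a: "a \<noteq> 0" using e3 by (simp add: a_def)
  have e3': "bform B e3 e1 = 0" "bform B e3 e2 = 0" "bform B e1 e3 = 0" "bform B e2 e3 = 0"
    using e3(1) s[of e1 e3] s[of e2 e3] by auto
  define pr' where "pr' v = pr v - (bform B v e3 / a) *s e3" for v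
  have pr': "bform B (pr' v) e1 = 0" "bform B (pr' v) e2 = 0" "bform B (pr' v) e3 = 0" for v
    using pr e3' a by (simp_all add: pr'_def bform_diff bform_scale) (simp add: pr_def bform_diff bform_scale e3' a_def)
  have card3: "card {e1, e2, e3} \<le> 3" by (simp add: card_insert_if)
  obtain e4 where e4: "\<And>e. e \<in> {e1, e2, e3} \<Longrightarrow> bform B e4 e = 0" "bform B e4 e4 \<noteq> 0"
  proof (rule anisotropic_complement[of "{e1, e2, e3}" pr'])
    show "card {e1, e2, e3} < CARD('n)" using card3 n by linarith
    show "bform B (pr' v) e = 0" if "e \<in> {e1, e2, e3}" for v e using that pr' by auto
    show "v - pr' v \<in> vec.span {e1, e2, e3}" for v
    proof -
      have eq: "v - pr' v = (bform B v e2 / b) *s e1 + (bform B v e1 / b) *s e2 + (bform B v e3 / a) *s e3"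
        by (simp add: pr_def pr'_def)
      show ?thesis unfolding eq by (intro vec.span_add vec.span_scale vec.span_base) simp_all
    qed
  qed auto
  have e4': "bform B e1 e4 = 0" "bform B e2 e4 = 0" "bform B e3 e4 = 0"
    using e4(1) s[of e1 e4] s[of e2 e4] s[of e3 e4] by auto
  show ?thesis
    by (rule that[OF b a e4(2) e12(1) e22 a_def[symmetric] refl e3'(3) e4'(1) e3'(4) e4'(2,3)])
qed

end

section \<open>Rational points\<close>

definition ac_vec :: "'k::field^'n \<Rightarrow> 'k alg_closure^'n" where
  "ac_vec x = (\<chi> i. to_ac (x $ i))"

definition ac_mat :: "'k::field^'n^'m \<Rightarrow> 'k alg_closure^'n^'m" where
  "ac_mat A = (\<chi> i j. to_ac (A $ i $ j))"

lemma ac_vec_nth [simp]: "ac_vec x $ i = to_ac (x $ i)"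
  by (simp add: ac_vec_def)

lemma ac_mat_nth [simp]: "ac_mat A $ i $ j = to_ac (A $ i $ j)"
  by (simp add: ac_mat_def)

lemma ac_vec_eq_0_iff [simp]: "ac_vec x = 0 \<longleftrightarrow> x = 0"
  by (simp add: vec_eq_iff)

lemma ac_mat_mult: "ac_mat (A ** B) = ac_mat A ** ac_mat B"
  by (simp add: vec_eq_iff matrix_matrix_mult_def to_ac_sum)

lemma ac_mat_one: "ac_mat (mat 1) = mat 1"
  by (simp add: vec_eq_iff mat_def)

lemma ac_mat_vec: "ac_mat A *v ac_vec x = ac_vec (A *v x)"
  by (simp add: vec_eq_iff matrix_vector_mult_def to_ac_sum)

lemma kvec_iff_range: "kvec x \<longleftrightarrow> (\<exists>k. x = ac_vec k)"
proof
  assume "kvec x"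
  then obtain k where "\<And>i. x $ i = to_ac (k i)" unfolding kvec_def image_iff by metis
  then have "x = ac_vec (\<chi> i. k i)" by (simp add: vec_eq_iff)
  then show "\<exists>k. x = ac_vec k" ..
qed (auto simp: kvec_def)

lemma kvec_ac_mat: "kvec x \<Longrightarrow> kvec (ac_mat A *v x)"
  using ac_mat_vec unfolding kvec_iff_range by blast

section \<open>Existence of rational points\<close>

lemma zariski_open_proj_space: "zariski_open (proj_space :: ('k::field, 'i::finite) point set)"
proof -
  let ?one = "Poly_Mapping.single 0 1 :: ('k, 'i) mpoly"
  have "mpoly_eval ?one x = 1" for x unfolding mpoly_eval_single by simp
  then have "zero_locus {?one} = {}"
    unfolding zero_locus_def proj_space_def using self_mem_point_of by fastforce
  moreover have "homogeneous 0 ?one" by (simp add: homogeneous_def)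
  ultimately show ?thesis unfolding zariski_open_def by (intro exI[of _ "{?one}"]) auto
qed

lemma mpoly_eval_coordinate:
  "\<exists>p. \<forall>t. poly p t = mpoly_eval f (\<chi> j. if j = i then t else x $ j)"
proof -
  define p where "p = (\<Sum>m\<in>Poly_Mapping.keys f. smult (to_ac (Poly_Mapping.lookup f m))
    (\<Prod>j\<in>UNIV. (if j = i then [:0, 1:] else [:x $ j:]) ^ Poly_Mapping.lookup m j))"
  have "poly p t = mpoly_eval f (\<chi> j. if j = i then t else x $ j)" for t
    unfolding p_def mpoly_eval_def poly_sum poly_smult poly_prod poly_power
    by (intro sum.cong prod.cong refl arg_cong2[of _ _ _ _ "(*)"] arg_cong2[of _ _ _ _ "(^)"]) auto
  then show ?thesis by blast
qed

text \<open>Coordinates are moved into the infinite field \<open>K\<close> one at a time: in each of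
  them the value of \<open>f\<close> is a nonzero polynomial with finitely many roots. Zero is
  avoided as well, so that \<open>y\<close> represents a point of projective space.\<close>

lemma kvec_nonvanishing:
  fixes x :: "'k::field_char_0 alg_closure^'i::finite"
  assumes "mpoly_eval f x \<noteq> 0"
  obtains y where "kvec y" "y \<noteq> 0" "mpoly_eval f y \<noteq> 0"
proof -
  have inf: "infinite (range (to_ac :: 'k \<Rightarrow> _))"
    using finite_imageD[OF _ inj_to_ac] infinite_UNIV_char_0 by blast
  have "\<exists>y. (\<forall>i\<in>A. y $ i \<in> range to_ac \<and> y $ i \<noteq> 0) \<and> mpoly_eval f y \<noteq> 0" if "finite A" for A :: "'i set"
    using that
  proof (induction A rule: finite_induct)
    case empty
    then show ?case using assms by blast
  next
    case (insert i A)
    then obtain y where y: "\<forall>i\<in>A. y $ i \<in> range to_ac \<and> y $ i \<noteq> 0" "mpoly_eval f y \<noteq> 0" by blast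
    obtain p where p: "\<And>t. poly p t = mpoly_eval f (\<chi> j. if j = i then t else y $ j)"
      using mpoly_eval_coordinate by blast
    have "(\<chi> j. if j = i then y $ i else y $ j) = y" by (simp add: vec_eq_iff)
    then have "poly p (y $ i) \<noteq> 0" using y(2) p by metis
    then have "p \<noteq> 0" by auto
    then have "finite ({t. poly p t = 0} \<union> {0})" using poly_roots_finite by blast
    then obtain t where "t \<in> range to_ac" "t \<notin> {t. poly p t = 0} \<union> {0}"
      using inf by (meson finite_subset subsetI)
    then show ?case using y insert(2) p
      by (intro exI[of _ "\<chi> j. if j = i then t else y $ j"]) auto
  qed
  from this[OF finite] obtain y where y: "\<forall>i\<in>UNIV. y $ i \<in> range to_ac \<and> y $ i \<noteq> 0" "mpoly_eval f y \<noteq> 0"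
    by blast
  moreover have "y \<noteq> 0"
  proof
    assume "y = 0"
    then have "y $ i = 0" for i by simp
    then show False using y(1) by blast
  qed
  ultimately show ?thesis using that[of y] by (simp add: kvec_def)
qed

text \<open>A nonempty open subset of the plane contains a \<open>K\<close>-point, and the inverse
  of the birational map sends it to a \<open>K\<close>-point of the surface.\<close>

lemma rational_surface_kvec:
  fixes V :: "('k::field_char_0, 'i::finite) point set"
  assumes "rational_surface V"
  obtains P y where "P \<in> V" "y \<in> P" "kvec y"
proof -
  obtain U and U' :: "('k, 3) point set" where U: "dense_open_in U V" "dense_open_in U' proj_space" "isomorphic_var U U'"
    using assms unfolding rational_surface_def birational_def by blast
  obtain N where N: "zariski_open N" "U' = proj_space \<inter> N" using U(2) unfolding dense_open_in_def by blast
  have "proj_space \<noteq> ({} :: ('k, 3) point set)"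
    using point_of_in_proj_space[of "\<chi> i. 1"] by (auto simp: vec_eq_iff)
  then have "U' \<noteq> {}" using U(2) zariski_open_proj_space unfolding dense_open_in_def by (metis inf.idem inf_bot_left)
  then obtain x where x: "x \<noteq> 0" "point_of x \<in> N" using N by (auto simp: proj_space_def)
  obtain f d where f: "mpoly_eval f x \<noteq> 0" "\<And>y. y \<noteq> 0 \<Longrightarrow> mpoly_eval f y \<noteq> 0 \<Longrightarrow> point_of y \<in> N"
    using zariski_openE[OF N(1) x(2)] by metis
  obtain y where y: "kvec y" "y \<noteq> 0" "mpoly_eval f y \<noteq> 0" using kvec_nonvanishing[OF f(1)] .
  then have yU: "point_of y \<in> U'" using f(2) N point_of_in_proj_space by blast
  obtain \<psi> where \<psi>: "is_morphism U' U \<psi>" using U(3) unfolding isomorphic_var_def by blast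
  obtain z where z: "z \<in> \<psi> (point_of y)" "kvec z" by (rule morphism_kvec[OF \<psi> yU self_mem_point_of y(1)])
  have "\<psi> (point_of y) \<in> U" using \<psi> yU by (auto simp: is_morphism_def)
  then have "\<psi> (point_of y) \<in> V" using U(1) unfolding dense_open_in_def by blast
  then show ?thesis using z that by blast
qed

section \<open>Quadrics with a rational point\<close>

lemma quadric_normal_form:
  fixes q :: "('k::field_char_0, 4) mpoly"
  assumes q: "homogeneous 2 q" "smooth_hypersurface q" and x: "kvec x" "x \<noteq> 0" "mpoly_eval q x = 0"
  obtains M M' :: "'k^4^4" and \<kappa> d where "M ** M' = mat 1" "M' ** M = mat 1" "\<kappa> \<noteq> 0" "d \<noteq> 0"
    "\<And>y. mpoly_eval q (ac_mat M *v y) = to_ac \<kappa> * (y $ 1 * y $ 2 - (y $ 3)\<^sup>2 + to_ac d * (y $ 4)\<^sup>2)"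
proof -
  obtain B :: "'k^4^4" where sym: "\<And>i j. B $ i $ j = B $ j $ i"
    and ev: "\<And>x. mpoly_eval q x = (\<Sum>i\<in>UNIV. \<Sum>j\<in>UNIV. to_ac (B $ i $ j) * x $ i * x $ j)"
    and pd: "\<And>i x. mpoly_eval (partial_deriv i q) x = 2 * (\<Sum>j\<in>UNIV. to_ac (B $ i $ j) * x $ j)"
    using quadratic_form_matrix[OF q(1)] by blast
  have ev': "mpoly_eval q x = bform (ac_mat B) x x" for x by (simp add: ev bform_def)
  have ac: "bform (ac_mat B) (ac_vec u) (ac_vec v) = to_ac (bform B u v)" for u v
    by (simp add: bform_def to_ac_sum)
  interpret nondegenerate_form B
  proof
    show "B $ i $ j = B $ j $ i" for i j by (rule sym)
    fix u assume u: "\<And>v. bform B u v = 0"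
    show "u = 0"
    \<comment> \<open>A nonzero vector in the radical would be a point of the quadric at which all
      partial derivatives vanish, contrary to smoothness.\<close>
    proof (rule ccontr)
      assume "u \<noteq> 0"
      moreover have "mpoly_eval q (ac_vec u) = 0" using u by (simp add: ev' ac)
      ultimately obtain i where i: "mpoly_eval (partial_deriv i q) (ac_vec u) \<noteq> 0"
        using q(2) ac_vec_eq_0_iff unfolding smooth_hypersurface_def by blast
      have "bform B u (\<chi> j. if j = i then 1 else 0) = (\<Sum>k\<in>UNIV. \<Sum>j\<in>UNIV. if j = i then B $ k $ j * u $ k else 0)"
        unfolding bform_def by (intro sum.cong refl) auto
      also have "\<dots> = (\<Sum>k\<in>UNIV. B $ i $ k * u $ k)" by (simp add: sym[of _ i])
      finally have "(\<Sum>k\<in>UNIV. B $ i $ k * u $ k) = 0" using u by simp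
      then have "to_ac (\<Sum>k\<in>UNIV. B $ i $ k * u $ k) = 0" by simp
      then show False using i by (simp add: pd to_ac_sum)
    qed
  qed
  obtain e1 where e1: "x = ac_vec e1" using x(1) kvec_iff_range by blast
  have "to_ac (bform B e1 e1) = 0" using x(3) by (simp add: e1 ev' flip: ac)
  then have e1': "e1 \<noteq> 0" "bform B e1 e1 = 0" using x(2) by (auto simp: e1)
  obtain e2 e3 e4 b a c where nz: "b \<noteq> 0" "a \<noteq> 0" "c \<noteq> 0" and g: "bform B e1 e2 = b" "bform B e2 e2 = 0"
    "bform B e3 e3 = a" "bform B e4 e4 = c" "bform B e1 e3 = 0" "bform B e1 e4 = 0"
    "bform B e2 e3 = 0" "bform B e2 e4 = 0" "bform B e3 e4 = 0"
    by (rule hyperbolic_splitting[OF _ e1']) simp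
  \<comment> \<open>The hyperbolic pair is rescaled so that its cross term becomes
    \<open>- a * y1 * y2\<close>. Then \<open>- a\<close> can be taken out of the first three terms,
    and \<open>d = - c / a\<close> remains for the fourth.\<close>
  obtain r where r: "r * b = - a / 2" using nz by (metis nonzero_divide_eq_eq)
  define f2 where "f2 = r *s e2"
  note s = bform_sym[OF sym]
  have gram: "bform B e1 e1 = 0" "bform B e1 f2 = - a / 2" "bform B e1 e3 = 0" "bform B e1 e4 = 0"
    "bform B f2 e1 = - a / 2" "bform B f2 f2 = 0" "bform B f2 e3 = 0" "bform B f2 e4 = 0"
    "bform B e3 e1 = 0" "bform B e3 f2 = 0" "bform B e3 e3 = a" "bform B e3 e4 = 0"
    "bform B e4 e1 = 0" "bform B e4 f2 = 0" "bform B e4 e3 = 0" "bform B e4 e4 = c"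
    using nz g e1' s[of e2 e1] s[of e3 e1] s[of e4 e1] s[of e3 e2] s[of e4 e2] s[of e4 e3]
    by (simp_all add: f2_def bform_scale r)
  define M :: "'k^4^4" where "M = (\<chi> i j. if j = 1 then e1 $ i else if j = 2 then f2 $ i else if j = 3 then e3 $ i else e4 $ i)"
  have M: "M *v y = y $ 1 *s e1 + y $ 2 *s f2 + y $ 3 *s e3 + y $ 4 *s e4" for y
    by (simp add: M_def vec_eq_iff matrix_vector_mult_def sum_4 mult.commute)
  have acM: "ac_mat M *v y = y $ 1 *s ac_vec e1 + y $ 2 *s ac_vec f2 + y $ 3 *s ac_vec e3 + y $ 4 *s ac_vec e4" for y
    by (simp add: M_def vec_eq_iff matrix_vector_mult_def sum_4 mult.commute)
  have "y = 0" if "M *v y = 0" for y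
  proof -
    have "bform B (M *v y) e1 = 0" "bform B (M *v y) f2 = 0" "bform B (M *v y) e3 = 0" "bform B (M *v y) e4 = 0"
      using that by simp_all
    then show ?thesis using nz by (simp add: M bform_add bform_scale gram vec4_eq_iff)
  qed
  then obtain M' where "M' ** M = mat 1" using matrix_left_invertible_ker[of M] by blast
  then have M': "M' ** M = mat 1" "M ** M' = mat 1" using matrix_left_right_inverse by blast+
  show ?thesis
  proof (rule that[OF M'(2,1), of "- a" "- c / a"])
    show "- a \<noteq> 0" "- c / a \<noteq> 0" using nz by simp_all
    fix y
    have "mpoly_eval q (ac_mat M *v y) = - (to_ac a * (y $ 1 * y $ 2)) + to_ac a * (y $ 3)\<^sup>2 + to_ac c * (y $ 4)\<^sup>2"
      unfolding ev' acM bform_add bform_scale ac gram by (simp add: power2_eq_square algebra_simps)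
    also have "\<dots> = to_ac (- a) * (y $ 1 * y $ 2 - (y $ 3)\<^sup>2 + to_ac (- c / a) * (y $ 4)\<^sup>2)"
      using nz by (simp add: algebra_simps)
    finally show "mpoly_eval q (ac_mat M *v y) = to_ac (- a) * (y $ 1 * y $ 2 - (y $ 3)\<^sup>2 + to_ac (- c / a) * (y $ 4)\<^sup>2)" .
  qed
qed

text \<open>The change of coordinates that factors \<open>z\<^sup>2 - \<delta>\<^sup>2 w\<^sup>2\<close>, and its inverse.\<close>

definition factor_mat :: "'a::field \<Rightarrow> 'a^4^4" where
  "factor_mat \<delta> = (\<chi> i j. if i = 1 then (if j = 1 then 1 else 0) else if i = 2 then (if j = 2 then 1 else 0)
     else if i = 3 then (if j = 3 \<or> j = 4 then 1 / 2 else 0)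
     else (if j = 3 then 1 / (2 * \<delta>) else if j = 4 then - 1 / (2 * \<delta>) else 0))"

definition unfactor_mat :: "'a::field \<Rightarrow> 'a^4^4" where
  "unfactor_mat \<delta> = (\<chi> i j. if i = 1 then (if j = 1 then 1 else 0) else if i = 2 then (if j = 2 then 1 else 0)
     else if i = 3 then (if j = 3 then 1 else if j = 4 then \<delta> else 0)
     else (if j = 3 then 1 else if j = 4 then - \<delta> else 0))"

lemma factor_mat_nth:
  "(factor_mat \<delta> *v y) $ 1 = y $ 1" "(factor_mat \<delta> *v y) $ 2 = y $ 2"
  "(factor_mat \<delta> *v y) $ 3 = (y $ 3 + y $ 4) / 2" "(factor_mat \<delta> *v y) $ 4 = (y $ 3 - y $ 4) / (2 * \<delta>)"
  by (simp_all add: factor_mat_def matrix_vector_mult_def sum_4 add_divide_distrib diff_divide_distrib)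

lemma unfactor_mat_nth:
  "(unfactor_mat \<delta> *v y) $ 1 = y $ 1" "(unfactor_mat \<delta> *v y) $ 2 = y $ 2"
  "(unfactor_mat \<delta> *v y) $ 3 = y $ 3 + \<delta> * y $ 4" "(unfactor_mat \<delta> *v y) $ 4 = y $ 3 - \<delta> * y $ 4"
  by (simp_all add: unfactor_mat_def matrix_vector_mult_def sum_4)

lemma factor_unfactor:
  fixes \<delta> :: "'a::field_char_0"
  assumes "\<delta> \<noteq> 0"
  shows "factor_mat \<delta> ** unfactor_mat \<delta> = mat 1" "unfactor_mat \<delta> ** factor_mat \<delta> = mat 1"
proof -
  have "unfactor_mat \<delta> *v (factor_mat \<delta> *v y) = y" for y
    using assms by (simp add: vec4_eq_iff unfactor_mat_nth factor_mat_nth field_simps)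
  then show *: "unfactor_mat \<delta> ** factor_mat \<delta> = mat 1"
    by (simp add: matrix_eq flip: matrix_vector_mul_assoc)
  show "factor_mat \<delta> ** unfactor_mat \<delta> = mat 1" using * matrix_left_right_inverse by blast
qed

lemma ac_mat_factor: "ac_mat (factor_mat e) = factor_mat (to_ac e)" "ac_mat (unfactor_mat e) = unfactor_mat (to_ac e)"
  by (simp_all add: vec_eq_iff factor_mat_def unfactor_mat_def)

section \<open>Split quadrics\<close>

lemma linear_form_eval:
  fixes a :: "'i::finite \<Rightarrow> 'k::field"
  defines "f \<equiv> \<Sum>i\<in>UNIV. Poly_Mapping.single (Poly_Mapping.single i (1::nat)) (a i)"
  shows "homogeneous 1 f" "mpoly_eval f x = (\<Sum>i\<in>UNIV. to_ac (a i) * x $ i)"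
proof -
  have "Poly_Mapping.keys f \<subseteq> (\<Union>i\<in>UNIV. {Poly_Mapping.single i (1::nat)})"
    unfolding f_def by (rule order_trans[OF Poly_Mapping.keys_sum]) auto
  moreover have "(\<Sum>j\<in>UNIV. Poly_Mapping.lookup (Poly_Mapping.single i (1::nat)) j) = 1" for i :: 'i
    by (simp add: lookup_single when_def)
  ultimately show "homogeneous 1 f" unfolding homogeneous_def by blast
  have "(\<Prod>j\<in>UNIV. x $ j ^ Poly_Mapping.lookup (Poly_Mapping.single i (1::nat)) j) = x $ i" for i
    using prod_power_delta[of "\<lambda>j. x $ j" i] by (simp add: lookup_single when_def eq_commute[of i] One_nat_def[symmetric] del: One_nat_def)
  then show "mpoly_eval f x = (\<Sum>i\<in>UNIV. to_ac (a i) * x $ i)"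
    unfolding f_def mpoly_eval_sum mpoly_eval_single by simp
qed

text \<open>A linear map respects scaling, so the chosen representative of a point is immaterial.
  One formula, with the whole projective space as neighbourhood, serves all points.\<close>

lemma linear_morphism:
  fixes A :: "'k::field^'i::finite^'j::finite"
  assumes V: "V \<subseteq> proj_space" and maps: "\<And>x. x \<noteq> 0 \<Longrightarrow> point_of x \<in> V \<Longrightarrow> point_of (ac_mat A *v x) \<in> W"
  shows "is_morphism V W (\<lambda>P. point_of (ac_mat A *v (SOME x. x \<in> P)))"
    and "\<And>x. point_of (ac_mat A *v (SOME y. y \<in> point_of x)) = point_of (ac_mat A *v x)"
proof -
  show eq: "point_of (ac_mat A *v (SOME y. y \<in> point_of x)) = point_of (ac_mat A *v x)" for x
  proof -
    have "(SOME y. y \<in> point_of x) \<in> point_of x" using self_mem_point_of by (rule someI)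
    then show ?thesis by (auto simp: mem_point_of vector_scalar_commute point_of_smult)
  qed
  have Vx: "\<exists>x. x \<noteq> 0 \<and> P = point_of x" if "P \<in> V" for P using that V by (auto simp: proj_space_def)
  show "is_morphism V W (\<lambda>P. point_of (ac_mat A *v (SOME x. x \<in> P)))"
    unfolding is_morphism_def
  proof (intro conjI ballI)
    show "(\<lambda>P. point_of (ac_mat A *v (SOME x. x \<in> P))) \<in> V \<rightarrow> W" using Vx maps by (force simp: eq)
    fix P assume P: "P \<in> V"
    define F where "F j = (\<Sum>i\<in>UNIV. Poly_Mapping.single (Poly_Mapping.single i (1::nat)) (A $ j $ i))" for j
    have hom: "\<forall>j. homogeneous 1 (F j)" unfolding F_def using linear_form_eval(1) by blast
    have F: "(\<chi> j. mpoly_eval (F j) x) = ac_mat A *v x" for x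
      unfolding F_def linear_form_eval(2) by (simp add: vec_eq_iff matrix_vector_mult_def)
    have "\<forall>Q\<in>V \<inter> proj_space. \<forall>x\<in>Q. (\<chi> j. mpoly_eval (F j) x) \<in> point_of (ac_mat A *v (SOME x. x \<in> Q))"
    proof (intro ballI)
      fix Q x assume "Q \<in> V \<inter> proj_space" "x \<in> Q"
      then have "Q = point_of x" using proj_space_mem by blast
      then show "(\<chi> j. mpoly_eval (F j) x) \<in> point_of (ac_mat A *v (SOME x. x \<in> Q))"
        by (simp add: eq F self_mem_point_of)
    qed
    then show "\<exists>U d F. zariski_open U \<and> P \<in> U \<and> (\<forall>j. homogeneous d (F j)) \<and>
        (\<forall>Q\<in>V \<inter> U. \<forall>x\<in>Q. (\<chi> j. mpoly_eval (F j) x) \<in> point_of (ac_mat A *v (SOME x. x \<in> Q)))"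
      using zariski_open_proj_space P V hom by blast
  qed
qed

lemma linear_isomorphic_var:
  fixes A :: "'k::field^'i::finite^'j::finite" and A' :: "'k^'j^'i"
  assumes V: "V \<subseteq> proj_space" and W: "W \<subseteq> proj_space"
    and inv: "\<And>x. ac_mat A' *v (ac_mat A *v x) = x" "\<And>y. ac_mat A *v (ac_mat A' *v y) = y"
    and maps: "\<And>x. point_of x \<in> V \<longleftrightarrow> point_of (ac_mat A *v x) \<in> W"
  shows "isomorphic_var V W"
proof -
  have maps': "point_of (ac_mat A' *v y) \<in> V" if "point_of y \<in> W" for y
    using that maps[of "ac_mat A' *v y"] inv by simp
  note A = linear_morphism[OF V, of A W] and A' = linear_morphism[OF W, of A' V]
  have P: "\<exists>x. P = point_of x" if "P \<in> proj_space" for P :: "('k, 'n::finite) point"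
    using that by (auto simp: proj_space_def)
  show ?thesis unfolding isomorphic_var_def
  proof (intro exI conjI ballI)
    show "is_morphism V W (\<lambda>P. point_of (ac_mat A *v (SOME x. x \<in> P)))" using A maps by blast
    show "is_morphism W V (\<lambda>P. point_of (ac_mat A' *v (SOME x. x \<in> P)))" using A' maps' by blast
    fix P assume "P \<in> V"
    then obtain x where "P = point_of x" using V P by blast
    then show "point_of (ac_mat A' *v (SOME x. x \<in> point_of (ac_mat A *v (SOME x. x \<in> P)))) = P"
      using A(2) A'(2) maps maps' inv by simp
  next
    fix Q assume "Q \<in> W"
    then obtain y where "Q = point_of y" using W P by blast
    then show "point_of (ac_mat A *v (SOME x. x \<in> point_of (ac_mat A' *v (SOME x. x \<in> Q)))) = Q"
      using A(2) A'(2) maps maps' inv by simp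
  qed
qed

text \<open>Follows the order of entries in \<open>quad_vec\<close>, the diagonal first, so that
  reindexing turns \<open>quad_vec\<close> into the Segre coordinates of
  \<open>product_var\<close>.\<close>

definition segre_index :: "2 \<times> 2 \<Rightarrow> 4" where
  "segre_index p = (if p = (1, 1) then 1 else if p = (2, 2) then 2 else if p = (1, 2) then 3 else 4)"

definition segre_pair :: "4 \<Rightarrow> 2 \<times> 2" where
  "segre_pair i = (if i = 1 then (1, 1) else if i = 2 then (2, 2) else if i = 3 then (1, 2) else (2, 1))"

lemma segre_pair_index [simp]: "segre_pair (segre_index p) = p" "segre_index (segre_pair i) = i"
proof -
  show "segre_pair (segre_index p) = p"
    using exhaust_2[of "fst p"] exhaust_2[of "snd p"] by (cases p) (auto simp: segre_pair_def segre_index_def)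
  show "segre_index (segre_pair i) = i"
    using exhaust_4[of i] by (auto simp: segre_pair_def segre_index_def)
qed

text \<open>When the matrices of the coordinate change have entries in \<open>K\<close>, the
  parametrization by rank one matrices is the Segre embedding up to a linear change over
  \<open>K\<close>. The excluded isomorphism then exists.\<close>

lemma (in geometric_quadric) split_isomorphic:
  assumes N: "N = ac_mat K" "N' = ac_mat K'"
  shows "isomorphic_var S (product_var (proj_space :: ('k, 2) point set) (proj_space :: ('k, 2) point set))"
proof -
  define R :: "'k^4^(2 \<times> 2)" where "R = (\<chi> p i. if i = segre_index p then 1 else 0)"
  define R' :: "'k^(2 \<times> 2)^4" where "R' = (\<chi> i p. if p = segre_pair i then 1 else 0)"
  have delta: "(\<Sum>i\<in>UNIV. to_ac (if i = k then 1 else 0 :: 'k) * y i) = y k" for k :: "'n::finite" and y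
  proof -
    have "(\<Sum>i\<in>UNIV. to_ac (if i = k then 1 else 0 :: 'k) * y i) = (\<Sum>i\<in>UNIV. if i = k then y i else 0)"
      by (intro sum.cong refl) simp
    then show ?thesis by simp
  qed
  have R: "(ac_mat R *v y) $ p = y $ segre_index p" for y p
    unfolding matrix_vector_mult_def R_def by (simp add: delta)
  have R': "(ac_mat R' *v z) $ i = z $ segre_pair i" for z i
    unfolding matrix_vector_mult_def R'_def by (simp add: delta)
  have A: "ac_mat (R ** K') *v x = ac_mat R *v (N' *v x)" for x
    by (simp add: N ac_mat_mult matrix_vector_mul_assoc)
  have A': "ac_mat (K ** R') *v x = N *v (ac_mat R' *v x)" for x
    by (simp add: N ac_mat_mult matrix_vector_mul_assoc)
  have NN: "N *v (N' *v x) = x" "N' *v (N *v x) = x" for x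
    by (simp_all add: matrix_vector_mul_assoc N_inv)
  have RR: "ac_mat R' *v (ac_mat R *v y) = y" "ac_mat R *v (ac_mat R' *v z) = z" for y z
    by (simp_all add: vec_eq_iff R R')
  have seg: "ac_mat R *v quad_vec (u $ 1) (u $ 2) (v $ 1) (v $ 2) = (\<chi> p. u $ fst p * v $ snd p)" for u v
  proof -
    have "quad_vec (u $ 1) (u $ 2) (v $ 1) (v $ 2) $ segre_index p = u $ fst p * v $ snd p" for p
      using exhaust_2[of "fst p"] exhaust_2[of "snd p"] by (cases p) (auto simp: segre_index_def)
    then show ?thesis by (simp add: vec_eq_iff R)
  qed
  have prod: "product_var (proj_space :: ('k, 2) point set) (proj_space :: ('k, 2) point set) =
    {point_of (ac_mat R *v (N' *v parv u v)) |u v. u \<noteq> 0 \<and> v \<noteq> 0}"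
    unfolding product_var_def parv_def N'_par seg using point_of_in_proj_space by blast
  show ?thesis
  proof (rule linear_isomorphic_var[of _ _ "K ** R'" "R ** K'"])
    show "S \<subseteq> proj_space" by (rule S_subset)
    show "product_var (proj_space :: ('k, 2) point set) (proj_space :: ('k, 2) point set) \<subseteq> proj_space"
    proof -
      have "ac_mat R *v (N' *v parv u v) \<noteq> 0" if "u \<noteq> 0" "v \<noteq> 0" for u v
      proof
        assume "ac_mat R *v (N' *v parv u v) = 0"
        then have "N *v (ac_mat R' *v (ac_mat R *v (N' *v parv u v))) = N *v (ac_mat R' *v 0)" by simp
        then have "parv u v = 0" by (simp add: RR NN)
        then show False using that par_nonzero pair_nonzero_iff unfolding parv_def by metis
      qed
      then show ?thesis unfolding prod using point_of_in_proj_space by blast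
    qed
    show "ac_mat (K ** R') *v (ac_mat (R ** K') *v x) = x" for x by (simp add: A A' RR NN)
    show "ac_mat (R ** K') *v (ac_mat (K ** R') *v y) = y" for y by (simp add: A A' RR NN)
    fix x
    show "point_of x \<in> S \<longleftrightarrow> point_of (ac_mat (R ** K') *v x)
      \<in> product_var (proj_space :: ('k, 2) point set) (proj_space :: ('k, 2) point set)"
    proof
      assume "point_of x \<in> S"
      then obtain u v where uv: "u \<noteq> 0" "v \<noteq> 0" "point_of x = point_of (parv u v)" by (rule S_cases_vec)
      then obtain c where "c \<noteq> 0" "x = c *s parv u v" using self_mem_point_of mem_point_of by metis
      then have "point_of (ac_mat (R ** K') *v x) = point_of (ac_mat R *v (N' *v parv u v))"
        by (simp add: A vector_scalar_commute point_of_smult)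
      then show "point_of (ac_mat (R ** K') *v x) \<in> product_var proj_space proj_space"
        unfolding prod using uv by blast
    next
      assume "point_of (ac_mat (R ** K') *v x) \<in> product_var (proj_space :: ('k, 2) point set) (proj_space :: ('k, 2) point set)"
      then obtain u v where uv: "u \<noteq> 0" "v \<noteq> 0"
        "point_of (ac_mat R *v (N' *v x)) = point_of (ac_mat R *v (N' *v parv u v))"
        unfolding prod A by blast
      then obtain c where c: "c \<noteq> 0" "ac_mat R *v (N' *v x) = c *s (ac_mat R *v (N' *v parv u v))"
        using self_mem_point_of mem_point_of by metis
      then have "N *v (ac_mat R' *v (ac_mat R *v (N' *v x))) = N *v (ac_mat R' *v (c *s (ac_mat R *v (N' *v parv u v))))" by simp
      then have "x = c *s parv u v" by (simp add: vector_scalar_commute RR NN)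
      then show "point_of x \<in> S" using parv_in_S[OF uv(1,2)] c by (simp add: point_of_smult)
    qed
  qed
qed

theorem proposition1p6:
  fixes q :: "('k::field_char_0, 4) mpoly"
    and S :: "('k, 4) point set"
  assumes "homogeneous 2 q" and "q \<noteq> 0"
    and "S = zero_locus {q}"
    and "smooth_hypersurface q"
    and "rational_surface S"
    and "\<not> isomorphic_var S
           (product_var (proj_space :: ('k, 2) point set)
             (proj_space :: ('k, 2) point set))"
  shows "jordan_constant (Aut S) \<le> 120"
proof -
  obtain P x where P: "P \<in> S" "x \<in> P" "kvec x" using rational_surface_kvec[OF assms(5)] .
  have "P \<in> proj_space" "mpoly_eval q x = 0" using P assms(3) by (auto simp: zero_locus_def)
  then have x: "x \<noteq> 0" "mpoly_eval q x = 0" using proj_space_mem P by blast+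
  obtain M M' :: "'k^4^4" and \<kappa> d where M: "M ** M' = mat 1" "M' ** M = mat 1" "\<kappa> \<noteq> 0" "d \<noteq> 0"
    and nf: "\<And>y. mpoly_eval q (ac_mat M *v y) = to_ac \<kappa> * (y $ 1 * y $ 2 - (y $ 3)\<^sup>2 + to_ac d * (y $ 4)\<^sup>2)"
    using quadric_normal_form[OF assms(1,4) P(3) x] by blast
  obtain \<delta> where \<delta>: "\<delta>\<^sup>2 = to_ac d"
  proof -
    have "\<exists>\<delta>. poly [:- to_ac d, 0, 1:] \<delta> = 0" by (rule alg_closed_imp_poly_has_root) simp
    then show ?thesis using that by (auto simp: power2_eq_square)
  qed
  have \<delta>0: "\<delta> \<noteq> 0" using \<delta> M by auto
  define N where "N = ac_mat M ** factor_mat \<delta>"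
  define N' where "N' = unfactor_mat \<delta> ** ac_mat M'"
  have inv: "ac_mat M ** ac_mat M' = mat 1" "ac_mat M' ** ac_mat M = mat 1"
    using M by (simp_all add: ac_mat_one flip: ac_mat_mult)
  have NN: "N ** N' = mat 1" "N' ** N = mat 1"
    unfolding N_def N'_def using factor_unfactor[OF \<delta>0] inv
    by (metis matrix_mul_assoc matrix_mul_rid)+
  have qN: "mpoly_eval q (N *v y) = to_ac \<kappa> * (y $ 1 * y $ 2 - y $ 3 * y $ 4)" for y
  proof -
    have "((y $ 3 + y $ 4) / 2)\<^sup>2 - to_ac d * ((y $ 3 - y $ 4) / (2 * \<delta>))\<^sup>2 = y $ 3 * y $ 4"
      using \<delta>0 by (simp add: power_divide power_mult_distrib flip: \<delta>) (simp add: power2_eq_square field_simps)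
    moreover have "p - A + B = p - C" if "A - B = C" for p A B C :: "'k alg_closure"
      unfolding that[symmetric] by simp
    ultimately have "y $ 1 * y $ 2 - ((y $ 3 + y $ 4) / 2)\<^sup>2 + to_ac d * ((y $ 3 - y $ 4) / (2 * \<delta>))\<^sup>2
        = y $ 1 * y $ 2 - y $ 3 * y $ 4"
      by blast
    then show ?thesis
      unfolding N_def matrix_vector_mul_assoc[symmetric] nf factor_mat_nth by (rule arg_cong)
  qed
  have S: "S = {point_of x |x. x \<noteq> 0 \<and> (N' *v x) $ 1 * (N' *v x) $ 2 = (N' *v x) $ 3 * (N' *v x) $ 4}"
  proof -
    have "mpoly_eval q x = 0 \<longleftrightarrow> (N' *v x) $ 1 * (N' *v x) $ 2 = (N' *v x) $ 3 * (N' *v x) $ 4" for x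
      using qN[of "N' *v x"] M(3) NN by (simp add: matrix_vector_mul_assoc)
    moreover have "(\<forall>y\<in>point_of x. mpoly_eval q y = 0) \<longleftrightarrow> mpoly_eval q x = 0" for x
    proof
      show "mpoly_eval q x = 0" if "\<forall>y\<in>point_of x. mpoly_eval q y = 0" using that self_mem_point_of by blast
      show "\<forall>y\<in>point_of x. mpoly_eval q y = 0" if "mpoly_eval q x = 0"
        using that by (auto simp: mem_point_of mpoly_eval_scale[OF assms(1)])
    qed
    ultimately show ?thesis unfolding assms(3) zero_locus_def proj_space_def by auto
  qed
  interpret geometric_quadric N N' S by unfold_locales (rule NN S)+
  \<comment> \<open>If \<open>\<delta>\<close> were in \<open>K\<close>, the factorization of the
    normal form and with it \<open>N\<close> would be defined over \<open>K\<close>, and the quadric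
    would be split.\<close>
  have nsq: "\<delta> \<notin> range to_ac"
  proof
    assume "\<delta> \<in> range to_ac"
    then obtain e where "\<delta> = to_ac e" by blast
    then have "N = ac_mat (M ** factor_mat e)" "N' = ac_mat (unfactor_mat e ** M')"
      by (simp_all add: N_def N'_def ac_mat_mult ac_mat_factor)
    then show False using split_isomorphic assms(6) by blast
  qed
  have kv: "kvec (N *v y) \<longleftrightarrow> (\<exists>k1 k2 z w. y $ 1 = to_ac k1 \<and> y $ 2 = to_ac k2 \<and>
      y $ 3 = to_ac z + \<delta> * to_ac w \<and> y $ 4 = to_ac z - \<delta> * to_ac w)" (is "_ \<longleftrightarrow> ?rhs") for y
  proof -
    \<comment> \<open>\<open>N *v y\<close> arises from \<open>?t\<close> by a matrix invertible
      over \<open>K\<close>, so both are rational together; the last two entries of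
      \<open>?t\<close> are the components \<open>z\<close> and \<open>w\<close> of the conjugate
      coordinates.\<close>
    let ?t = "factor_mat \<delta> *v y"
    have "ac_mat M' *v (ac_mat M *v ?t) = ?t"
      unfolding matrix_vector_mul_assoc[of "ac_mat M'" "ac_mat M"] inv by (rule matrix_vector_mul_lid)
    then have "kvec (N *v y) \<longleftrightarrow> kvec ?t"
      unfolding N_def matrix_vector_mul_assoc[symmetric] using kvec_ac_mat by metis
    also have "\<dots> \<longleftrightarrow> ?rhs"
    proof
      assume "kvec ?t"
      then obtain k where k: "?t = ac_vec k" using kvec_iff_range by blast
      have "y = unfactor_mat \<delta> *v ac_vec k"
        using factor_unfactor(2)[OF \<delta>0] by (simp add: matrix_vector_mul_assoc flip: k)
      then show ?rhs
        by (intro exI[of _ "k $ 1"] exI[of _ "k $ 2"] exI[of _ "k $ 3"] exI[of _ "k $ 4"]) (simp add: unfactor_mat_nth)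
    next
      assume ?rhs
      then obtain k1 k2 z w where "y $ 1 = to_ac k1" "y $ 2 = to_ac k2"
        "y $ 3 = to_ac z + \<delta> * to_ac w" "y $ 4 = to_ac z - \<delta> * to_ac w" by blast
      then have "?t $ 1 = to_ac k1" "?t $ 2 = to_ac k2" "?t $ 3 = to_ac z" "?t $ 4 = to_ac w"
        using \<delta>0 by (simp_all add: factor_mat_nth)
      then show "kvec ?t" by (simp add: kvec_def forall_4)
    qed
    finally show ?thesis .
  qed
  interpret arithmetic_quadric N N' S \<delta> by unfold_locales (rule nsq kv)+
  show ?thesis by (rule jordan_constant_Aut_le)
qed

end
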